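(* Let $X\subset\mathbb R$ satisfy (X1) and (X2) and let $V:\mathbb R\to\mathbb R$ satisfy (V1) and (V2) (spelled out in the context). Then for every $n\in\mathbb Z$ there is a Gibbs measure $\mu\in\mathcal G$ such that $\mu(F=n)=1$.
   Context: Point sets. (X1): $X$ is locally finite (every bounded subset is finite) and bi-infinite (unbounded above and below). For $a\in\mathbb R$ let $c_g(a):=\inf\{c\ge0:\ \#\{x\in X:0<|x-a|\le t\}\le ct\text{ for all }t>0\}$ ($\inf\emptyset=\infty$). (X2): $c_g(a)<\infty$ for some $a\in\mathbb R$. $X^\star$ is the set of midpoints of consecutive points of $X$. $\Lambda\Subset X$ means $\Lambda$ is a finite subset of $X$; $\Lambda^c:=X\setminus\Lambda$. Potential. (V1): $V$ is symmetric ($V(x)=V(-x)$) and strictly convex. (V2): for every $d>0$, $\frac{V(x)+V(0)-2V((x+d)/2)}{x\log x}\to\infty$ as $x\to\infty$. Permutations and flow. $\Omega_X$ is the set of all bijections $\sigma:X\to X$. For $a\in X^\star$ let $F_a^+(\sigma):=\#\{x\in X: x<a<\sigma(x)\}$, $F_a^-(\sigma):=\#\{x\in X:\sigma(x)<a<x\}$, and $F_a(\sigma):=F_a^+(\sigma)-F_a^-(\sigma)$ if both are finite, $F_a(\sigma):=\infty$ otherwise. The value $F_a(\sigma)$ does not depend on $a\in X^\star$; the common value is the flow $F(\sigma)\in\mathbb Z\cup\{\infty\}$. Gibbs measures. $\mathcal F_X$ is the $\sigma$-algebra on $\Omega_X$ generated by the maps $\sigma\mapsto\sigma(x)$ and $\sigma\mapsto\sigma^{-1}(x)$,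 $x\in X$. For $\Lambda\Subset X$: $\sigma\sim_\Lambda\eta$ iff $\sigma(x)=\eta(x)$ and $\sigma^{-1}(x)=\eta^{-1}(x)$ for all $x\in\Lambda^c$; $H_\Lambda(\sigma):=\sum_{x\in\Lambda\cap\sigma^{-1}(\Lambda)}V(\sigma(x)-x)$; and $\gamma_\Lambda(\cdot|\eta)$ is the discrete probability measure on $\Omega_X$ with $\gamma_\Lambda(\{\sigma\}|\eta)=\frac1{Z_\Lambda(\eta)}e^{-H_\Lambda(\sigma)}1_{\{\sigma\sim_\Lambda\eta\}}$, $Z_\Lambda(\eta):=\sum_{\sigma\sim_\Lambda\eta}e^{-H_\Lambda(\sigma)}$. A Gibbs measure is a probability measure $\mu$ on $(\Omega_X,\mathcal F_X)$ with $E_\mu(\gamma_\Lambda(A|\cdot))=\mu(A)$ for all $A\in\mathcal F_X$ and $\Lambda\Subset X$. $\mathcal G$ is the set of Gibbs measures. *)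

theory Defs
  imports "HOL-Probability.Probability" "HOL-Combinatorics.Permutations"
begin

definition locally_finite :: "real set \<Rightarrow> bool" where
  "locally_finite X \<longleftrightarrow> (\<forall>B. B \<subseteq> X \<and> bounded B \<longrightarrow> finite B)"

definition bi_infinite :: "real set \<Rightarrow> bool" where
  "bi_infinite X \<longleftrightarrow> \<not> bdd_above X \<and> \<not> bdd_below X"

definition X1 :: "real set \<Rightarrow> bool" where
  "X1 X \<longleftrightarrow> locally_finite X \<and> bi_infinite X"

text \<open>Finiteness is part of the bound because \<^const>\<open>card\<close> is 0 on infinite sets; the infimum is
  taken in the extended reals, where it is \<open>\<infinity>\<close> on the empty set.\<close>

definition growth_const :: "real set \<Rightarrow> real \<Rightarrow> ereal" where
  "growth_const X a = Inf {ereal c | c. 0 \<le> c \<and>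
     (\<forall>t>0. finite {x \<in> X. 0 < \<bar>x - a\<bar> \<and> \<bar>x - a\<bar> \<le> t} \<and>
            real (card {x \<in> X. 0 < \<bar>x - a\<bar> \<and> \<bar>x - a\<bar> \<le> t}) \<le> c * t)}"

definition X2 :: "real set \<Rightarrow> bool" where
  "X2 X \<longleftrightarrow> (\<exists>a. growth_const X a < \<infinity>)"

definition midpoints :: "real set \<Rightarrow> real set" where
  "midpoints X = {(x + y) / 2 | x y. x \<in> X \<and> y \<in> X \<and> x < y \<and> {x<..<y} \<inter> X = {}}"

definition strictly_convex :: "(real \<Rightarrow> real) \<Rightarrow> bool" where
  "strictly_convex V \<longleftrightarrow> (\<forall>x y t. x \<noteq> y \<and> 0 < t \<and> t < 1 \<longrightarrow>
     V ((1 - t) * x + t * y) < (1 - t) * V x + t * V y)"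

definition V1 :: "(real \<Rightarrow> real) \<Rightarrow> bool" where
  "V1 V \<longleftrightarrow> (\<forall>x. V x = V (- x)) \<and> strictly_convex V"

definition V2 :: "(real \<Rightarrow> real) \<Rightarrow> bool" where
  "V2 V \<longleftrightarrow> (\<forall>d>0. filterlim (\<lambda>x. (V x + V 0 - 2 * V ((x + d) / 2)) / (x * ln x)) at_top at_top)"

text \<open>A bijection of \<open>X\<close> is represented by its extension to all of \<open>\<real>\<close> by the identity off \<open>X\<close>.
  So \<^term>\<open>inv \<sigma>\<close> extends the inverse bijection in the same way.\<close>

definition Perms :: "real set \<Rightarrow> (real \<Rightarrow> real) set" where
  "Perms X = {\<sigma>. \<sigma> permutes X}"

definition flow_right :: "real set \<Rightarrow> real \<Rightarrow> (real \<Rightarrow> real) \<Rightarrow> real set" where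
  "flow_right X a \<sigma> = {x \<in> X. x < a \<and> a < \<sigma> x}"

definition flow_left :: "real set \<Rightarrow> real \<Rightarrow> (real \<Rightarrow> real) \<Rightarrow> real set" where
  "flow_left X a \<sigma> = {x \<in> X. \<sigma> x < a \<and> a < x}"

text \<open>The value \<^term>\<open>None\<close> stands for \<open>\<infinity>\<close>.\<close>

definition flow_at :: "real set \<Rightarrow> real \<Rightarrow> (real \<Rightarrow> real) \<Rightarrow> int option" where
  "flow_at X a \<sigma> =
     (if finite (flow_right X a \<sigma>) \<and> finite (flow_left X a \<sigma>)
      then Some (int (card (flow_right X a \<sigma>)) - int (card (flow_left X a \<sigma>)))
      else None)"

text \<open>On bijections of a locally finite bi-infinite set, \<^const>\<open>flow_at\<close> takes the same value at
  all midpoints, so this description is proper there.\<close>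

definition flow :: "real set \<Rightarrow> (real \<Rightarrow> real) \<Rightarrow> int option" where
  "flow X \<sigma> = (THE f. \<forall>a \<in> midpoints X. flow_at X a \<sigma> = f)"

text \<open>The \<open>\<sigma>\<close>-algebra is generated by the evaluation maps and inverse evaluation maps, as maps into
  \<open>X\<close> with the discrete \<open>\<sigma>\<close>-algebra. Only the \<open>\<sigma>\<close>-algebra of this measure space is used.\<close>

definition perm_space :: "real set \<Rightarrow> (real \<Rightarrow> real) measure" where
  "perm_space X = sigma (Perms X)
     ({{\<sigma> \<in> Perms X. \<sigma> x \<in> B} | x B. x \<in> X \<and> B \<subseteq> X} \<union>
      {{\<sigma> \<in> Perms X. inv \<sigma> x \<in> B} | x B. x \<in> X \<and> B \<subseteq> X})"

definition agree_off :: "real set \<Rightarrow> real set \<Rightarrow> (real \<Rightarrow> real) \<Rightarrow> (real \<Rightarrow> real) \<Rightarrow> bool" where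
  "agree_off X \<Lambda> \<sigma> \<eta> \<longleftrightarrow> (\<forall>x \<in> X - \<Lambda>. \<sigma> x = \<eta> x \<and> inv \<sigma> x = inv \<eta> x)"

definition Hamiltonian :: "(real \<Rightarrow> real) \<Rightarrow> real set \<Rightarrow> (real \<Rightarrow> real) \<Rightarrow> real" where
  "Hamiltonian V \<Lambda> \<sigma> = (\<Sum>x \<in> \<Lambda> \<inter> \<sigma> -` \<Lambda>. V (\<sigma> x - x))"

text \<open>For finite \<open>\<Lambda>\<close> the sum below is finite: if \<open>\<sigma>\<close> agrees with \<open>\<eta>\<close> off \<open>\<Lambda>\<close>, then \<open>\<sigma>\<close>
  restricts to a bijection from \<open>\<Lambda>\<close> to \<open>\<eta> ` \<Lambda>\<close>.\<close>

definition partition_fun ::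
  "real set \<Rightarrow> (real \<Rightarrow> real) \<Rightarrow> real set \<Rightarrow> (real \<Rightarrow> real) \<Rightarrow> real" where
  "partition_fun X V \<Lambda> \<eta> = (\<Sum>\<sigma> | \<sigma> \<in> Perms X \<and> agree_off X \<Lambda> \<sigma> \<eta>. exp (- Hamiltonian V \<Lambda> \<sigma>))"

definition gibbs_kernel ::
  "real set \<Rightarrow> (real \<Rightarrow> real) \<Rightarrow> real set \<Rightarrow> (real \<Rightarrow> real) \<Rightarrow> (real \<Rightarrow> real) measure" where
  "gibbs_kernel X V \<Lambda> \<eta> = point_measure (Perms X)
     (\<lambda>\<sigma>. ennreal (1 / partition_fun X V \<Lambda> \<eta> * exp (- Hamiltonian V \<Lambda> \<sigma>)
                   * of_bool (agree_off X \<Lambda> \<sigma> \<eta>)))"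

definition gibbs_measures :: "real set \<Rightarrow> (real \<Rightarrow> real) \<Rightarrow> (real \<Rightarrow> real) measure set" where
  "gibbs_measures X V = {\<mu>. prob_space \<mu> \<and> sets \<mu> = sets (perm_space X) \<and>
     (\<forall>\<Lambda> A. finite \<Lambda> \<and> \<Lambda> \<subseteq> X \<and> A \<in> sets (perm_space X) \<longrightarrow>
        (\<integral>\<^sup>+ \<eta>. emeasure (gibbs_kernel X V \<Lambda> \<eta>) A \<partial>\<mu>) = emeasure \<mu> A)}"

end

theory Submission
  imports Defs
begin

text \<open>
  The permutation that shifts every point of \<open>X\<close> by \<open>n\<close> places to the right has flow \<open>n\<close>. With this shift
  as boundary condition, the finite-volume measure \<open>\<gamma>\<^sub>\<Lambda>\<close> is carried by permutations of flow \<open>n\<close>: far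
  to the right of \<open>\<Lambda>\<close> nothing has been changed, and the flow is the same at all sites
  (\<open>agree_off_flow\<close>). The required Gibbs measure is a limit point of these measures as \<open>\<Lambda>\<close> grows
  to \<open>X\<close>. Two things could go wrong in the limit: images or preimages of a point may run off to
  infinity, so that the limit is not carried by bijections, and flow may be lost through longer and
  longer jumps. Both are excluded by one estimate that is uniform in \<open>\<Lambda>\<close>: for every real \<open>a\<close>, all
  pairs \<open>p\<close>, \<open>q\<close> on the two sides of \<open>a\<close>, outside a finite box, satisfy
  \<open>\<gamma>\<^sub>\<Lambda>(\<sigma> p = q) \<le> C * r(p) * r(q)\<close> with \<open>r(x) = 1 / (1 + \<bar>x\<bar>)\<^sup>2\<close>, which is summable over \<open>X\<close> by the
  linear growth of \<open>X\<close> (\<open>eventually_kernel_jump_bound\<close>, \<open>summable_decay\<close>).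

  The estimate comes from an exchange argument. Let \<open>\<sigma>\<close> have flow \<open>n\<close> and jump from \<open>x < a\<close> to
  \<open>y > b\<close>, where the window between \<open>a\<close> and \<open>b\<close> contains more than \<open>\<bar>n\<bar>\<close> points. Then some point
  \<open>u > a\<close> has its image to the left of \<open>b\<close>, since otherwise nothing would return over \<open>a\<close> and all
  points of the window would be hit from the left of \<open>a\<close>, which makes the flow too large
  (\<open>ex_exchange_partner\<close>). Exchanging the images of \<open>x\<close> and \<open>u\<close> lowers the energy by convexity, and
  it can be undone because \<open>u\<close> is the preimage of \<open>y\<close> under the new permutation. So the probability
  of the jump is at most \<open>exp\<close> of minus the least energy gain, with no entropy factor
  (\<open>exchange_bound\<close>). The second condition on \<open>V\<close> makes this gain much larger than \<open>l * ln l\<close> if the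
  window lies in the middle of a jump of length \<open>l\<close>. The gain is concave in the position of the
  window, hence a window at distance \<open>m\<close> from the end of the jump still keeps the fraction
  \<open>2 * m / l\<close> of it, and this beats any multiple of \<open>ln l\<close> (\<open>gain_ge_log\<close>). Jumps to the left are
  reduced to jumps to the right by inversion, which changes \<open>n\<close> to \<open>- n\<close>.

  For the passage to the limit, events that depend on finitely many values of the permutation and its
  inverse form an algebra that generates the \<open>\<sigma>\<close>-algebra. By Tychonoff's theorem the probabilities of
  all these events converge at once along a suitable filter, and the tightness estimate makes the
  limit continuous at the empty set, so Caratheodory's extension theorem turns it into a measure
  (\<open>tight_family_has_local_limit\<close>). The Gibbs kernel of a local event is a local function of the
  boundary condition, so the Gibbs equations survive on local events (\<open>local_integral_tendsto\<close>) and
  extend to all events. Finally, up to a small probability all jumps over a given site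
  stay in a finite box, where having flow \<open>n\<close> is a local event; therefore no flow is lost.
\<close>

section \<open>Energy gained by an exchange\<close>

text \<open>The points \<open>p + h\<close> and \<open>q\<close> lie between \<open>p\<close> and \<open>q + h\<close> and have the same sum as these end points;
  adding the two chord estimates gives the claim.\<close>

lemma convex_increments_mono:
  fixes f :: "real \<Rightarrow> real"
  assumes f: "convex_on UNIV f" and "p \<le> q" and "0 \<le> h"
  shows "f (p + h) - f p \<le> f (q + h) - f q"
proof (cases "p = q \<or> h = 0")
  case False
  define l where "l = h / (q + h - p)"
  have pos: "q + h - p > 0" and l: "0 \<le> l" "l \<le> 1"
    using False assms by (auto simp: l_def field_simps)
  have e: "l * (q + h - p) = h" using pos by (simp add: l_def)
  have 1: "f (p + h) \<le> (1 - l) * f p + l * f (q + h)"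
    using convex_onD[OF f l, of p "q + h"] e by (simp add: algebra_simps)
  have 2: "f q \<le> l * f p + (1 - l) * f (q + h)"
  proof -
    have "l * p + (1 - l) * (q + h) = q + h - l * (q + h - p)" by (simp add: algebra_simps)
    then show ?thesis using convex_onD[OF f, of "1 - l" p "q + h"] e l by simp
  qed
  from 1 2 show ?thesis by (simp add: algebra_simps)
qed auto

lemma V1_convex:
  assumes "V1 V" shows "convex_on UNIV V"
proof (rule convex_onI)
  fix t x y :: real assume t: "0 < t" "t < 1"
  show "V ((1 - t) *\<^sub>R x + t *\<^sub>R y) \<le> (1 - t) * V x + t * V y"
  proof (cases "x = y")
    case True
    then show ?thesis by (simp add: algebra_simps)
  next
    case False
    then show ?thesis using assms t unfolding V1_def strictly_convex_def by (simp add: less_imp_le)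
  qed
qed simp

lemma V1_min_at_0:
  assumes "V1 V" shows "V 0 \<le> V x"
  using convex_onD[OF V1_convex[OF assms], of "1/2" x "- x"] assms by (simp add: V1_def)

text \<open>The drop of energy when a jump of length \<open>s + t + d\<close> over a window of length \<open>d\<close>, starting \<open>s\<close> before
  the window and ending \<open>t\<close> behind it, exchanges images with a jump from the left to the right end of
  the window.\<close>

definition gain :: "(real \<Rightarrow> real) \<Rightarrow> real \<Rightarrow> real \<Rightarrow> real \<Rightarrow> real" where
  "gain V d s t = V (s + t + d) + V d - V (s + d) - V (t + d)"

text \<open>By convexity the drop of energy increases if the start \<open>u\<close> of the second jump moves to the right or
  its end \<open>v\<close> moves to the left. The least favourable partner therefore jumps from \<open>a\<close> to \<open>b\<close>.\<close>

lemma exchange_gain: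
  assumes V: "V1 V" and "x < a" "b < y" "a < u" "v < b" 
  shows "gain V (b - a) (a - x) (y - b) \<le> V (y - x) + V (v - u) - V (v - x) - V (y - u)"
proof -
  note inc = convex_increments_mono[OF V1_convex[OF V]]
  have "V (b - u) - V (v - u) \<le> V (b - x) - V (v - x)"
    using inc[of "v - u" "v - x" "b - v"] assms by simp
  moreover have "V (y - u) - V (b - u) \<le> V (y - a) - V (b - a)"
    using inc[of "b - u" "b - a" "y - b"] assms by simp
  ultimately show ?thesis by (simp add: gain_def)
qed

lemma gain_nonneg:
  assumes V: "V1 V" and "0 \<le> s" "0 \<le> t" shows "0 \<le> gain V d s t"
  using convex_increments_mono[OF V1_convex[OF V], of d "d + t" s] assms
  by (simp add: gain_def algebra_simps)

text \<open>For fixed \<open>s + t\<close> the gain is a concave function of \<open>s\<close> which vanishes at both ends. At distance \<open>m\<close>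
  from the ends it is therefore at least the fraction \<open>2 * m / (s + t)\<close> of its value in the middle,
  where \<open>V d\<close> may be replaced by the smaller number \<open>V 0\<close> that appears in the growth condition.\<close>

lemma gain_ge_fraction_of_balanced:
  assumes V: "V1 V" and "0 < m" "m \<le> s" "m \<le> t"
    and bal: "0 \<le> V (s + t + d) + V 0 - 2 * V ((s + t) / 2 + d)"
  shows "2 * m / (s + t) * (V (s + t + d) + V 0 - 2 * V ((s + t) / 2 + d)) \<le> gain V d s t"
proof -
  have *: "2 * m / (s + t) * (V (s + t + d) + V 0 - 2 * V ((s + t) / 2 + d)) \<le> gain V d s t"
    if st: "0 < s" "s \<le> t" "m \<le> s" 
      and bal: "0 \<le> V (s + t + d) + V 0 - 2 * V ((s + t) / 2 + d)" for s t
  proof -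
    define l where "l = 2 * s / (s + t)"
    have l: "0 \<le> l" "l \<le> 1" using st by (auto simp: l_def)
    have e: "l * (s + t) = 2 * s" using st by (simp add: l_def)
    define c where "c = (s + t) / 2 + d"
    note cv = convex_onD[OF V1_convex[OF V] l]
    have "(1 - l) * d + l * c = d + l * (s + t) / 2" by (simp add: c_def algebra_simps add_divide_distrib)
    then have 1: "V (s + d) \<le> (1 - l) * V d + l * V c"
      using cv[of d c] e by (simp add: add.commute)
    have "(1 - l) * (s + t + d) + l * c = (s + t + d) - l * (s + t) / 2" 
      by (simp add: c_def algebra_simps add_divide_distrib)
    then have 2: "V (t + d) \<le> (1 - l) * V (s + t + d) + l * V c"
      using cv[of "s + t + d" c] e by simp
    have "l * (V (s + t + d) + V 0 - 2 * V c) \<le> l * (V (s + t + d) + V d - 2 * V c)"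
      using l V1_min_at_0[OF V, of d] by (intro mult_left_mono) auto
    also have "\<dots> \<le> gain V d s t" using 1 2 by (simp add: gain_def algebra_simps)
    finally have "l * (V (s + t + d) + V 0 - 2 * V c) \<le> gain V d s t" .
    moreover have "2 * m / (s + t) * (V (s + t + d) + V 0 - 2 * V c) \<le> l * (V (s + t + d) + V 0 - 2 * V c)"
      using bal st unfolding l_def by (intro mult_right_mono divide_right_mono) (auto simp: c_def)
    ultimately show ?thesis by (simp add: c_def)
  qed
  have sym: "gain V d t s = gain V d s t" by (simp add: gain_def add.commute)
  show ?thesis using *[of s t] *[of t s] assms sym
    by (cases "s \<le> t") (auto simp: add.commute)
qed

text \<open>The factor 4 provides one inverse square for each end of the jump.\<close>

lemma gain_ge_log:
  assumes V: "V1 V" "V2 V" and m: "0 < m" and d: "0 < d"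
  obtains S where "1 \<le> S" and "\<And>s t. m \<le> s \<Longrightarrow> m \<le> t \<Longrightarrow> S \<le> s + t \<Longrightarrow> 4 * ln (s + t) \<le> gain V d s t"
proof -
  define Q where "Q x = V x + V 0 - 2 * V ((x + d) / 2)" for x
  have "filterlim (\<lambda>x. Q x / (x * ln x)) at_top at_top"
    using V d unfolding V2_def Q_def by auto
  \<comment> \<open>The threshold \<open>2 / m\<close> turns the fraction \<open>2 * m / (s + t)\<close> of the balanced gain into 4 logarithms.\<close>
  then have "eventually (\<lambda>x. 2 / m \<le> Q x / (x * ln x)) at_top"
    by (rule filterlim_at_top[THEN iffD1, rule_format])
  then obtain N where N: "\<And>x. N \<le> x \<Longrightarrow> 2 / m \<le> Q x / (x * ln x)"
    by (auto simp: eventually_at_top_linorder)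
  show ?thesis
  proof (rule that[of "max 1 N"])
    fix s t assume st: "m \<le> s" "m \<le> t" "max 1 N \<le> s + t"
    define x where "x = s + t + d"
    have x: "1 < x" "N \<le> x" "s + t \<le> x" using st d by (auto simp: x_def)
    have S: "1 \<le> s + t" using st by auto
    have Qx: "2 / m * (x * ln x) \<le> Q x" using N[of x] x by (simp add: field_simps)
    have half: "(x + d) / 2 = (s + t) / 2 + d" by (simp add: x_def field_simps)
    have "0 \<le> 2 / m * (x * ln x)" using x m by simp
    then have Q0: "0 \<le> Q x" using Qx by linarith
    have "s + t \<noteq> 0" "m \<noteq> 0" using S m by auto
    then have "4 * ln (s + t) = 2 * m / (s + t) * (2 / m * ((s + t) * ln (s + t)))"
      by simp
    also have "\<dots> \<le> 2 * m / (s + t) * (2 / m * (x * ln x))"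
      using S m x by (intro mult_left_mono mult_mono) auto
    also have "\<dots> \<le> 2 * m / (s + t) * Q x"
      using Qx S m by (intro mult_left_mono) auto
    also have "\<dots> \<le> gain V d s t"
      using gain_ge_fraction_of_balanced[OF V(1) m st(1,2), of d] Q0
      unfolding Q_def half by (simp add: x_def)
    finally show "4 * ln (s + t) \<le> gain V d s t" .
  qed simp
qed

section \<open>Point sets and their growth\<close>

locale point_set =
  fixes X :: "real set"
  assumes X1: "X1 X"
begin

lemma finite_if_bounded: "B \<subseteq> X \<Longrightarrow> bounded B \<Longrightarrow> finite B"
  using X1 by (simp add: X1_def locally_finite_def)

lemma finite_bounded_part: "finite {x \<in> X. a \<le> x \<and> x \<le> b}"
proof (rule finite_if_bounded)
  show "bounded {x \<in> X. a \<le> x \<and> x \<le> b}"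
    by (rule bounded_subset[OF bounded_closed_interval[of a b]]) auto
qed auto

lemma finite_within: "A \<subseteq> X \<Longrightarrow> (\<And>x. x \<in> A \<Longrightarrow> a \<le> x \<and> x \<le> b) \<Longrightarrow> finite A"
  by (rule finite_subset[OF _ finite_bounded_part[of a b]]) auto

lemma ex_above: "\<exists>x\<in>X. b < x"
  using X1 by (auto simp: X1_def bi_infinite_def bdd_above_def not_le)

lemma ex_below: "\<exists>x\<in>X. x < b"
  using X1 by (auto simp: X1_def bi_infinite_def bdd_below_def not_le)

lemma countable_X: "countable X"
proof -
  have "X = (\<Union>k::nat. {x \<in> X. - real k \<le> x \<and> x \<le> real k})"
  proof safe
    fix x assume "x \<in> X"
    moreover obtain k :: nat where "\<bar>x\<bar> \<le> real k" using real_arch_simple by blast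
    ultimately show "x \<in> (\<Union>k::nat. {x \<in> X. - real k \<le> x \<and> x \<le> real k})"
      unfolding UN_iff by (intro bexI[of _ k]) auto
  qed
  moreover have "countable (\<Union>k::nat. {x \<in> X. - real k \<le> x \<and> x \<le> real k})"
    by (rule countable_UN) (auto intro: countable_finite finite_bounded_part)
  ultimately show ?thesis by (rule ssubst)
qed

text \<open>An arbitrary point from which the points of \<open>X\<close> are numbered.\<close>

definition origin :: real where "origin = (SOME x. x \<in> X)"

lemma origin: "origin \<in> X"
  unfolding origin_def using ex_above[of 0] by (auto intro: someI)

definition point_count :: "real \<Rightarrow> real \<Rightarrow> int" where
  "point_count a b = int (card {x \<in> X. a \<le> x \<and> x < b})"

lemma finite_point_count: "finite {x \<in> X. a \<le> x \<and> x < b}"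
  by (rule finite_within[of _ a b]) auto

lemma point_count_add: "a \<le> b \<Longrightarrow> b \<le> c \<Longrightarrow> point_count a c = point_count a b + point_count b c"
  unfolding point_count_def of_nat_add[symmetric]
  by (subst card_Un_disjoint[symmetric]) (auto intro!: finite_point_count arg_cong[where f = card])

text \<open>The number of a point of \<open>X\<close> in increasing order, with \<open>origin\<close> as number 0. This is an order
  isomorphism from \<open>X\<close> to the integers.\<close>

definition idx :: "real \<Rightarrow> int" where
  "idx x = (if origin \<le> x then point_count origin x else - point_count x origin)"

lemma idx_diff: "x \<le> y \<Longrightarrow> idx y - idx x = point_count x y"
  using point_count_add[of origin x y] point_count_add[of x origin y] point_count_add[of x y origin]
  by (auto simp: idx_def)

lemma idx_less: assumes "x \<in> X" "x < y" shows "idx x < idx y"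
proof -
  have "{z \<in> X. x \<le> z \<and> z < y} \<noteq> {}" using assms by auto
  then have "0 < point_count x y" using finite_point_count by (simp add: point_count_def card_gt_0_iff)
  then show ?thesis using idx_diff[of x y] assms by simp
qed

lemma idx_less_iff: "x \<in> X \<Longrightarrow> y \<in> X \<Longrightarrow> idx x < idx y \<longleftrightarrow> x < y"
  using idx_less[of x y] idx_less[of y x] by (cases x y rule: linorder_cases) auto

lemma idx_inj: "inj_on idx X"
proof (rule inj_onI)
  fix x y assume "x \<in> X" "y \<in> X" "idx x = idx y"
  then show "x = y" using idx_less[of x y] idx_less[of y x] by (cases x y rule: linorder_cases) auto
qed

text \<open>Local finiteness provides every point with a nearest neighbour on each side, and the numbers of
  neighbours differ by 1.\<close>

lemma idx_surj: "k \<in> idx ` X"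
proof (induction k rule: int_induct[where k = "idx origin"])
  case base
  then show ?case using origin by auto
next
  case (step1 i)
  then obtain x where x: "x \<in> X" "i = idx x" by auto
  obtain b where b: "b \<in> X" "x < b" using ex_above by auto
  have fin: "finite {z \<in> X. x < z \<and> z \<le> b}" by (rule finite_within[of _ x b]) auto
  define y where "y = Min {z \<in> X. x < z \<and> z \<le> b}"
  have y: "y \<in> {z \<in> X. x < z \<and> z \<le> b}" unfolding y_def using fin b by (intro Min_in) auto
  have "{z \<in> X. x \<le> z \<and> z < y} = {x}"
  proof safe
    fix z assume z: "z \<in> X" "x \<le> z" "z < y"
    show "z = x"
    proof (rule ccontr)
      assume "z \<noteq> x"
      then have "y \<le> z" unfolding y_def using z fin y by (intro Min_le) auto
      then show False using z by simp
    qed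
  qed (use x y in auto)
  then have "point_count x y = 1" by (simp add: point_count_def)
  then show ?case using idx_diff[of x y] y x by (intro image_eqI[of _ _ y]) auto
next
  case (step2 i)
  then obtain x where x: "x \<in> X" "i = idx x" by auto
  obtain b where b: "b \<in> X" "b < x" using ex_below by auto
  have fin: "finite {z \<in> X. b \<le> z \<and> z < x}" by (rule finite_point_count)
  define y where "y = Max {z \<in> X. b \<le> z \<and> z < x}"
  have y: "y \<in> {z \<in> X. b \<le> z \<and> z < x}" unfolding y_def using fin b by (intro Max_in) auto
  have "{z \<in> X. y \<le> z \<and> z < x} = {y}"
  proof safe
    fix z assume z: "z \<in> X" "y \<le> z" "z < x"
    have "b \<le> z" using y z by simp
    then have "z \<le> y" unfolding y_def using z(1,3) fin by (intro Max_ge) simp_all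
    then show "z = y" using z by simp
  qed (use x y in auto)
  then have "point_count y x = 1" by (simp add: point_count_def)
  then show ?case using idx_diff[of y x] y x by (intro image_eqI[of _ _ y]) auto
qed

lemma idx_bij: "bij_betw idx X UNIV"
  unfolding bij_betw_def using idx_inj idx_surj by auto

definition point :: "int \<Rightarrow> real" where "point = inv_into X idx"

lemma point_in: "point i \<in> X" and idx_point: "idx (point i) = i"
  using idx_surj[of i] by (auto simp: point_def inv_into_into f_inv_into_f)

lemma point_idx: "x \<in> X \<Longrightarrow> point (idx x) = x"
  using idx_inj by (simp add: point_def)

lemma point_less_iff: "point i < point j \<longleftrightarrow> i < j"
  using idx_less_iff[of "point i" "point j"] by (simp add: point_in idx_point)

lemma inj_point: "inj point" 
  by (rule injI) (use idx_point in metis)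

text \<open>The exchange argument needs a window with many points on either side of any given site. The ends of
  the window are placed in gaps of \<open>X\<close>.\<close>

lemma many_points_above:
  obtains a b where "c < a" "a < b" "a \<notin> X" "b \<notin> X" "N < card {x \<in> X. a < x \<and> x < b}"
proof -
  have gap: "\<exists>a. point i < a \<and> a < point (i + 1) \<and> a \<notin> X" for i
  proof (intro exI[of _ "(point i + point (i + 1)) / 2"] conjI notI)
    have l: "point i < point (i + 1)" by (simp add: point_less_iff)
    show *: "point i < (point i + point (i + 1)) / 2" "(point i + point (i + 1)) / 2 < point (i + 1)"
      using l by auto
    assume "(point i + point (i + 1)) / 2 \<in> X"
    then obtain j where "(point i + point (i + 1)) / 2 = point j" using point_idx by metis
    then have "i < j" "j < i + 1" using * by (simp_all add: point_less_iff)
    then show False by simp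
  qed
  obtain x where x: "x \<in> X" "c < x" using ex_above by auto
  obtain a where a: "point (idx x) < a" "a < point (idx x + 1)" "a \<notin> X" using gap by blast
  obtain b where b: "point (idx x + 1 + int N) < b" "b < point (idx x + 1 + int N + 1)" "b \<notin> X" 
    using gap by blast
  have sub: "point ` {idx x + 1..idx x + 1 + int N} \<subseteq> {x \<in> X. a < x \<and> x < b}"
  proof safe
    fix i assume i: "i \<in> {idx x + 1..idx x + 1 + int N}"
    show "point i \<in> X" by (rule point_in)
    have "point (idx x + 1) \<le> point i" "point i \<le> point (idx x + 1 + int N)"
      using i by (simp_all add: point_less_iff flip: not_less)
    then show "a < point i" "point i < b" using a b by auto
  qed
  have "finite {x \<in> X. a < x \<and> x < b}" by (rule finite_within[of _ a b]) auto
  from card_mono[OF this sub] have card: "N < card {x \<in> X. a < x \<and> x < b}"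
    by (simp add: card_image inj_on_subset[OF inj_point])
  have "point (idx x + 1) \<le> point (idx x + 1 + int N)" by (simp add: point_less_iff flip: not_less)
  then have "a < b" using a b by simp
  moreover have "c < a" using a x by (simp add: point_idx)
  ultimately show ?thesis using that a b card by blast
qed

end

lemma point_set_reflect: 
  assumes "point_set X" shows "point_set (uminus ` X)"
proof 
  have X: "X1 X" using assms by (simp add: point_set_def)
  have "locally_finite (uminus ` X)" unfolding locally_finite_def
  proof safe
    fix B assume B: "B \<subseteq> uminus ` X" "bounded B"
    have "bounded (uminus ` B)" using B by simp
    moreover have "uminus ` B \<subseteq> X" using B by force
    moreover have "locally_finite X" using X by (simp add: X1_def)
    ultimately have "finite (uminus ` B)" by (simp add: locally_finite_def)
    then show "finite B" by (rule finite_imageD) (auto simp: inj_on_def)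
  qed
  then show "X1 (uminus ` X)" using X unfolding X1_def bi_infinite_def
    by auto
qed

context point_set begin

lemma many_points_below:
  obtains a b where "b < c" "a < b" "a \<notin> X" "b \<notin> X" "N < card {x \<in> X. a < x \<and> x < b}"
proof -
  interpret r: point_set "uminus ` X" by (rule point_set_reflect) unfold_locales
  obtain a b where ab: "- c < a" "a < b" "a \<notin> uminus ` X" "b \<notin> uminus ` X" 
    "N < card {x \<in> uminus ` X. a < x \<and> x < b}" by (rule r.many_points_above)
  have "{x \<in> uminus ` X. a < x \<and> x < b} = uminus ` {x \<in> X. - b < x \<and> x < - a}" by force
  then have "card {x \<in> uminus ` X. a < x \<and> x < b} = card {x \<in> X. - b < x \<and> x < - a}" 
    by (simp add: card_image)
  moreover have "- a \<notin> X" "- b \<notin> X" using ab by force+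
  ultimately show ?thesis using that[of "- a" "- b"] ab by simp
qed

text \<open>A weight that is summable over \<open>X\<close>, while it decays only polynomially.\<close>

definition decay :: "real \<Rightarrow> real" where "decay x = 1 / (1 + \<bar>x\<bar>)\<^sup>2"

lemma decay_pos: "0 < decay x"
proof -
  have "0 < 1 + \<bar>x\<bar>" by linarith
  then show ?thesis by (simp add: decay_def)
qed

text \<open>All points between \<open>origin\<close> and \<open>x\<close> lie within distance \<open>1 + \<bar>x\<bar> + \<bar>a\<bar> + \<bar>origin\<bar>\<close> of the centre \<open>a\<close> of the
  growth bound. That bound does not count \<open>a\<close> itself, which costs one more point.\<close>

lemma idx_linear_bound:
  assumes "X2 X"
  obtains C where "0 < C" "\<And>x. x \<in> X \<Longrightarrow> 1 + \<bar>real_of_int (idx x)\<bar> \<le> C * (1 + \<bar>x\<bar>)"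
proof -
  obtain a where "growth_const X a < \<infinity>" using assms by (auto simp: X2_def)
  then obtain c where c: "0 \<le> c" and cnt: "\<And>t. 0 < t \<Longrightarrow> 
      finite {x \<in> X. 0 < \<bar>x - a\<bar> \<and> \<bar>x - a\<bar> \<le> t} \<and> real (card {x \<in> X. 0 < \<bar>x - a\<bar> \<and> \<bar>x - a\<bar> \<le> t}) \<le> c * t"
    unfolding growth_const_def Inf_less_iff by auto
  define D where "D = 1 + \<bar>a\<bar> + \<bar>origin\<bar>"
  show ?thesis
  proof (rule that[of "2 + c * D"])
    show "0 < 2 + c * D" using c by (simp add: D_def add_pos_nonneg)
    fix x assume x: "x \<in> X"
    define t where "t = 1 + \<bar>x\<bar> + \<bar>a\<bar> + \<bar>origin\<bar>"
    have t: "0 < t" by (simp add: t_def)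
    define B where "B = {x \<in> X. 0 < \<bar>x - a\<bar> \<and> \<bar>x - a\<bar> \<le> t}"
    have "point_count u v \<le> int (card (insert a B))" if "u \<in> {x, origin}" "v \<in> {x, origin}" for u v
      unfolding point_count_def of_nat_le_iff
    proof (rule card_mono)
      show "finite (insert a B)" using cnt[OF t] by (simp add: B_def)
      have "\<bar>u\<bar> \<le> \<bar>x\<bar> + \<bar>origin\<bar>" "\<bar>v\<bar> \<le> \<bar>x\<bar> + \<bar>origin\<bar>" using that by auto
      then have "\<bar>z - a\<bar> \<le> t" if "u \<le> z" "z < v" for z using that unfolding t_def by linarith
      then show "{z \<in> X. u \<le> z \<and> z < v} \<subseteq> insert a B" by (auto simp: B_def)
    qed
    then have "\<bar>idx x\<bar> \<le> int (card (insert a B))" by (auto simp: idx_def point_count_def)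
    also have "\<dots> \<le> int (card B) + 1" using cnt[OF t] by (simp add: card_insert_if B_def)
    finally have "\<bar>real_of_int (idx x)\<bar> \<le> real (card B) + 1" by linarith
    also have "real (card B) \<le> c * t" using cnt[OF t] by (simp add: B_def)
    also have "c * t \<le> c * (D * (1 + \<bar>x\<bar>))"
      using c by (intro mult_left_mono) (auto simp: t_def D_def algebra_simps)
    finally have "1 + \<bar>real_of_int (idx x)\<bar> \<le> 2 * 1 + c * D * (1 + \<bar>x\<bar>)" by simp
    also have "\<dots> \<le> 2 * (1 + \<bar>x\<bar>) + c * D * (1 + \<bar>x\<bar>)" by simp
    finally show "1 + \<bar>real_of_int (idx x)\<bar> \<le> (2 + c * D) * (1 + \<bar>x\<bar>)" by (simp add: algebra_simps)
  qed
qed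

lemma summable_inverse_squares_int: "(\<lambda>k::int. 1 / (1 + \<bar>real_of_int k\<bar>)\<^sup>2) summable_on UNIV"
proof -
  let ?f = "\<lambda>k::int. 1 / (1 + \<bar>real_of_int k\<bar>)\<^sup>2"
  have "summable (\<lambda>n. inverse ((real (Suc n))\<^sup>2))"
    by (subst summable_Suc_iff) (rule inverse_power_summable, simp)
  then have nat: "(\<lambda>n::nat. 1 / (1 + real n)\<^sup>2) summable_on UNIV"
    by (intro norm_summable_imp_summable_on) (simp add: inverse_eq_divide)
  have "?f summable_on (range int)"
    by (subst summable_on_reindex) (auto simp: o_def nat)
  moreover have "?f summable_on (range (\<lambda>n. - int n))"
    by (subst summable_on_reindex) (auto simp: o_def nat inj_on_def)
  ultimately have "?f summable_on (range int \<union> range (\<lambda>n. - int n))"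
    by (rule summable_on_union)
  moreover have "range int \<union> range (\<lambda>n. - int n) = UNIV"
  proof -
    have "k \<in> range int \<union> range (\<lambda>n. - int n)" for k
      by (cases k rule: int_cases2) auto
    then show ?thesis by blast
  qed
  ultimately show ?thesis by simp
qed

lemma summable_decay:
  assumes "X2 X" shows "decay summable_on X"
proof -
  obtain C where C: "0 < C" "\<And>x. x \<in> X \<Longrightarrow> 1 + \<bar>real_of_int (idx x)\<bar> \<le> C * (1 + \<bar>x\<bar>)"
    using idx_linear_bound[OF assms] by blast
  have "(\<lambda>x. 1 / (1 + \<bar>real_of_int (idx x)\<bar>)\<^sup>2) summable_on X"
    using summable_on_reindex_bij_betw[OF idx_bij, of "\<lambda>k. 1 / (1 + \<bar>real_of_int k\<bar>)\<^sup>2"] 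
      summable_inverse_squares_int by simp
  then have "(\<lambda>x. C\<^sup>2 * (1 / (1 + \<bar>real_of_int (idx x)\<bar>)\<^sup>2)) summable_on X"
    by (rule summable_on_cmult_right)
  then show ?thesis
  proof (rule summable_on_comparison_test)
    fix x assume x: "x \<in> X"
    have "(1 + \<bar>real_of_int (idx x)\<bar>)\<^sup>2 \<le> (C * (1 + \<bar>x\<bar>))\<^sup>2"
      by (rule power_mono[OF C(2)[OF x]]) auto
    moreover have "1 + \<bar>x\<bar> \<noteq> 0" "1 + \<bar>real_of_int (idx x)\<bar> \<noteq> 0" by linarith+
    ultimately show "decay x \<le> C\<^sup>2 * (1 / (1 + \<bar>real_of_int (idx x)\<bar>)\<^sup>2)"
      by (simp add: decay_def divide_simps power_mult_distrib)
  qed (simp add: decay_pos less_imp_le)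
qed

text \<open>The form in which summability enters: pairs that are not contained in a large box contribute little.\<close>

lemma decay_pairs_tail:
  assumes "X2 X" and e: "0 < e" and T1: "finite T1" "T1 \<subseteq> X"
  obtains T where "finite T" "T1 \<subseteq> T" "T \<subseteq> X"
    "\<And>F. finite F \<Longrightarrow> F \<subseteq> X \<times> X \<Longrightarrow> F \<inter> T \<times> T = {} \<Longrightarrow> (\<Sum>(p,q)\<in>F. decay p * decay q) \<le> e"
proof -
  let ?f = "\<lambda>(p,q). decay p * decay q"
  have dec: "decay summable_on X" by (rule summable_decay[OF assms(1)])
  have "?f summable_on (X \<times> X)"
  proof (rule nonneg_bdd_above_summable_on)
    show "bdd_above (sum ?f ` {F. F \<subseteq> X \<times> X \<and> finite F})"
    proof (rule bdd_aboveI2)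
      fix F assume F: "F \<in> {F. F \<subseteq> X \<times> X \<and> finite F}"
      have "F \<subseteq> fst ` F \<times> snd ` F" by force
      then have "sum ?f F \<le> sum ?f (fst ` F \<times> snd ` F)"
        using F by (intro sum_mono2) (auto simp: decay_pos less_imp_le)
      also have "\<dots> = sum decay (fst ` F) * sum decay (snd ` F)"
        by (simp add: sum_product sum.cartesian_product)
      also have "\<dots> \<le> infsum decay X * infsum decay X"
        using F by (intro mult_mono finite_sum_le_infsum dec infsum_nonneg sum_nonneg)
          (auto simp: decay_pos less_imp_le)
      finally show "sum ?f F \<le> infsum decay X * infsum decay X" .
    qed
  qed (auto simp: decay_pos less_imp_le)
  note sum = this
  have "(sum ?f \<longlongrightarrow> infsum ?f (X \<times> X)) (finite_subsets_at_top (X \<times> X))"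
    using sum by (rule infsum_tendsto)
  then have "eventually (\<lambda>F. dist (sum ?f F) (infsum ?f (X \<times> X)) < e) (finite_subsets_at_top (X \<times> X))"
    using e by (rule tendstoD)
  then obtain U where U: "finite U" "U \<subseteq> X \<times> X" and 
      close: "\<forall>Y. finite Y \<and> U \<subseteq> Y \<and> Y \<subseteq> X \<times> X \<longrightarrow> dist (sum ?f Y) (infsum ?f (X \<times> X)) < e"
    unfolding eventually_finite_subsets_at_top by (elim exE conjE) rule
  define T where "T = T1 \<union> fst ` U \<union> snd ` U"
  show ?thesis
  proof (rule that[of T])
    show "finite T" "T1 \<subseteq> T" "T \<subseteq> X" using U T1 by (auto simp: T_def)
    fix F assume F: "finite F" "F \<subseteq> X \<times> X" "F \<inter> T \<times> T = {}"
    have disj: "U \<inter> F = {}" using F(3) by (force simp: T_def)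
    have "sum ?f (U \<union> F) \<le> infsum ?f (X \<times> X)"
      using U F by (intro finite_sum_le_infsum sum) (auto simp: decay_pos less_imp_le)
    moreover have "infsum ?f (X \<times> X) < sum ?f U + e"
      using close[rule_format, of U] U by (simp add: dist_real_def)
    ultimately show "sum ?f F \<le> e" using sum.union_disjoint[OF U(1) F(1) disj, of ?f] by simp
  qed
qed

end

section \<open>Flow and shifts\<close>

lemma PermsD: assumes "\<sigma> \<in> Perms X"
  shows "\<sigma> permutes X" "bij \<sigma>" "inj \<sigma>" "\<And>x. \<sigma> x \<in> X \<longleftrightarrow> x \<in> X" "\<And>x. \<sigma> (inv \<sigma> x) = x"
    "\<And>x. inv \<sigma> (\<sigma> x) = x" "\<And>x. inv \<sigma> x \<in> X \<longleftrightarrow> x \<in> X" "inv \<sigma> \<in> Perms X" "inv (inv \<sigma>) = \<sigma>"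
    "\<And>x y. inv \<sigma> x = y \<longleftrightarrow> \<sigma> y = x"
proof -
  show p: "\<sigma> permutes X" using assms by (simp add: Perms_def)
  show "bij \<sigma>" "inj \<sigma>" using p by (rule permutes_bij, rule permutes_inj)
  show "\<sigma> x \<in> X \<longleftrightarrow> x \<in> X" for x using permutes_in_image[OF p] .
  show "\<sigma> (inv \<sigma> x) = x" "inv \<sigma> (\<sigma> x) = x" for x using permutes_inverses[OF p] by auto
  show q: "inv \<sigma> \<in> Perms X" using permutes_inv[OF p] by (simp add: Perms_def)
  show "inv \<sigma> x \<in> X \<longleftrightarrow> x \<in> X" for x using permutes_in_image[OF permutes_inv[OF p]] .
  show "inv (inv \<sigma>) = \<sigma>" using permutes_inv_inv[OF p] .
  show "inv \<sigma> x = y \<longleftrightarrow> \<sigma> y = x" for x y using permutes_inv_eq[OF p] by auto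
qed

text \<open>Off \<open>\<Lambda>\<close> both the images and the preimages are prescribed. Only jumps with both ends in \<open>\<Lambda>\<close> are free.\<close>

lemma agree_off_eq:
  assumes s: "\<sigma> \<in> Perms X" and h: "\<eta> \<in> Perms X" and agree: "agree_off X \<Lambda> \<sigma> \<eta>" and x: "x \<in> X"
    and out: "x \<notin> \<Lambda> \<or> \<sigma> x \<notin> \<Lambda> \<or> \<eta> x \<notin> \<Lambda>"
  shows "\<sigma> x = \<eta> x"
proof -
  note S = PermsD[OF s] and H = PermsD[OF h]
  from out consider "x \<notin> \<Lambda>" | "\<sigma> x \<notin> \<Lambda>" | "\<eta> x \<notin> \<Lambda>" by blast
  then show ?thesis
  proof cases
    case 1 then show ?thesis using agree x by (simp add: agree_off_def)
  next
    case 2 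
    then have "inv \<sigma> (\<sigma> x) = inv \<eta> (\<sigma> x)" using agree x S(4) by (simp add: agree_off_def)
    then have "inv \<eta> (\<sigma> x) = x" by (simp add: S(6))
    then show ?thesis using H(10)[of "\<sigma> x" x] by simp
  next
    case 3
    then have "inv \<sigma> (\<eta> x) = inv \<eta> (\<eta> x)" using agree x H(4) by (simp add: agree_off_def)
    then have "inv \<sigma> (\<eta> x) = x" by (simp add: H(6))
    then show ?thesis using S(10)[of "\<eta> x" x] by simp
  qed
qed

context point_set begin

text \<open>There are as many jumps out of the finitely many points between \<open>a\<close> and \<open>b\<close> as jumps into them. Jumps
  between the outer parts contribute equally at \<open>a\<close> and at \<open>b\<close>, and the difference of the other
  contributions vanishes by this balance.\<close>

lemma flow_at_eq_of_less:
  assumes s: "\<sigma> \<in> Perms X" and ab: "a \<notin> X" "b \<notin> X" "a < b"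
  shows "flow_at X a \<sigma> = flow_at X b \<sigma>"
proof -
  note S = PermsD[OF s]
  define I where "I = {x \<in> X. a < x \<and> x < b}"
  define PQ where "PQ = {x \<in> X. x < a \<and> b < \<sigma> x}"
  define QP where "QP = {x \<in> X. b < x \<and> \<sigma> x < a}"
  define PI where "PI = {x \<in> X. x < a \<and> \<sigma> x \<in> I}"
  define QI where "QI = {x \<in> X. b < x \<and> \<sigma> x \<in> I}"
  define II where "II = {x \<in> I. \<sigma> x \<in> I}"
  define IP where "IP = {x \<in> I. \<sigma> x < a}"
  define IQ where "IQ = {x \<in> I. b < \<sigma> x}"
  have ne: "x \<in> X \<Longrightarrow> x \<noteq> a \<and> x \<noteq> b \<and> \<sigma> x \<noteq> a \<and> \<sigma> x \<noteq> b" for x using ab S(4) by metis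
  have finI: "finite I" unfolding I_def by (rule finite_within[of _ a b]) auto
  have pre: "inv \<sigma> ` I = PI \<union> II \<union> QI"
  proof safe
    fix x assume x: "x \<in> I" "inv \<sigma> x \<notin> QI" "inv \<sigma> x \<notin> II"
    then have "inv \<sigma> x \<in> X" by (simp add: I_def S)
    moreover from this have "inv \<sigma> x \<noteq> a" "inv \<sigma> x \<noteq> b" using ab by auto
    ultimately show "inv \<sigma> x \<in> PI" using x by (auto simp: PI_def QI_def II_def I_def S(5))
  next
    fix x assume "x \<in> PI" then show "x \<in> inv \<sigma> ` I"
      by (intro image_eqI[of _ _ "\<sigma> x"]) (auto simp: PI_def S(6))
  next
    fix x assume "x \<in> QI" then show "x \<in> inv \<sigma> ` I"
      by (intro image_eqI[of _ _ "\<sigma> x"]) (auto simp: QI_def S(6))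
  next
    fix x assume "x \<in> II" then show "x \<in> inv \<sigma> ` I"
      by (intro image_eqI[of _ _ "\<sigma> x"]) (auto simp: II_def S(6))
  qed
  have fin: "finite PI" "finite II" "finite QI" "finite IP" "finite IQ"
    using finite_imageI[OF finI, of "inv \<sigma>"] unfolding pre
    using finI by (auto simp: IP_def IQ_def)
  have lt: "a < x \<longleftrightarrow> \<not> x < a" "b < x \<longleftrightarrow> \<not> x < b" "a < \<sigma> x \<longleftrightarrow> \<not> \<sigma> x < a" "b < \<sigma> x \<longleftrightarrow> \<not> \<sigma> x < b" 
    if "x \<in> X" for x using ne[OF that] by auto
  have decomp: "I = IP \<union> II \<union> IQ" using ab by (auto simp: IP_def II_def IQ_def I_def S(4) lt)
  have "card I = card (inv \<sigma> ` I)" 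
    by (rule card_image[symmetric]) (rule inj_on_subset[OF PermsD(3)[OF S(8)]], simp)
  also have "\<dots> = card PI + card II + card QI" unfolding pre
    using fin ab by (subst card_Un_disjoint; (subst card_Un_disjoint)?) (auto simp: PI_def II_def QI_def I_def)
  finally have c1: "card I = card PI + card II + card QI" .
  have c2: "card I = card IP + card II + card IQ" 
    by (subst decomp, subst card_Un_disjoint; (subst card_Un_disjoint)?) (use fin ab in \<open>auto simp: IP_def II_def IQ_def I_def\<close>)
  have e: "flow_right X a \<sigma> = PI \<union> PQ" "flow_left X a \<sigma> = IP \<union> QP" 
    "flow_right X b \<sigma> = IQ \<union> PQ" "flow_left X b \<sigma> = QI \<union> QP"
    using ab unfolding flow_right_def flow_left_def PI_def PQ_def IP_def QP_def IQ_def QI_def I_def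
    by (auto simp: S(4) lt)
  have d: "PI \<inter> PQ = {}" "IP \<inter> QP = {}" "IQ \<inter> PQ = {}" "QI \<inter> QP = {}"
    using ab by (auto simp: PI_def PQ_def IP_def QP_def IQ_def QI_def I_def)
  show ?thesis
    unfolding flow_at_def e using fin c1 c2 by (auto simp: card_Un_disjoint d)
qed

lemma flow_at_const:
  assumes "\<sigma> \<in> Perms X" "a \<notin> X" "b \<notin> X"
  shows "flow_at X a \<sigma> = flow_at X b \<sigma>"
proof (cases a b rule: linorder_cases)
  case less
  then show ?thesis by (rule flow_at_eq_of_less[OF assms])
next
  case greater
  then show ?thesis by (rule flow_at_eq_of_less[OF assms(1,3,2), symmetric])
qed simp

text \<open>If all points to the right of \<open>a\<close> were sent beyond \<open>b\<close>, then nothing would return over \<open>a\<close>, and the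
  points of the window would be images of points on the left of \<open>a\<close>. The flow at \<open>a\<close> would be at least
  the number of points in the window.\<close>

lemma ex_exchange_partner:
  assumes s: "\<sigma> \<in> Perms X" and ab: "a \<notin> X" "b \<notin> X" "a < b"
    and flow: "flow_at X a \<sigma> = Some n" and many: "n < int (card {x \<in> X. a < x \<and> x < b})"
  shows "\<exists>u\<in>X. a < u \<and> \<sigma> u < b"
proof (rule ccontr)
  assume no: "\<not> (\<exists>u\<in>X. a < u \<and> \<sigma> u < b)"
  note S = PermsD[OF s]
  have "flow_left X a \<sigma> = {}" using no ab by (auto simp: flow_left_def)
  then have fin: "finite (flow_right X a \<sigma>)" and n: "n = int (card (flow_right X a \<sigma>))"
    using flow by (auto simp: flow_at_def split: if_splits)
  have "inv \<sigma> ` {x \<in> X. a < x \<and> x < b} \<subseteq> flow_right X a \<sigma>"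
  proof safe
    fix y assume y: "y \<in> X" "a < y" "y < b"
    then have "inv \<sigma> y \<in> X" by (simp add: S)
    moreover from this have "inv \<sigma> y < a" using no y ab S(5)[of y] by (metis linorder_neqE_linordered_idom)
    ultimately show "inv \<sigma> y \<in> flow_right X a \<sigma>" using y by (simp add: flow_right_def S)
  qed
  then have "card (inv \<sigma> ` {x \<in> X. a < x \<and> x < b}) \<le> card (flow_right X a \<sigma>)"
    by (rule card_mono[OF fin])
  moreover have "card (inv \<sigma> ` {x \<in> X. a < x \<and> x < b}) = card {x \<in> X. a < x \<and> x < b}"
    by (rule card_image) (rule inj_on_subset[OF PermsD(3)[OF S(8)]], simp)
  ultimately show False using many n by simp
qed

definition shift :: "int \<Rightarrow> real \<Rightarrow> real" where
  "shift n x = (if x \<in> X then point (idx x + n) else x)"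

lemma shift_shift: "shift m (shift n x) = shift (m + n) x"
  by (simp add: shift_def point_in idx_point algebra_simps)

lemma shift_0: "shift 0 x = x" by (simp add: shift_def point_idx)

lemma inv_shift: "inv (shift n) = shift (- n)"
  by (rule inv_equality) (simp_all add: shift_shift shift_0)

lemma shift_Perms: "shift n \<in> Perms X"
  unfolding Perms_def mem_Collect_eq permutes_def
proof (intro conjI allI impI)
  show "\<exists>!x. shift n x = y" for y
    by (rule ex1I[of _ "shift (- n) y"]) (auto simp: shift_shift shift_0)
qed (simp add: shift_def)

text \<open>In terms of numbers, the points that cross \<open>a\<close> form an interval of length \<open>\<bar>n\<bar>\<close>.\<close>

lemma shift_flow: assumes a: "a \<notin> X" shows "flow_at X a (shift n) = Some n"
proof -
  obtain x where x: "x \<in> X" "a < x" using ex_above by auto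
  obtain w where w: "w \<in> X" "w < a" using ex_below by auto
  \<comment> \<open>The number of the first point to the right of \<open>a\<close>.\<close>
  define k where "k = Max {i. idx w \<le> i \<and> point i < a} + 1"
  have fin: "finite {i. idx w \<le> i \<and> point i < a}"
  proof (rule finite_subset)
    show "{i. idx w \<le> i \<and> point i < a} \<subseteq> {idx w .. idx x}"
    proof safe
      fix i assume "point i < a"
      then have "point i < point (idx x)" using x by (simp add: point_idx)
      then show "i \<in> {idx w .. idx x}" if "idx w \<le> i" using that by (simp add: point_less_iff)
    qed
  qed simp
  have ne: "{i. idx w \<le> i \<and> point i < a} \<noteq> {}" using w point_idx by auto
  have k1: "k - 1 \<in> {i. idx w \<le> i \<and> point i < a}" unfolding k_def using Max_in[OF fin ne] by simp
  have below: "point i < a \<longleftrightarrow> i < k" for i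
  proof
    assume i: "point i < a"
    show "i < k"
    proof (rule ccontr)
      assume "\<not> i < k"
      then have "i \<in> {i. idx w \<le> i \<and> point i < a}" using i k1 by auto
      then have "i \<le> k - 1" unfolding k_def using Max_ge[OF fin] by simp
      then show False using \<open>\<not> i < k\<close> by simp
    qed
  next
    assume "i < k"
    then have "point i \<le> point (k - 1)" by (simp add: point_less_iff flip: not_less)
    then show "point i < a" using k1 by simp
  qed
  have above: "a < point i \<longleftrightarrow> k \<le> i" for i
    using below[of i] a point_in[of i] by (metis linorder_not_less order_le_less)
  have r: "flow_right X a (shift n) = point ` {k - n..<k}"
  proof safe
    fix x assume "x \<in> flow_right X a (shift n)"
    then have "x \<in> X" "idx x < k" "k \<le> idx x + n"
      by (auto simp: flow_right_def shift_def point_idx simp flip: below above)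
    then show "x \<in> point ` {k - n..<k}"
      by (intro image_eqI[of _ _ "idx x"]) (auto simp: point_idx)
  qed (auto simp: flow_right_def shift_def point_in idx_point below above)
  have l: "flow_left X a (shift n) = point ` {k..<k - n}"
  proof safe
    fix x assume "x \<in> flow_left X a (shift n)"
    then have "x \<in> X" "idx x + n < k" "k \<le> idx x"
      by (auto simp: flow_left_def shift_def point_idx simp flip: below above)
    then show "x \<in> point ` {k..<k - n}"
      by (intro image_eqI[of _ _ "idx x"]) (auto simp: point_idx)
  qed (auto simp: flow_left_def shift_def point_in idx_point below above)
  show ?thesis unfolding flow_at_def r l
    by (simp add: card_image inj_on_subset[OF inj_point])
qed

text \<open>To the right of \<open>\<Lambda>\<close> the two permutations have the same crossings, and the flow does not depend on
  the site.\<close>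

lemma agree_off_flow:
  assumes s: "\<sigma> \<in> Perms X" and h: "\<eta> \<in> Perms X" and L: "finite \<Lambda>" and agree: "agree_off X \<Lambda> \<sigma> \<eta>" and a: "a \<notin> X"
  shows "flow_at X a \<sigma> = flow_at X a \<eta>"
proof -
  note S = PermsD[OF s] and H = PermsD[OF h]
  obtain c where c: "\<And>x. x \<in> \<Lambda> \<Longrightarrow> x < c"
    using bdd_above_finite[OF L] by (metis bdd_above.E gt_ex order_le_less_trans)
  obtain b where b: "c < b" "b \<notin> X" by (rule many_points_above)
  have out: "\<sigma> x = \<eta> x" if "x \<in> X" "b < x \<or> b < \<sigma> x \<or> b < \<eta> x" for x
  proof (rule agree_off_eq[OF s h agree that(1)])
    show "x \<notin> \<Lambda> \<or> \<sigma> x \<notin> \<Lambda> \<or> \<eta> x \<notin> \<Lambda>"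
      using that(2) c[of x] c[of "\<sigma> x"] c[of "\<eta> x"] b(1) by auto
  qed
  have "b < \<sigma> x \<longleftrightarrow> b < \<eta> x" if "x \<in> X" for x using out[OF that] by argo
  then have "flow_right X b \<sigma> = flow_right X b \<eta>"
    unfolding flow_right_def by blast
  moreover have "\<sigma> x < b \<longleftrightarrow> \<eta> x < b" if "x \<in> X" "b < x" for x using out[of x] that by simp
  then have "flow_left X b \<sigma> = flow_left X b \<eta>"
    unfolding flow_left_def by blast
  ultimately
  have "flow_at X b \<sigma> = flow_at X b \<eta>" by (simp add: flow_at_def)
  then show ?thesis using flow_at_const[OF s a b(2)] flow_at_const[OF h a b(2)] by simp
qed

lemma midpoints_disjoint: "a \<in> midpoints X \<Longrightarrow> a \<notin> X"
proof
  assume "a \<in> midpoints X" "a \<in> X"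
  then obtain x y where "a = (x + y) / 2" "x < y" "{x<..<y} \<inter> X = {}" by (auto simp: midpoints_def)
  moreover from this have "a \<in> {x<..<y}" by auto
  ultimately show False using \<open>a \<in> X\<close> by blast
qed

lemma flow_eq_flow_at:
  assumes "\<sigma> \<in> Perms X" "a \<notin> X"
  shows "flow X \<sigma> = flow_at X a \<sigma>"
proof -
  have in_mid: "(point 0 + point 1) / 2 \<in> midpoints X"
  proof -
    have "{point 0<..<point 1} \<inter> X = {}"
    proof safe
      fix x assume x: "x \<in> X" "x \<in> {point 0<..<point 1}"
      then have "point 0 < point (idx x)" "point (idx x) < point 1" by (auto simp: point_idx)
      then show "x \<in> {}" by (simp add: point_less_iff)
    qed
    then have "(point 0 + point 1) / 2 = (point 0 + point 1) / 2 \<and> point 0 \<in> X \<and> point 1 \<in> X \<and> point 0 < point 1 \<and> {point 0<..<point 1} \<inter> X = {}"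
      by (simp add: point_in point_less_iff)
    then show ?thesis unfolding midpoints_def mem_Collect_eq by (intro exI)
  qed
  have all: "flow_at X b \<sigma> = flow_at X a \<sigma>" if "b \<in> midpoints X" for b
    using flow_at_const[OF assms(1) midpoints_disjoint[OF that] assms(2)] .
  show ?thesis unfolding flow_def
  proof (rule the_equality)
    fix f assume "\<forall>b\<in>midpoints X. flow_at X b \<sigma> = f"
    then show "f = flow_at X a \<sigma>" using all[OF in_mid] in_mid by auto
  qed (simp add: all)
qed

end

section \<open>Finite-volume Gibbs kernels\<close>

text \<open>The permutations that are compatible with the boundary condition \<open>\<eta>\<close>; these are the equivalence
  classes of \<open>agree_off\<close>.\<close>

definition boundary_class :: "real set \<Rightarrow> real set \<Rightarrow> (real \<Rightarrow> real) \<Rightarrow> (real \<Rightarrow> real) set" where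
  "boundary_class X \<Lambda> \<eta> = {\<sigma> \<in> Perms X. agree_off X \<Lambda> \<sigma> \<eta>}"

definition weight :: "(real \<Rightarrow> real) \<Rightarrow> real set \<Rightarrow> (real \<Rightarrow> real) \<Rightarrow> real" where
  "weight V \<Lambda> \<sigma> = exp (- Hamiltonian V \<Lambda> \<sigma>)"

lemma weight_pos: "0 < weight V \<Lambda> \<sigma>" by (simp add: weight_def)

lemma boundary_class_self: "\<eta> \<in> Perms X \<Longrightarrow> \<eta> \<in> boundary_class X \<Lambda> \<eta>"
  by (simp add: boundary_class_def agree_off_def)

lemma boundary_class_eq: "\<sigma> \<in> boundary_class X \<Lambda> \<eta> \<Longrightarrow> boundary_class X \<Lambda> \<sigma> = boundary_class X \<Lambda> \<eta>"
  unfolding boundary_class_def agree_off_def by auto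

lemma boundary_class_sym: "\<eta> \<in> Perms X \<Longrightarrow> \<sigma> \<in> boundary_class X \<Lambda> \<eta> \<Longrightarrow> \<eta> \<in> boundary_class X \<Lambda> \<sigma>"
  unfolding boundary_class_def agree_off_def by auto

lemma boundary_class_mono: "\<Lambda> \<subseteq> \<Lambda>' \<Longrightarrow> boundary_class X \<Lambda> \<eta> \<subseteq> boundary_class X \<Lambda>' \<eta>"
  unfolding boundary_class_def agree_off_def by auto

lemma finite_boundary_class:
  assumes h: "\<eta> \<in> Perms X" and L: "finite \<Lambda>"
  shows "finite (boundary_class X \<Lambda> \<eta>)"
proof (rule finite_imageD)
  note H = PermsD[OF h]
  have "(\<lambda>\<sigma>. restrict \<sigma> \<Lambda>) ` boundary_class X \<Lambda> \<eta> \<subseteq> PiE \<Lambda> (\<lambda>_. \<eta> ` \<Lambda> \<union> \<Lambda>)"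
  proof (rule image_subsetI, rule restrict_PiE_iff[THEN iffD2], rule ballI)
    fix \<sigma> x assume s: "\<sigma> \<in> boundary_class X \<Lambda> \<eta>" and x: "x \<in> \<Lambda>"
    show "\<sigma> x \<in> \<eta> ` \<Lambda> \<union> \<Lambda>"
    proof (cases "x \<in> X \<and> \<sigma> x \<notin> \<Lambda>")
      case True
      then have "\<sigma> x = \<eta> x" using agree_off_eq[of \<sigma> X \<eta> \<Lambda> x] s h by (auto simp: boundary_class_def)
      then show ?thesis using x by auto
    next
      case False
      then show ?thesis using x s permutes_not_in[of \<sigma> X x] by (auto simp: boundary_class_def Perms_def)
    qed
  qed
  then show "finite ((\<lambda>\<sigma>. restrict \<sigma> \<Lambda>) ` boundary_class X \<Lambda> \<eta>)"
    by (rule finite_subset) (intro finite_PiE L ballI finite_UnI finite_imageI)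
  show "inj_on (\<lambda>\<sigma>. restrict \<sigma> \<Lambda>) (boundary_class X \<Lambda> \<eta>)"
  proof (rule inj_onI, rule ext)
    fix \<sigma> \<sigma>' x assume s: "\<sigma> \<in> boundary_class X \<Lambda> \<eta>" "\<sigma>' \<in> boundary_class X \<Lambda> \<eta>" and e: "restrict \<sigma> \<Lambda> = restrict \<sigma>' \<Lambda>"
    consider "x \<notin> X" | "x \<in> \<Lambda>" | "x \<in> X - \<Lambda>" by auto
    then show "\<sigma> x = \<sigma>' x"
    proof cases
      case 1 then show ?thesis using s permutes_not_in[of \<sigma> X x] permutes_not_in[of \<sigma>' X x] by (auto simp: boundary_class_def Perms_def)
    next
      case 2 then show ?thesis using e by (metis restrict_apply')
    next
      case 3 then show ?thesis using s by (auto simp: boundary_class_def agree_off_def)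
    qed
  qed
qed

lemma partition_fun_eq: "partition_fun X V \<Lambda> \<eta> = (\<Sum>\<sigma>\<in>boundary_class X \<Lambda> \<eta>. weight V \<Lambda> \<sigma>)"
  by (simp add: partition_fun_def boundary_class_def weight_def)

lemma partition_fun_pos:
  assumes "\<eta> \<in> Perms X" "finite \<Lambda>" shows "0 < partition_fun X V \<Lambda> \<eta>"
  unfolding partition_fun_eq using assms boundary_class_self
  by (intro sum_pos finite_boundary_class weight_pos) auto

lemma partition_fun_cong: "\<sigma> \<in> boundary_class X \<Lambda> \<eta> \<Longrightarrow> partition_fun X V \<Lambda> \<sigma> = partition_fun X V \<Lambda> \<eta>"
  by (simp add: partition_fun_eq boundary_class_eq)

lemma space_gibbs_kernel [simp]: "space (gibbs_kernel X V \<Lambda> \<eta>) = Perms X"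
  and sets_gibbs_kernel [simp]: "sets (gibbs_kernel X V \<Lambda> \<eta>) = Pow (Perms X)"
  by (simp_all add: gibbs_kernel_def space_point_measure sets_point_measure)

lemma nn_integral_gibbs_kernel:
  assumes h: "\<eta> \<in> Perms X" and L: "finite \<Lambda>" and f: "\<And>\<sigma>. 0 \<le> f \<sigma>"
  shows "(\<integral>\<^sup>+ \<sigma>. ennreal (f \<sigma>) \<partial>gibbs_kernel X V \<Lambda> \<eta>) 
    = ennreal ((\<Sum>\<sigma>\<in>boundary_class X \<Lambda> \<eta>. weight V \<Lambda> \<sigma> * f \<sigma>) / partition_fun X V \<Lambda> \<eta>)"
proof -
  let ?Z = "partition_fun X V \<Lambda> \<eta>"
  let ?g = "\<lambda>\<sigma>. ennreal (1 / ?Z * exp (- Hamiltonian V \<Lambda> \<sigma>) * of_bool (agree_off X \<Lambda> \<sigma> \<eta>))"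
  have Z: "0 < ?Z" using h L by (rule partition_fun_pos)
  have sub: "{\<sigma> \<in> Perms X. 0 < ?g \<sigma> \<and> 0 < ennreal (f \<sigma>)} \<subseteq> boundary_class X \<Lambda> \<eta>"
    by (auto simp: boundary_class_def)
  have "(\<integral>\<^sup>+ \<sigma>. ennreal (f \<sigma>) \<partial>gibbs_kernel X V \<Lambda> \<eta>) = 
     (\<Sum>\<sigma> | \<sigma> \<in> Perms X \<and> 0 < ?g \<sigma> \<and> 0 < ennreal (f \<sigma>). ?g \<sigma> * ennreal (f \<sigma>))"
    unfolding gibbs_kernel_def 
    by (rule nn_integral_point_measure) (rule finite_subset[OF sub finite_boundary_class[OF h L]])
  also have "\<dots> = (\<Sum>\<sigma>\<in>boundary_class X \<Lambda> \<eta>. ?g \<sigma> * ennreal (f \<sigma>))"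
    by (rule sum.mono_neutral_left[OF finite_boundary_class[OF h L] sub]) (auto simp: boundary_class_def zero_less_iff_neq_zero)
  also have "\<dots> = (\<Sum>\<sigma>\<in>boundary_class X \<Lambda> \<eta>. ennreal (weight V \<Lambda> \<sigma> * f \<sigma> / ?Z))"
    using Z f by (intro sum.cong refl) (auto simp: boundary_class_def weight_def ennreal_mult[symmetric])
  also have "\<dots> = ennreal (\<Sum>\<sigma>\<in>boundary_class X \<Lambda> \<eta>. weight V \<Lambda> \<sigma> * f \<sigma> / ?Z)"
    using Z f less_imp_le[OF weight_pos] by (intro sum_ennreal divide_nonneg_pos mult_nonneg_nonneg)
  finally show ?thesis by (simp add: sum_divide_distrib)
qed

lemma emeasure_gibbs_kernel:
  assumes h: "\<eta> \<in> Perms X" and L: "finite \<Lambda>" and A: "A \<subseteq> Perms X"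
  shows "emeasure (gibbs_kernel X V \<Lambda> \<eta>) A 
    = ennreal ((\<Sum>\<sigma>\<in>boundary_class X \<Lambda> \<eta> \<inter> A. weight V \<Lambda> \<sigma>) / partition_fun X V \<Lambda> \<eta>)"
proof -
  have "emeasure (gibbs_kernel X V \<Lambda> \<eta>) A = (\<integral>\<^sup>+ \<sigma>. ennreal (indicator A \<sigma>) \<partial>gibbs_kernel X V \<Lambda> \<eta>)"
    using A by (simp add: ennreal_indicator)
  also have "\<dots> = ennreal ((\<Sum>\<sigma>\<in>boundary_class X \<Lambda> \<eta>. weight V \<Lambda> \<sigma> * indicator A \<sigma>) / partition_fun X V \<Lambda> \<eta>)"
    by (rule nn_integral_gibbs_kernel[OF h L]) simp
  also have "(\<Sum>\<sigma>\<in>boundary_class X \<Lambda> \<eta>. weight V \<Lambda> \<sigma> * indicator A \<sigma>) = (\<Sum>\<sigma>\<in>boundary_class X \<Lambda> \<eta> \<inter> A. weight V \<Lambda> \<sigma>)"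
    using finite_boundary_class[OF h L] by (simp add: sum.inter_restrict indicator_def if_distrib cong: if_cong)
  finally show ?thesis .
qed

lemma measure_gibbs_kernel:
  assumes h: "\<eta> \<in> Perms X" and L: "finite \<Lambda>" and A: "A \<subseteq> Perms X"
  shows "measure (gibbs_kernel X V \<Lambda> \<eta>) A 
    = (\<Sum>\<sigma>\<in>boundary_class X \<Lambda> \<eta> \<inter> A. weight V \<Lambda> \<sigma>) / partition_fun X V \<Lambda> \<eta>"
  unfolding measure_def emeasure_gibbs_kernel[OF assms] 
  using partition_fun_pos[OF h L, of V] weight_pos by (simp add: sum_nonneg less_imp_le)

lemma prob_space_gibbs_kernel:
  assumes h: "\<eta> \<in> Perms X" and L: "finite \<Lambda>"
  shows "prob_space (gibbs_kernel X V \<Lambda> \<eta>)"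
proof
  have "boundary_class X \<Lambda> \<eta> \<inter> Perms X = boundary_class X \<Lambda> \<eta>" by (auto simp: boundary_class_def)
  then show "emeasure (gibbs_kernel X V \<Lambda> \<eta>) (space (gibbs_kernel X V \<Lambda> \<eta>)) = 1"
    using partition_fun_pos[OF assms, of V] 
    by (simp add: emeasure_gibbs_kernel[OF assms] flip: partition_fun_eq)
qed

text \<open>The energies in \<open>\<Lambda>\<close> and in \<open>\<Lambda>\<close>' differ by the contributions of jumps that are not contained in \<open>\<Lambda>\<close>,
  and these jumps are common to all permutations of the class.\<close>

lemma weight_ratio_on_class:
  assumes h: "\<eta> \<in> Perms X" and L': "finite \<Lambda>'" and sub: "\<Lambda> \<subseteq> \<Lambda>'" "\<Lambda>' \<subseteq> X" and s: "\<sigma> \<in> boundary_class X \<Lambda> \<eta>"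
  shows "weight V \<Lambda>' \<eta> * weight V \<Lambda> \<sigma> = weight V \<Lambda>' \<sigma> * weight V \<Lambda> \<eta>"
proof -
  define R where "R \<tau> = {x \<in> \<Lambda>'. \<tau> x \<in> \<Lambda>' \<and> \<not> (x \<in> \<Lambda> \<and> \<tau> x \<in> \<Lambda>)}" for \<tau> :: "real \<Rightarrow> real"
  have split: "Hamiltonian V \<Lambda>' \<tau> = Hamiltonian V \<Lambda> \<tau> + (\<Sum>x\<in>R \<tau>. V (\<tau> x - x))" for \<tau>
  proof -
    have "\<Lambda>' \<inter> \<tau> -` \<Lambda>' = (\<Lambda> \<inter> \<tau> -` \<Lambda>) \<union> R \<tau>" using sub by (auto simp: R_def)
    moreover have "(\<Lambda> \<inter> \<tau> -` \<Lambda>) \<inter> R \<tau> = {}" by (auto simp: R_def)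
    moreover have "finite \<Lambda>" using sub L' finite_subset by auto
    ultimately show ?thesis using L' by (simp add: Hamiltonian_def sum.union_disjoint R_def)
  qed
  have s': "\<sigma> \<in> Perms X" "agree_off X \<Lambda> \<sigma> \<eta>" using s by (auto simp: boundary_class_def)
  have eq: "\<sigma> x = \<eta> x" if "x \<in> X" "x \<notin> \<Lambda> \<or> \<sigma> x \<notin> \<Lambda> \<or> \<eta> x \<notin> \<Lambda>" for x
    by (rule agree_off_eq[OF s'(1) h s'(2) that])
  have "x \<in> R \<sigma> \<longleftrightarrow> x \<in> R \<eta>" for x
    using eq[of x] sub unfolding R_def mem_Collect_eq by (cases "\<sigma> x = \<eta> x") auto
  then have RR: "R \<sigma> = R \<eta>" by blast
  have "(\<Sum>x\<in>R \<sigma>. V (\<sigma> x - x)) = (\<Sum>x\<in>R \<eta>. V (\<eta> x - x))"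
    unfolding RR
  proof (rule sum.cong[OF refl])
    fix x assume "x \<in> R \<eta>"
    then have "\<sigma> x = \<eta> x" using sub by (intro eq) (auto simp: R_def)
    then show "V (\<sigma> x - x) = V (\<eta> x - x)" by simp
  qed
  then show ?thesis using split[of \<sigma>] split[of \<eta>] by (simp add: weight_def flip: exp_add)
qed

text \<open>Resampling in the smaller region preserves the measure by detailed balance: the weight of passing
  from \<open>\<zeta>\<close> to \<open>\<sigma>\<close> is symmetric, so the double sum can be carried out over \<open>\<zeta>\<close> first.\<close>

lemma gibbs_kernel_consistent:
  assumes h: "\<eta> \<in> Perms X" and L': "finite \<Lambda>'" and sub: "\<Lambda> \<subseteq> \<Lambda>'" "\<Lambda>' \<subseteq> X" and A: "A \<subseteq> Perms X"
  shows "(\<integral>\<^sup>+ \<zeta>. ennreal (measure (gibbs_kernel X V \<Lambda> \<zeta>) A) \<partial>gibbs_kernel X V \<Lambda>' \<eta>) 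
     = emeasure (gibbs_kernel X V \<Lambda>' \<eta>) A"
proof -
  have L: "finite \<Lambda>" using sub L' finite_subset by auto
  let ?C = "boundary_class X \<Lambda>' \<eta>" and ?w = "weight V \<Lambda>'" and ?v = "weight V \<Lambda>" and ?Z = "partition_fun X V \<Lambda>"
  have fin: "finite ?C" by (rule finite_boundary_class[OF h L'])
  have C: "\<zeta> \<in> Perms X" if "\<zeta> \<in> ?C" for \<zeta> using that by (simp add: boundary_class_def)
  have sub': "boundary_class X \<Lambda> \<zeta> \<subseteq> ?C" if "\<zeta> \<in> ?C" for \<zeta>
    using boundary_class_mono[OF sub(1), of X \<zeta>] boundary_class_eq[OF that] by simp
  have "(\<Sum>\<zeta>\<in>?C. ?w \<zeta> * measure (gibbs_kernel X V \<Lambda> \<zeta>) A)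
     = (\<Sum>\<zeta>\<in>?C. \<Sum>\<sigma>\<in>boundary_class X \<Lambda> \<zeta> \<inter> A. ?w \<zeta> * ?v \<sigma> / ?Z \<zeta>)"
    by (rule sum.cong) (auto simp: measure_gibbs_kernel[OF C L A] sum_distrib_left sum_divide_distrib)
  also have "\<dots> = (\<Sum>\<zeta>\<in>?C. \<Sum>\<sigma> | \<sigma> \<in> ?C \<inter> A \<and> \<sigma> \<in> boundary_class X \<Lambda> \<zeta>. ?w \<sigma> * ?v \<zeta> / ?Z \<sigma>)"
  proof (intro sum.cong refl)
    fix \<zeta> assume z: "\<zeta> \<in> ?C" 
    show "boundary_class X \<Lambda> \<zeta> \<inter> A = {\<sigma>. \<sigma> \<in> ?C \<inter> A \<and> \<sigma> \<in> boundary_class X \<Lambda> \<zeta>}" using sub'[OF z] by auto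
    fix \<sigma> assume s: "\<sigma> \<in> {\<sigma>. \<sigma> \<in> ?C \<inter> A \<and> \<sigma> \<in> boundary_class X \<Lambda> \<zeta>}"
    then show "?w \<zeta> * ?v \<sigma> / ?Z \<zeta> = ?w \<sigma> * ?v \<zeta> / ?Z \<sigma>"
      using weight_ratio_on_class[OF C[OF z] L' sub, of \<sigma> V] partition_fun_cong[of \<sigma> X \<Lambda> \<zeta>] by simp
  qed
  also have "\<dots> = (\<Sum>\<sigma>\<in>?C \<inter> A. \<Sum>\<zeta> | \<zeta> \<in> ?C \<and> \<sigma> \<in> boundary_class X \<Lambda> \<zeta>. ?w \<sigma> * ?v \<zeta> / ?Z \<sigma>)"
    using fin by (intro sum.swap_restrict) auto
  also have "\<dots> = (\<Sum>\<sigma>\<in>?C \<inter> A. ?w \<sigma>)"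
  proof (rule sum.cong[OF refl])
    fix \<sigma> assume s: "\<sigma> \<in> ?C \<inter> A"
    then have sP: "\<sigma> \<in> Perms X" using C by auto
    have "{\<zeta>. \<zeta> \<in> ?C \<and> \<sigma> \<in> boundary_class X \<Lambda> \<zeta>} = boundary_class X \<Lambda> \<sigma>"
      using sub'[of \<sigma>] s boundary_class_sym[OF sP] boundary_class_sym C by blast
    then have "(\<Sum>\<zeta> | \<zeta> \<in> ?C \<and> \<sigma> \<in> boundary_class X \<Lambda> \<zeta>. ?w \<sigma> * ?v \<zeta> / ?Z \<sigma>) = ?w \<sigma> * ?Z \<sigma> / ?Z \<sigma>"
      by (simp add: partition_fun_eq sum_distrib_left sum_divide_distrib)
    then show "(\<Sum>\<zeta> | \<zeta> \<in> ?C \<and> \<sigma> \<in> boundary_class X \<Lambda> \<zeta>. ?w \<sigma> * ?v \<zeta> / ?Z \<sigma>) = ?w \<sigma>"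
      using partition_fun_pos[OF sP L, of V] by simp
  qed
  finally have "(\<Sum>\<zeta>\<in>?C. ?w \<zeta> * measure (gibbs_kernel X V \<Lambda> \<zeta>) A) = (\<Sum>\<sigma>\<in>?C \<inter> A. ?w \<sigma>)" .
  then show ?thesis
    using nn_integral_gibbs_kernel[OF h L', of "\<lambda>\<zeta>. measure (gibbs_kernel X V \<Lambda> \<zeta>) A" V]
    by (simp add: emeasure_gibbs_kernel[OF h L' A])
qed

section \<open>Jump probabilities by exchange\<close>

text \<open>Each permutation with \<open>\<sigma> x = y\<close> is mapped to one of larger weight by exchanging the images of \<open>x\<close> and
  of its partner \<open>u\<close>. This map is injective, although \<open>u\<close> depends on \<open>\<sigma>\<close>: for the new permutation, \<open>u\<close>
  is the preimage of \<open>y\<close>. Hence the choice of a partner costs no entropy.\<close>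

lemma exchange_bound:
  assumes h: "\<eta> \<in> Perms X" and L: "finite \<Lambda>" "\<Lambda> \<subseteq> X"
    and partner: "\<And>\<sigma>. \<sigma> \<in> boundary_class X \<Lambda> \<eta> \<Longrightarrow> \<sigma> x = y \<Longrightarrow> \<exists>u. u \<noteq> x \<and> u \<in> \<Lambda> \<and> \<sigma> u \<in> \<Lambda> \<and> x \<in> \<Lambda> \<and> y \<in> \<Lambda> \<and>
      g \<le> V (y - x) + V (\<sigma> u - u) - V (\<sigma> u - x) - V (y - u)"
  shows "measure (gibbs_kernel X V \<Lambda> \<eta>) {\<sigma> \<in> Perms X. \<sigma> x = y} \<le> exp (- g)"
proof -
  let ?C = "boundary_class X \<Lambda> \<eta>" and ?w = "weight V \<Lambda>"
  define D where "D = ?C \<inter> {\<sigma> \<in> Perms X. \<sigma> x = y}"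
  have finC: "finite ?C" using finite_boundary_class[OF h L(1)] .
  have D: "\<sigma> \<in> Perms X" "\<sigma> \<in> ?C" "\<sigma> x = y" if "\<sigma> \<in> D" for \<sigma> using that by (auto simp: D_def)
  have "\<exists>U. \<forall>\<sigma>\<in>D. U \<sigma> \<noteq> x \<and> U \<sigma> \<in> \<Lambda> \<and> \<sigma> (U \<sigma>) \<in> \<Lambda> \<and> x \<in> \<Lambda> \<and> y \<in> \<Lambda> \<and>
      g \<le> V (y - x) + V (\<sigma> (U \<sigma>) - U \<sigma>) - V (\<sigma> (U \<sigma>) - x) - V (y - U \<sigma>)"
    by (rule bchoice) (use partner D in blast)
  then obtain U where U: "\<And>\<sigma>. \<sigma> \<in> D \<Longrightarrow> U \<sigma> \<noteq> x \<and> U \<sigma> \<in> \<Lambda> \<and> \<sigma> (U \<sigma>) \<in> \<Lambda> \<and> x \<in> \<Lambda> \<and> y \<in> \<Lambda> \<and>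
      g \<le> V (y - x) + V (\<sigma> (U \<sigma>) - U \<sigma>) - V (\<sigma> (U \<sigma>) - x) - V (y - U \<sigma>)"
    by blast
  define \<Phi> where "\<Phi> \<sigma> = \<sigma> \<circ> Transposition.transpose x (U \<sigma>)" for \<sigma>
  have \<Phi>: "\<Phi> \<sigma> x = \<sigma> (U \<sigma>)" "\<Phi> \<sigma> (U \<sigma>) = \<sigma> x" "\<And>z. z \<noteq> x \<Longrightarrow> z \<noteq> U \<sigma> \<Longrightarrow> \<Phi> \<sigma> z = \<sigma> z" for \<sigma>
    by (auto simp: \<Phi>_def Transposition.transpose_def)
  have \<Phi>P: "\<Phi> \<sigma> \<in> Perms X" if "\<sigma> \<in> D" for \<sigma>
    unfolding \<Phi>_def Perms_def mem_Collect_eq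
    using D(1)[OF that] U[OF that] L by (intro permutes_compose permutes_swap_id) (auto simp: Perms_def)
  have \<Phi>C: "\<Phi> \<sigma> \<in> ?C" if s: "\<sigma> \<in> D" for \<sigma>
  proof -
    note S = PermsD[OF D(1)[OF s]] and P = PermsD[OF \<Phi>P[OF s]] 
    have "agree_off X \<Lambda> (\<Phi> \<sigma>) \<sigma>" unfolding agree_off_def
    proof (intro ballI conjI)
      fix z assume z: "z \<in> X - \<Lambda>"
      show "\<Phi> \<sigma> z = \<sigma> z" using z U[OF s] by (intro \<Phi>(3)) auto
      have "inv \<sigma> z \<noteq> x" "inv \<sigma> z \<noteq> U \<sigma>" using z U[OF s] D(3)[OF s] S(5)[of z] by auto
      then have "\<Phi> \<sigma> (inv \<sigma> z) = z" by (simp add: \<Phi>(3) S(5))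
      then show "inv (\<Phi> \<sigma>) z = inv \<sigma> z" by (simp add: P(10))
    qed
    then have "\<Phi> \<sigma> \<in> boundary_class X \<Lambda> \<sigma>" using \<Phi>P[OF s] by (simp add: boundary_class_def)
    then show ?thesis using boundary_class_eq[OF D(2)[OF s]] by simp
  qed
  have inj: "inj_on \<Phi> D"
  proof (rule inj_onI)
    fix \<sigma> \<tau> assume st: "\<sigma> \<in> D" "\<tau> \<in> D" and e: "\<Phi> \<sigma> = \<Phi> \<tau>"
    have "\<Phi> \<sigma> (U \<sigma>) = \<Phi> \<sigma> (U \<tau>)" using \<Phi>(2)[of \<sigma>] \<Phi>(2)[of \<tau>] e D(3)[OF st(1)] D(3)[OF st(2)] by simp
    then have u: "U \<sigma> = U \<tau>" using PermsD(3)[OF \<Phi>P[OF st(1)]] by (simp add: inj_eq)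
    have "\<Phi> \<sigma> \<circ> Transposition.transpose x (U \<sigma>) = \<Phi> \<tau> \<circ> Transposition.transpose x (U \<tau>)" using e u by simp
    then show "\<sigma> = \<tau>" by (simp add: \<Phi>_def comp_assoc)
  qed
  have w: "?w \<sigma> \<le> exp (- g) * ?w (\<Phi> \<sigma>)" if s: "\<sigma> \<in> D" for \<sigma>
  proof -
    define R where "R = \<Lambda> \<inter> \<sigma> -` \<Lambda> - {x, U \<sigma>}"
    note Us = U[OF s] and Ds = D[OF s]
    have S: "\<Lambda> \<inter> \<sigma> -` \<Lambda> = insert x (insert (U \<sigma>) R)" using Us Ds by (auto simp: R_def)
    have S': "\<Lambda> \<inter> \<Phi> \<sigma> -` \<Lambda> = insert x (insert (U \<sigma>) R)"
    proof (intro set_eqI)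
      fix z show "z \<in> \<Lambda> \<inter> \<Phi> \<sigma> -` \<Lambda> \<longleftrightarrow> z \<in> insert x (insert (U \<sigma>) R)"
        using Us Ds \<Phi>(1,2)[of \<sigma>] \<Phi>(3)[of _ \<sigma>] by (cases "z = x"; cases "z = U \<sigma>") (auto simp: R_def)
    qed
    have fin: "finite R" "x \<notin> R" "U \<sigma> \<notin> R" using L by (auto simp: R_def)
    have "(\<Sum>z\<in>R. V (\<Phi> \<sigma> z - z)) = (\<Sum>z\<in>R. V (\<sigma> z - z))"
      by (rule sum.cong) (auto simp: R_def \<Phi>(3))
    then have "g + Hamiltonian V \<Lambda> (\<Phi> \<sigma>) \<le> Hamiltonian V \<Lambda> \<sigma>"
      unfolding Hamiltonian_def S S' using fin Us Ds \<Phi>(1,2)[of \<sigma>] by auto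
    then show ?thesis by (simp add: weight_def flip: exp_add)
  qed
  have "sum ?w D \<le> (\<Sum>\<sigma>\<in>D. exp (- g) * ?w (\<Phi> \<sigma>))" by (rule sum_mono) (rule w)
  also have "\<dots> = exp (- g) * sum ?w (\<Phi> ` D)" by (simp add: sum.reindex[OF inj] sum_distrib_left)
  also have "\<dots> \<le> exp (- g) * sum ?w ?C"
    using \<Phi>C finC weight_pos by (intro mult_left_mono sum_mono2) (auto intro: less_imp_le)
  finally have "sum ?w D \<le> exp (- g) * partition_fun X V \<Lambda> \<eta>" by (simp add: partition_fun_eq)
  then show ?thesis
    using partition_fun_pos[OF h L(1), of V] measure_gibbs_kernel[OF h L(1), of "{\<sigma> \<in> Perms X. \<sigma> x = y}" V]
    by (simp add: D_def pos_divide_le_eq)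
qed

lemma boundary_class_inv_image:
  assumes h: "\<eta> \<in> Perms X"
  shows "boundary_class X \<Lambda> (inv \<eta>) = inv ` boundary_class X \<Lambda> \<eta>"
proof (intro set_eqI iffI)
  fix \<sigma> assume s: "\<sigma> \<in> boundary_class X \<Lambda> (inv \<eta>)"
  then have sP: "\<sigma> \<in> Perms X" by (simp add: boundary_class_def)
  show "\<sigma> \<in> inv ` boundary_class X \<Lambda> \<eta>"
    using s PermsD(8,9)[OF sP] PermsD(9)[OF h] by (intro image_eqI[of _ _ "inv \<sigma>"]) (auto simp: boundary_class_def agree_off_def)
next
  fix \<sigma> assume "\<sigma> \<in> inv ` boundary_class X \<Lambda> \<eta>"
  then obtain \<tau> where t: "\<sigma> = inv \<tau>" "\<tau> \<in> Perms X" "agree_off X \<Lambda> \<tau> \<eta>" by (auto simp: boundary_class_def)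
  then show "\<sigma> \<in> boundary_class X \<Lambda> (inv \<eta>)"
    using PermsD(8,9)[OF t(2)] PermsD(9)[OF h] by (auto simp: boundary_class_def agree_off_def)
qed

lemma inj_on_inv_Perms: "inj_on inv (Perms X)"
  by (rule inj_on_inverseI[of _ inv]) (rule PermsD(9))

lemma weight_inv:
  assumes s: "\<sigma> \<in> Perms X" and V: "V1 V"
  shows "weight V \<Lambda> (inv \<sigma>) = weight V \<Lambda> \<sigma>"
proof -
  note S = PermsD[OF s]
  have "Hamiltonian V \<Lambda> (inv \<sigma>) = Hamiltonian V \<Lambda> \<sigma>" unfolding Hamiltonian_def
  proof (rule sum.reindex_bij_witness[where i = \<sigma> and j = "inv \<sigma>"])
    fix z show "V (\<sigma> (inv \<sigma> z) - inv \<sigma> z) = V (inv \<sigma> z - z)"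
      using V unfolding V1_def by (metis S(5) minus_diff_eq)
  qed (auto simp: S(5,6))
  then show ?thesis by (simp add: weight_def)
qed

text \<open>As \<open>V\<close> is even, inversion preserves all weights. Jumps to the left thus become jumps to the right,
  with the inverse boundary condition.\<close>

lemma gibbs_kernel_inv:
  assumes h: "\<eta> \<in> Perms X" and L: "finite \<Lambda>" and V: "V1 V"
  shows "measure (gibbs_kernel X V \<Lambda> (inv \<eta>)) {\<sigma> \<in> Perms X. \<sigma> x = y} = measure (gibbs_kernel X V \<Lambda> \<eta>) {\<sigma> \<in> Perms X. \<sigma> y = x}"
proof -
  have sub: "boundary_class X \<Lambda> \<eta> \<subseteq> Perms X" by (auto simp: boundary_class_def)
  have inj: "inj_on inv A" if "A \<subseteq> boundary_class X \<Lambda> \<eta>" for A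
    using inj_on_inv_Perms by (rule inj_on_subset) (use that sub in blast)
  have e: "boundary_class X \<Lambda> (inv \<eta>) \<inter> {\<sigma> \<in> Perms X. \<sigma> x = y} = inv ` (boundary_class X \<Lambda> \<eta> \<inter> {\<sigma> \<in> Perms X. \<sigma> y = x})"
  proof -
    have "inv \<sigma> \<in> Perms X \<and> (inv \<sigma> x = y \<longleftrightarrow> \<sigma> y = x)" if "\<sigma> \<in> Perms X" for \<sigma>
      using PermsD(8,10)[OF that] by simp
    then show ?thesis unfolding boundary_class_inv_image[OF h] using sub by blast
  qed
  have w: "(\<Sum>\<sigma>\<in>inv ` A. weight V \<Lambda> \<sigma>) = (\<Sum>\<sigma>\<in>A. weight V \<Lambda> \<sigma>)" if "A \<subseteq> boundary_class X \<Lambda> \<eta>" for A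
    using weight_inv[OF _ V] that sub by (subst sum.reindex[OF inj[OF that]]) (auto intro!: sum.cong)
  have Z: "partition_fun X V \<Lambda> (inv \<eta>) = partition_fun X V \<Lambda> \<eta>"
    unfolding partition_fun_eq boundary_class_inv_image[OF h] by (rule w) simp
  have m: "{\<sigma> \<in> Perms X. \<sigma> x = y} \<subseteq> Perms X" "{\<sigma> \<in> Perms X. \<sigma> y = x} \<subseteq> Perms X" by auto
  show ?thesis
    unfolding measure_gibbs_kernel[OF h L m(2)] measure_gibbs_kernel[OF PermsD(8)[OF h] L m(1)] e Z
    by (simp add: w)
qed

context point_set begin

text \<open>The exchange partner must lie in \<open>\<Lambda>\<close> together with its image. Otherwise it would follow the shift, and \<open>\<Lambda>\<close>
  is assumed to contain all those points, and their images, that the shift moves from the right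
  of \<open>a\<close> to the left of \<open>b\<close>. Nor does the shift make a jump over the whole window, because such a jump
  would pass more than \<open>\<bar>n\<bar>\<close> points.\<close>

lemma kernel_jump_bound:
  assumes V: "V1 V" and L: "finite \<Lambda>" "\<Lambda> \<subseteq> X" and ab: "a \<notin> X" "b \<notin> X" "a < b"
    and many: "\<bar>n\<bar> < int (card {x \<in> X. a < x \<and> x < b})"
    and U: "{u \<in> X. a < u \<and> shift n u < b} \<subseteq> \<Lambda>" "shift n ` {u \<in> X. a < u \<and> shift n u < b} \<subseteq> \<Lambda>"
    and xy: "x \<in> X" "y \<in> X" "x < a" "b < y"
  shows "measure (gibbs_kernel X V \<Lambda> (shift n)) {\<sigma> \<in> Perms X. \<sigma> x = y} \<le> exp (- gain V (b - a) (a - x) (y - b))"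
proof (rule exchange_bound[OF shift_Perms L])
  fix \<sigma> assume s: "\<sigma> \<in> boundary_class X \<Lambda> (shift n)" and y: "\<sigma> x = y"
  have sP: "\<sigma> \<in> Perms X" and agree: "agree_off X \<Lambda> \<sigma> (shift n)" using s by (auto simp: boundary_class_def)
  have "flow_at X a \<sigma> = Some n"
    using agree_off_flow[OF sP shift_Perms L(1) agree ab(1)] shift_flow[OF ab(1)] by simp
  then obtain u where u: "u \<in> X" "a < u" "\<sigma> u < b"
    using ex_exchange_partner[OF sP ab] many by force
  note eq = agree_off_eq[OF sP shift_Perms agree]
  have uL: "u \<in> \<Lambda> \<and> \<sigma> u \<in> \<Lambda>"
  proof (rule ccontr)
    assume no: "\<not> (u \<in> \<Lambda> \<and> \<sigma> u \<in> \<Lambda>)"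
    then have e: "\<sigma> u = shift n u" by (intro eq[OF u(1)]) auto
    then have "u \<in> {u \<in> X. a < u \<and> shift n u < b}" using u by auto
    then show False using U no e by auto
  qed
  have xL: "x \<in> \<Lambda> \<and> y \<in> \<Lambda>"
  proof (rule ccontr)
    assume "\<not> (x \<in> \<Lambda> \<and> y \<in> \<Lambda>)"
    then have "\<sigma> x = shift n x" using y by (intro eq[OF xy(1)]) auto
    then have "idx y - idx x = n" using y xy by (simp add: shift_def idx_point)
    moreover have "idx y - idx x = point_count x y" using xy ab by (intro idx_diff) auto
    moreover have "card {z \<in> X. a < z \<and> z < b} \<le> card {z \<in> X. x \<le> z \<and> z < y}"
      using xy by (intro card_mono finite_point_count) auto
    ultimately show False using many by (simp add: point_count_def)
  qed
  show "\<exists>u. u \<noteq> x \<and> u \<in> \<Lambda> \<and> \<sigma> u \<in> \<Lambda> \<and> x \<in> \<Lambda> \<and> y \<in> \<Lambda> \<and>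
      gain V (b - a) (a - x) (y - b) \<le> V (y - x) + V (\<sigma> u - u) - V (\<sigma> u - x) - V (y - u)"
    using uL xL u xy exchange_gain[OF V xy(3,4) u(2,3)] by (intro exI[of _ u]) auto
qed

text \<open>The gain degenerates for jumps that end next to the window; by local finiteness the ends keep a
  positive distance.\<close>

lemma ex_gap: assumes "a \<notin> X" obtains m where "0 < m" "\<And>x. x \<in> X \<Longrightarrow> m \<le> \<bar>x - a\<bar>"
proof -
  have fin: "finite {x \<in> X. \<bar>x - a\<bar> \<le> 1}" by (rule finite_within[of _ "a - 1" "a + 1"]) auto
  let ?M = "insert 1 ((\<lambda>x. \<bar>x - a\<bar>) ` {x \<in> X. \<bar>x - a\<bar> \<le> 1})"
  have "0 < Min ?M" using fin assms by (subst Min_gr_iff) auto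
  moreover have "Min ?M \<le> \<bar>x - a\<bar>" if "x \<in> X" for x
  proof (cases "\<bar>x - a\<bar> \<le> 1")
    case True then show ?thesis using fin that by (intro Min_le) auto
  next
    case False
    moreover have "Min ?M \<le> 1" using fin by (intro Min_le) auto
    ultimately show ?thesis by linarith
  qed
  ultimately show ?thesis using that by blast
qed

text \<open>If the length of the jump exceeds some \<open>S\<close>, then the logarithmic lower bound for the gain applies. The
  shorter jumps only enlarge the constant.\<close>

lemma gain_beats_decay:
  assumes V: "V1 V" "V2 V" and ab: "a \<notin> X" "b \<notin> X" "a < b"
  obtains C where "0 \<le> C" "\<And>x y. x \<in> X \<Longrightarrow> y \<in> X \<Longrightarrow> x < a \<Longrightarrow> b < y \<Longrightarrow>
    exp (- gain V (b - a) (a - x) (y - b)) \<le> C * (decay x * decay y)"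
proof -
  obtain m1 where m1: "0 < m1" "\<And>x. x \<in> X \<Longrightarrow> m1 \<le> \<bar>x - a\<bar>" using ex_gap[OF ab(1)] by blast
  obtain m2 where m2: "0 < m2" "\<And>x. x \<in> X \<Longrightarrow> m2 \<le> \<bar>x - b\<bar>" using ex_gap[OF ab(2)] by blast
  obtain S where S: "1 \<le> S" "\<And>s t. min m1 m2 \<le> s \<Longrightarrow> min m1 m2 \<le> t \<Longrightarrow> S \<le> s + t \<Longrightarrow> 4 * ln (s + t) \<le> gain V (b - a) s t"
    using gain_ge_log[OF V, of "min m1 m2" "b - a"] m1 m2 ab by auto
  define D where "D = 1 + \<bar>a\<bar> + \<bar>b\<bar>"
  show ?thesis
  proof (rule that[of "(2 * D * S) ^ 4"])
    show "0 \<le> (2 * D * S) ^ 4" by simp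
    fix x y assume xy: "x \<in> X" "y \<in> X" "x < a" "b < y"
    define s t where "s = a - x" and "t = y - b"
    have st: "min m1 m2 \<le> s" "min m1 m2 \<le> t" "0 < s" "0 < t"
      using m1(2)[OF xy(1)] m2(2)[OF xy(2)] xy by (auto simp: s_def t_def)
    \<comment> \<open>Replacing \<open>s + t\<close> by this maximum treats long and short jumps at the same time.\<close>
    define M where "M = max S (s + t)"
    have M: "1 \<le> M" "s \<le> M" "t \<le> M" "S \<le> M" using S st by (auto simp: M_def)
    have g: "exp (- gain V (b - a) s t) \<le> S ^ 4 / M ^ 4"
    proof (cases "S \<le> s + t")
      case True
      have "exp (- gain V (b - a) s t) \<le> exp (- (4 * ln (s + t)))" using S(2)[OF st(1,2) True] by simp
      also have "\<dots> = 1 / M ^ 4"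
      proof -
        have "exp (4 * ln (s + t)) = exp (ln (s + t)) ^ 4" by (simp flip: exp_of_nat_mult)
        then show ?thesis using True S st by (simp add: exp_minus inverse_eq_divide M_def max_def)
      qed
      also have "\<dots> \<le> S ^ 4 / M ^ 4" using S M by (intro divide_right_mono) auto
      finally show ?thesis .
    next
      case False
      then have "M = S" by (simp add: M_def)
      then show ?thesis using gain_nonneg[OF V(1), of s t "b - a"] st S(1) by simp
    qed
    have bound: "1 + \<bar>z\<bar> \<le> 2 * D * M" if "z = x \<or> z = y" for z
    proof -
      have "1 + \<bar>z\<bar> \<le> D + M" using that M xy unfolding D_def s_def t_def by auto
      also have "\<dots> \<le> D * M + D * M"
        using M by (intro add_mono mult_le_cancel_left1[THEN iffD2] mult_le_cancel_right1[THEN iffD2]) (auto simp: D_def)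
      finally show ?thesis by simp
    qed
    have "(1 + \<bar>x\<bar>)\<^sup>2 * (1 + \<bar>y\<bar>)\<^sup>2 \<le> (2 * D * M)\<^sup>2 * (2 * D * M)\<^sup>2"
      using bound by (intro mult_mono power_mono) auto
    also have "\<dots> = (2 * D * M) ^ 4" by (simp flip: power_add)
    finally have le: "(1 + \<bar>x\<bar>)\<^sup>2 * (1 + \<bar>y\<bar>)\<^sup>2 \<le> (2 * D * M) ^ 4" .
    have dd: "decay x * decay y = 1 / ((1 + \<bar>x\<bar>)\<^sup>2 * (1 + \<bar>y\<bar>)\<^sup>2)" by (simp add: decay_def)
    have pos: "0 < (1 + \<bar>x\<bar>)\<^sup>2 * (1 + \<bar>y\<bar>)\<^sup>2" by (intro mult_pos_pos zero_less_power) linarith+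
    have "S ^ 4 / M ^ 4 = (2 * D * S) ^ 4 * (1 / (2 * D * M) ^ 4)"
      using M by (simp add: power_mult_distrib D_def)
    also have "\<dots> \<le> (2 * D * S) ^ 4 * (decay x * decay y)"
      unfolding dd using le pos less_le_trans[OF pos le]
      by (intro mult_left_mono divide_left_mono mult_pos_pos) simp_all
    finally show "exp (- gain V (b - a) (a - x) (y - b)) \<le> (2 * D * S) ^ 4 * (decay x * decay y)"
      using g by (simp add: s_def t_def)
  qed
qed

lemma eventually_superset:
  assumes "finite U" "U \<subseteq> X"
  shows "eventually (\<lambda>\<Lambda>. finite \<Lambda> \<and> \<Lambda> \<subseteq> X \<and> U \<subseteq> \<Lambda>) (finite_subsets_at_top X)"
  unfolding eventually_finite_subsets_at_top using assms by (intro exI[of _ U]) auto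

lemma finite_shift_window: "finite {u \<in> X. a < u \<and> shift n u < b}"
proof -
  obtain z where z: "z \<in> X" "b < z" using ex_above by auto
  show ?thesis
  proof (rule finite_within[of _ a "point (idx z - n)"])
    fix u assume u: "u \<in> {u \<in> X. a < u \<and> shift n u < b}"
    then have "point (idx u + n) < b" by (auto simp: shift_def)
    then have "point (idx u + n) < point (idx z)" using z by (simp add: point_idx)
    then have "point (idx u) < point (idx z - n)" by (simp add: point_less_iff)
    then show "a \<le> u \<and> u \<le> point (idx z - n)" using u by (simp add: point_idx)
  qed auto
qed

lemma eventually_jump_bound:
  assumes V: "V1 V" "V2 V" and ab: "a \<notin> X" "b \<notin> X" "a < b"
    and many: "\<bar>n\<bar> < int (card {x \<in> X. a < x \<and> x < b})"
  obtains C where "0 \<le> C" "eventually (\<lambda>\<Lambda>. \<forall>x\<in>X. \<forall>y\<in>X. x < a \<longrightarrow> b < y \<longrightarrow> 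
    measure (gibbs_kernel X V \<Lambda> (shift n)) {\<sigma> \<in> Perms X. \<sigma> x = y} \<le> C * (decay x * decay y) \<and>
    measure (gibbs_kernel X V \<Lambda> (shift n)) {\<sigma> \<in> Perms X. \<sigma> y = x} \<le> C * (decay x * decay y)) (finite_subsets_at_top X)"
proof -
  obtain C where C: "0 \<le> C" "\<And>x y. x \<in> X \<Longrightarrow> y \<in> X \<Longrightarrow> x < a \<Longrightarrow> b < y \<Longrightarrow>
    exp (- gain V (b - a) (a - x) (y - b)) \<le> C * (decay x * decay y)"
    using gain_beats_decay[OF V ab] by blast
  define W where "W n = {u \<in> X. a < u \<and> shift n u < b} \<union> shift n ` {u \<in> X. a < u \<and> shift n u < b}" for n
  have W: "finite (W n)" "W n \<subseteq> X" for n
    using finite_shift_window PermsD(4)[OF shift_Perms] by (auto simp: W_def)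
  have *: "eventually (\<lambda>\<Lambda>. \<forall>x\<in>X. \<forall>y\<in>X. x < a \<longrightarrow> b < y \<longrightarrow> 
    measure (gibbs_kernel X V \<Lambda> (shift n)) {\<sigma> \<in> Perms X. \<sigma> x = y} \<le> C * (decay x * decay y)) (finite_subsets_at_top X)"
    if "\<bar>n\<bar> < int (card {x \<in> X. a < x \<and> x < b})" for n
    using eventually_superset[OF W[of n]]
  proof eventually_elim
    case (elim \<Lambda>)
    show ?case
    proof (intro ballI impI)
      fix x y assume xy: "x \<in> X" "y \<in> X" "x < a" "b < y"
      have "measure (gibbs_kernel X V \<Lambda> (shift n)) {\<sigma> \<in> Perms X. \<sigma> x = y} \<le> exp (- gain V (b - a) (a - x) (y - b))"
        using elim by (intro kernel_jump_bound V ab that xy) (auto simp: W_def)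
      also have "\<dots> \<le> C * (decay x * decay y)" by (rule C(2)[OF xy])
      finally show "measure (gibbs_kernel X V \<Lambda> (shift n)) {\<sigma> \<in> Perms X. \<sigma> x = y} \<le> C * (decay x * decay y)" .
    qed
  qed
  have inv: "measure (gibbs_kernel X V \<Lambda> (shift n)) {\<sigma> \<in> Perms X. \<sigma> y = x} = measure (gibbs_kernel X V \<Lambda> (shift (- n))) {\<sigma> \<in> Perms X. \<sigma> x = y}"
    if "finite \<Lambda>" for \<Lambda> x y
    using gibbs_kernel_inv[OF shift_Perms[of n] that V(1), of x y] by (simp add: inv_shift)
  have "\<bar>- n\<bar> < int (card {x \<in> X. a < x \<and> x < b})" using many by simp
  show ?thesis
  proof (rule that[OF C(1)])
    show "eventually (\<lambda>\<Lambda>. \<forall>x\<in>X. \<forall>y\<in>X. x < a \<longrightarrow> b < y \<longrightarrow> 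
      measure (gibbs_kernel X V \<Lambda> (shift n)) {\<sigma> \<in> Perms X. \<sigma> x = y} \<le> C * (decay x * decay y) \<and>
      measure (gibbs_kernel X V \<Lambda> (shift n)) {\<sigma> \<in> Perms X. \<sigma> y = x} \<le> C * (decay x * decay y)) (finite_subsets_at_top X)"
      using *[OF many] *[OF \<open>\<bar>- n\<bar> < _\<close>] eventually_superset[OF finite.emptyI empty_subsetI]
      by eventually_elim (simp add: inv)
  qed
qed

text \<open>The uniform estimate for jumps over \<open>a\<close>. The case \<open>p = a\<close> or \<open>q = a\<close> is included, so that it also controls the
  image and the preimage of a single point \<open>a\<close>.\<close>

definition jump_bound :: "(real \<Rightarrow> real) measure \<Rightarrow> real \<Rightarrow> real \<Rightarrow> real set \<Rightarrow> bool" where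
  "jump_bound M a C T \<longleftrightarrow> (\<forall>p\<in>X. \<forall>q\<in>X. (p, q) \<notin> T \<times> T \<longrightarrow> min p q \<le> a \<longrightarrow> a \<le> max p q \<longrightarrow>
     measure M {\<sigma> \<in> Perms X. \<sigma> p = q} \<le> C * (decay p * decay q))"

text \<open>Choose one window on either side of \<open>a\<close>. A jump over \<open>a\<close> that is not contained in the convex hull of the
  two windows passes over one of them completely.\<close>

lemma eventually_kernel_jump_bound:
  assumes V: "V1 V" "V2 V" 
  obtains C T where "0 \<le> C" "finite T" "T \<subseteq> X" 
    "eventually (\<lambda>\<Lambda>. jump_bound (gibbs_kernel X V \<Lambda> (shift n)) a C T) (finite_subsets_at_top X)"
proof -
  obtain a1 a2 where a: "a < a1" "a1 < a2" "a1 \<notin> X" "a2 \<notin> X" "nat \<bar>n\<bar> < card {x \<in> X. a1 < x \<and> x < a2}"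
    by (rule many_points_above)
  obtain b1 b2 where b: "b2 < a" "b1 < b2" "b1 \<notin> X" "b2 \<notin> X" "nat \<bar>n\<bar> < card {x \<in> X. b1 < x \<and> x < b2}"
    by (rule many_points_below)
  let ?K = "\<lambda>\<Lambda>. measure (gibbs_kernel X V \<Lambda> (shift n))"
  let ?B = "\<lambda>a b C \<Lambda>. \<forall>x\<in>X. \<forall>y\<in>X. x < a \<longrightarrow> b < y \<longrightarrow> 
    ?K \<Lambda> {\<sigma> \<in> Perms X. \<sigma> x = y} \<le> C * (decay x * decay y) \<and>
    ?K \<Lambda> {\<sigma> \<in> Perms X. \<sigma> y = x} \<le> C * (decay x * decay y)"
  have many: "\<bar>n\<bar> < int (card {x \<in> X. a1 < x \<and> x < a2})" "\<bar>n\<bar> < int (card {x \<in> X. b1 < x \<and> x < b2})"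
    using a(5) b(5) by linarith+
  obtain C where C: "0 \<le> C" "eventually (?B a1 a2 C) (finite_subsets_at_top X)"
    by (rule eventually_jump_bound[OF V a(3,4,2) many(1)])
  obtain D where D: "0 \<le> D" "eventually (?B b1 b2 D) (finite_subsets_at_top X)"
    by (rule eventually_jump_bound[OF V b(3,4,2) many(2)])
  define E where "E = max C D"
  define T where "T = {x \<in> X. b1 \<le> x \<and> x \<le> a2}"
  have mono: "C * (decay p * decay q) \<le> E * (decay p * decay q)" "D * (decay p * decay q) \<le> E * (decay p * decay q)" for p q
    using decay_pos[of p] decay_pos[of q] by (auto simp: E_def intro!: mult_right_mono)
  show ?thesis
  proof (rule that[of E T])
    show "0 \<le> E" using C by (simp add: E_def)
    show "finite T" "T \<subseteq> X" using finite_bounded_part by (auto simp: T_def)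
    show "eventually (\<lambda>\<Lambda>. jump_bound (gibbs_kernel X V \<Lambda> (shift n)) a E T) (finite_subsets_at_top X)"
      using C(2) D(2)
    proof eventually_elim
      case (elim \<Lambda>)
      have *: "?K \<Lambda> {\<sigma> \<in> Perms X. \<sigma> p = q} \<le> E * (decay p * decay q) \<and> ?K \<Lambda> {\<sigma> \<in> Perms X. \<sigma> q = p} \<le> E * (decay p * decay q)"
        if pq: "p \<in> X" "q \<in> X" "p \<le> a" "a \<le> q" "(p, q) \<notin> T \<times> T" for p q
      proof (cases "a2 < q")
        case True
        moreover have "p < a1" using pq a by simp
        ultimately show ?thesis 
          using elim(1)[rule_format, OF pq(1,2)] mono(1)[of p q] by (auto intro: order_trans)
      next
        case False
        then have "p < b1" using pq a b by (auto simp: T_def)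
        moreover have "b2 < q" using pq b by simp
        ultimately show ?thesis 
          using elim(2)[rule_format, OF pq(1,2)] mono(2)[of p q] by (auto intro: order_trans)
      qed
      show ?case unfolding jump_bound_def
      proof (intro ballI impI)
        fix p q assume pq: "p \<in> X" "q \<in> X" "(p, q) \<notin> T \<times> T" "min p q \<le> a" "a \<le> max p q"
        show "?K \<Lambda> {\<sigma> \<in> Perms X. \<sigma> p = q} \<le> E * (decay p * decay q)"
          using *[of p q] *[of q p] pq by (cases "p \<le> q") (auto simp: mult.commute)
      qed
    qed
  qed
qed

end

section \<open>Local events and escaping jumps\<close>

text \<open>Tychonoff's theorem in the form of a common refinement of the filter along which all members of a
  bounded family converge.\<close>

lemma bounded_family_cluster:
  fixes f :: "'k \<Rightarrow> 'i \<Rightarrow> real"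
  assumes F: "F \<noteq> bot" and bound: "\<And>k i. \<bar>f k i\<bar> \<le> B i"
  obtains G g where "G \<noteq> bot" "G \<le> F" "\<And>i. ((\<lambda>k. f k i) \<longlongrightarrow> g i) G"
proof -
  let ?S = "PiE UNIV (\<lambda>i. {- B i..B i})"
  have "compactin (product_topology (\<lambda>i. euclidean) UNIV) ?S"
    by (simp add: compactin_PiE)
  then have "compact ?S" by (simp add: euclidean_product_topology)
  moreover have "filtermap f F \<noteq> bot" using F by (simp add: filtermap_bot_iff)
  moreover have "eventually (\<lambda>h. h \<in> ?S) (filtermap f F)"
  proof -
    have "f k i \<in> {- B i..B i}" for k i using bound[of k i] by (auto simp: abs_le_iff)
    then show ?thesis by (simp add: eventually_filtermap PiE_iff)
  qed
  ultimately obtain g where g: "inf (nhds g) (filtermap f F) \<noteq> bot"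
    unfolding compact_filter by blast
  define G where "G = inf (filtercomap f (nhds g)) F"
  have nb: "G \<noteq> bot"
  proof
    assume "G = bot"
    then have "eventually (\<lambda>_. False) G" by simp
    then obtain P R where PR: "eventually P (nhds g)" "eventually R F" "\<And>k. P (f k) \<Longrightarrow> R k \<Longrightarrow> False"
      unfolding G_def eventually_inf eventually_filtercomap by blast
    have "eventually (\<lambda>h. \<not> P h) (filtermap f F)"
      using PR(2) unfolding eventually_filtermap by eventually_elim (use PR(3) in blast)
    then have "eventually (\<lambda>_. False) (inf (nhds g) (filtermap f F))"
      unfolding eventually_inf using PR(1) by blast
    then show False using g by (simp add: trivial_limit_def)
  qed
  have "filterlim f (nhds g) G" unfolding G_def
    by (rule filterlim_mono[OF filterlim_filtercomap order_refl inf_le1])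
  then have "((\<lambda>k. f k i) \<longlongrightarrow> g i) G" for i
    by (rule continuous_on_tendsto_compose[OF continuous_on_product_coordinates]) auto
  moreover have "G \<le> F" by (simp add: G_def)
  ultimately show ?thesis using that nb by blast
qed

lemma tendsto_finite_range:
  fixes l :: real
  assumes "(f \<longlongrightarrow> l) G" "eventually (\<lambda>k. f k \<in> T) G" "finite T"
  shows "eventually (\<lambda>k. f k = l) G"
proof -
  have "open (- (T - {l}))" using assms(3) by (intro open_Compl finite_imp_closed) simp
  then have "eventually (\<lambda>k. f k \<in> - (T - {l})) G" by (rule topological_tendstoD[OF assms(1)]) simp
  with assms(2) show ?thesis by eventually_elim auto
qed

lemma (in finite_measure) measure_countable_UN_le:
  assumes I: "countable I" and A: "\<And>i. i \<in> I \<Longrightarrow> A i \<in> sets M"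
    and B: "\<And>F. finite F \<Longrightarrow> F \<subseteq> I \<Longrightarrow> (\<Sum>i\<in>F. measure M (A i)) \<le> B"
  shows "measure M (\<Union>i\<in>I. A i) \<le> B"
proof (cases "I = {}")
  case True
  then show ?thesis using B[of "{}"] by simp
next
  case False
  define J where "J k = from_nat_into I ` {..<k}" for k :: nat
  define U where "U k = (\<Union>i\<in>J k. A i)" for k
  have J: "finite (J k)" "J k \<subseteq> I" for k using from_nat_into[OF False] by (auto simp: J_def)
  have Us: "range U \<subseteq> sets M" using J A by (auto simp: U_def intro!: sets.finite_UN)
  have "incseq U" unfolding U_def J_def by (rule incseq_SucI) (intro UN_mono image_mono, auto)
  then have "(\<lambda>k. measure M (U k)) \<longlonglongrightarrow> measure M (\<Union>k. U k)" using Us by (rule finite_Lim_measure_incseq[rotated])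
  moreover have "(\<Union>k. U k) = (\<Union>i\<in>I. A i)"
  proof -
    have "(\<Union>k. J k) = I" 
    proof
      show "I \<subseteq> (\<Union>k. J k)"
      proof
        fix i assume "i \<in> I"
        then have "from_nat_into I (to_nat_on I i) = i" using I by simp
        then show "i \<in> (\<Union>k. J k)" unfolding J_def by (intro UN_I[of "Suc (to_nat_on I i)"]) force+
      qed
    qed (use J in auto)
    then show ?thesis unfolding U_def by blast
  qed
  moreover have "measure M (U k) \<le> B" for k
  proof -
    have "measure M (U k) \<le> (\<Sum>i\<in>J k. measure M (A i))" unfolding U_def
      using J A by (intro finite_measure_subadditive_finite) auto
    also have "\<dots> \<le> B" by (rule B[OF J])
    finally show ?thesis .
  qed
  ultimately show ?thesis by (metis LIMSEQ_le_const2)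
qed

context point_set begin

text \<open>Events that are decided by the images and preimages of finitely many points.\<close>

definition local_events :: "(real \<Rightarrow> real) set set" where
  "local_events = {A. A \<subseteq> Perms X \<and> (\<exists>J. finite J \<and> J \<subseteq> X \<and> 
     (\<forall>\<sigma>\<in>A. \<forall>\<tau>\<in>Perms X. (\<forall>x\<in>J. \<sigma> x = \<tau> x \<and> inv \<sigma> x = inv \<tau> x) \<longrightarrow> \<tau> \<in> A))}"

lemma local_eventI:
  assumes "finite J" "J \<subseteq> X" 
    and "\<And>\<sigma> \<tau>. \<sigma> \<in> Perms X \<Longrightarrow> \<tau> \<in> Perms X \<Longrightarrow> (\<And>x. x \<in> J \<Longrightarrow> \<sigma> x = \<tau> x) \<Longrightarrow> (\<And>x. x \<in> J \<Longrightarrow> inv \<sigma> x = inv \<tau> x) \<Longrightarrow> P \<sigma> \<Longrightarrow> P \<tau>"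
  shows "{\<sigma> \<in> Perms X. P \<sigma>} \<in> local_events"
  unfolding local_events_def
proof (rule CollectI, intro conjI exI[of _ J] ballI impI assms(1,2))
  fix \<sigma> \<tau> assume s: "\<sigma> \<in> {\<sigma> \<in> Perms X. P \<sigma>}" "\<tau> \<in> Perms X" "\<forall>x\<in>J. \<sigma> x = \<tau> x \<and> inv \<sigma> x = inv \<tau> x"
  then show "\<tau> \<in> {\<sigma> \<in> Perms X. P \<sigma>}" using assms(3)[of \<sigma> \<tau>] by simp
qed auto

lemma local_eventE:
  assumes "A \<in> local_events"
  obtains J where "finite J" "J \<subseteq> X" 
    "\<And>\<sigma> \<tau>. \<sigma> \<in> A \<Longrightarrow> \<tau> \<in> Perms X \<Longrightarrow> (\<And>x. x \<in> J \<Longrightarrow> \<sigma> x = \<tau> x \<and> inv \<sigma> x = inv \<tau> x) \<Longrightarrow> \<tau> \<in> A"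
  using assms unfolding local_events_def by auto

lemma local_events_sub: "A \<in> local_events \<Longrightarrow> A \<subseteq> Perms X"
  by (simp add: local_events_def)

lemma local_events_algebra: "algebra (Perms X) local_events"
  unfolding algebra_iff_Int
proof (intro conjI ballI)
  show "local_events \<subseteq> Pow (Perms X)" using local_events_sub by auto
  show "{} \<in> local_events" using local_eventI[of "{}" "\<lambda>_. False"] by simp
next
  fix A assume A: "A \<in> local_events"
  then obtain J where J: "finite J" "J \<subseteq> X" 
    "\<And>\<sigma> \<tau>. \<sigma> \<in> A \<Longrightarrow> \<tau> \<in> Perms X \<Longrightarrow> (\<And>x. x \<in> J \<Longrightarrow> \<sigma> x = \<tau> x \<and> inv \<sigma> x = inv \<tau> x) \<Longrightarrow> \<tau> \<in> A"
    by (rule local_eventE) blast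
  have "{\<sigma> \<in> Perms X. \<sigma> \<notin> A} \<in> local_events"
  proof (rule local_eventI[OF J(1,2)])
    fix \<sigma> \<tau> assume "\<sigma> \<in> Perms X" "\<And>x. x \<in> J \<Longrightarrow> \<sigma> x = \<tau> x" "\<And>x. x \<in> J \<Longrightarrow> inv \<sigma> x = inv \<tau> x" "\<sigma> \<notin> A"
    then show "\<tau> \<notin> A" using J(3)[of \<tau> \<sigma>] by auto
  qed
  moreover have "{\<sigma> \<in> Perms X. \<sigma> \<notin> A} = Perms X - A" by auto
  ultimately show "Perms X - A \<in> local_events" by simp
next
  fix A B assume A: "A \<in> local_events" and B: "B \<in> local_events"
  obtain J where J: "finite J" "J \<subseteq> X" 
    "\<And>\<sigma> \<tau>. \<sigma> \<in> A \<Longrightarrow> \<tau> \<in> Perms X \<Longrightarrow> (\<And>x. x \<in> J \<Longrightarrow> \<sigma> x = \<tau> x \<and> inv \<sigma> x = inv \<tau> x) \<Longrightarrow> \<tau> \<in> A"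
    by (rule local_eventE[OF A]) blast
  obtain K where K: "finite K" "K \<subseteq> X" 
    "\<And>\<sigma> \<tau>. \<sigma> \<in> B \<Longrightarrow> \<tau> \<in> Perms X \<Longrightarrow> (\<And>x. x \<in> K \<Longrightarrow> \<sigma> x = \<tau> x \<and> inv \<sigma> x = inv \<tau> x) \<Longrightarrow> \<tau> \<in> B"
    by (rule local_eventE[OF B]) blast
  have "{\<sigma> \<in> Perms X. \<sigma> \<in> A \<and> \<sigma> \<in> B} \<in> local_events"
  proof (rule local_eventI[of "J \<union> K"])
    fix \<sigma> \<tau> assume st: "\<sigma> \<in> Perms X" "\<tau> \<in> Perms X" "\<And>x. x \<in> J \<union> K \<Longrightarrow> \<sigma> x = \<tau> x" "\<And>x. x \<in> J \<union> K \<Longrightarrow> inv \<sigma> x = inv \<tau> x" "\<sigma> \<in> A \<and> \<sigma> \<in> B"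
    show "\<tau> \<in> A \<and> \<tau> \<in> B"
    proof
      show "\<tau> \<in> A" by (rule J(3)[of \<sigma>]) (use st in auto)
      show "\<tau> \<in> B" by (rule K(3)[of \<sigma>]) (use st in auto)
    qed
  qed (use J K in auto)
  moreover have "{\<sigma> \<in> Perms X. \<sigma> \<in> A \<and> \<sigma> \<in> B} = A \<inter> B" using local_events_sub[OF A] by auto
  ultimately show "A \<inter> B \<in> local_events" by simp
qed

sublocale L: algebra "Perms X" local_events by (rule local_events_algebra)

lemma space_perm_space [simp]: "space (perm_space X) = Perms X"
  unfolding perm_space_def by (rule space_measure_of) auto

lemma sets_perm_space_generators: "sets (perm_space X) = sigma_sets (Perms X)
    ({{\<sigma> \<in> Perms X. \<sigma> x \<in> B} | x B. x \<in> X \<and> B \<subseteq> X} \<union> {{\<sigma> \<in> Perms X. inv \<sigma> x \<in> B} | x B. x \<in> X \<and> B \<subseteq> X})"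
  unfolding perm_space_def by (rule sets_measure_of) auto

lemma coordinate_sets:
  assumes "x \<in> X"
  shows "{\<sigma> \<in> Perms X. \<sigma> x = y} \<in> sets (perm_space X)" "{\<sigma> \<in> Perms X. inv \<sigma> x = y} \<in> sets (perm_space X)"
proof -
  have gen: "{{\<sigma> \<in> Perms X. \<sigma> x \<in> B} | x B. x \<in> X \<and> B \<subseteq> X} \<union> {{\<sigma> \<in> Perms X. inv \<sigma> x \<in> B} | x B. x \<in> X \<and> B \<subseteq> X} \<subseteq> sets (perm_space X)"
    unfolding sets_perm_space_generators by (rule subsetI) (rule sigma_sets.Basic)
  have "{\<sigma> \<in> Perms X. \<sigma> x = y} = {\<sigma> \<in> Perms X. \<sigma> x \<in> {y} \<inter> X}" 
    "{\<sigma> \<in> Perms X. inv \<sigma> x = y} = {\<sigma> \<in> Perms X. inv \<sigma> x \<in> {y} \<inter> X}"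
    using assms PermsD(4,7) by blast+
  moreover have "{\<sigma> \<in> Perms X. \<sigma> x \<in> {y} \<inter> X} \<in> sets (perm_space X)" "{\<sigma> \<in> Perms X. inv \<sigma> x \<in> {y} \<inter> X} \<in> sets (perm_space X)"
    by (rule subsetD[OF gen], use assms in blast)+
  ultimately show "{\<sigma> \<in> Perms X. \<sigma> x = y} \<in> sets (perm_space X)" "{\<sigma> \<in> Perms X. inv \<sigma> x = y} \<in> sets (perm_space X)"
    by simp_all
qed

text \<open>Only countably many patterns are possible on a finite set of points.\<close>

lemma local_events_measurable:
  assumes A: "A \<in> local_events" shows "A \<in> sets (perm_space X)"
proof -
  obtain J where J: "finite J" "J \<subseteq> X" 
    "\<And>\<sigma> \<tau>. \<sigma> \<in> A \<Longrightarrow> \<tau> \<in> Perms X \<Longrightarrow> (\<And>x. x \<in> J \<Longrightarrow> \<sigma> x = \<tau> x \<and> inv \<sigma> x = inv \<tau> x) \<Longrightarrow> \<tau> \<in> A"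
    by (rule local_eventE[OF A]) blast
  define pat where "pat \<eta> = (restrict \<eta> J, restrict (inv \<eta>) J)" for \<eta> :: "real \<Rightarrow> real"
  define cyl where "cyl f = {\<sigma> \<in> Perms X. \<forall>x\<in>J. \<sigma> x = fst f x \<and> inv \<sigma> x = snd f x}" for f :: "(real \<Rightarrow> real) \<times> (real \<Rightarrow> real)"
  have cyl: "cyl f \<in> sets (perm_space X)" for f
    using sets.sets_Collect_finite_All[of J "perm_space X" "\<lambda>x \<sigma>. \<sigma> x = fst f x \<and> inv \<sigma> x = snd f x"] J(1,2)
      coordinate_sets sets.sets_Collect_conj[of "perm_space X"] unfolding cyl_def by (simp add: subset_iff)
  have "countable (PiE J (\<lambda>_. X) \<times> PiE J (\<lambda>_. X))"
    using J(1) countable_X by (intro countable_SIGMA countable_PiE) auto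
  moreover have "pat ` A \<subseteq> PiE J (\<lambda>_. X) \<times> PiE J (\<lambda>_. X)"
  proof (rule image_subsetI)
    fix \<sigma> assume "\<sigma> \<in> A"
    then have s: "\<sigma> \<in> Perms X" using local_events_sub[OF A] by auto
    show "pat \<sigma> \<in> PiE J (\<lambda>_. X) \<times> PiE J (\<lambda>_. X)"
      using J(2) by (auto simp: pat_def PermsD(4,7)[OF s])
  qed
  ultimately have "countable (pat ` A)" by (rule countable_subset[rotated])
  then have "(\<Union>f\<in>pat ` A. cyl f) \<in> sets (perm_space X)" using cyl by (intro sets.countable_UN') auto
  moreover have "(\<Union>f\<in>pat ` A. cyl f) = A"
  proof (intro set_eqI iffI)
    fix \<tau> assume "\<tau> \<in> (\<Union>f\<in>pat ` A. cyl f)"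
    then obtain \<sigma> where "\<sigma> \<in> A" "\<tau> \<in> Perms X" "\<forall>x\<in>J. \<tau> x = \<sigma> x \<and> inv \<tau> x = inv \<sigma> x"
      by (auto simp: cyl_def pat_def)
    then show "\<tau> \<in> A" using J(3)[of \<sigma> \<tau>] by auto
  next
    fix \<tau> assume "\<tau> \<in> A"
    then show "\<tau> \<in> (\<Union>f\<in>pat ` A. cyl f)" using local_events_sub[OF A]
      by (intro UN_I[of "pat \<tau>"]) (auto simp: cyl_def pat_def)
  qed
  ultimately show ?thesis by simp
qed

lemma sets_perm_space: "sets (perm_space X) = sigma_sets (Perms X) local_events"
proof
  show "sigma_sets (Perms X) local_events \<subseteq> sets (perm_space X)"
    using sets.sigma_sets_subset[of local_events "perm_space X"] local_events_measurable by auto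
  have "{\<sigma> \<in> Perms X. \<sigma> x \<in> B} \<in> local_events" "{\<sigma> \<in> Perms X. inv \<sigma> x \<in> B} \<in> local_events" 
    if "x \<in> X" for x B by (rule local_eventI[of "{x}"]; use that in simp)+
  then have "{{\<sigma> \<in> Perms X. \<sigma> x \<in> B} | x B. x \<in> X \<and> B \<subseteq> X} \<union> {{\<sigma> \<in> Perms X. inv \<sigma> x \<in> B} | x B. x \<in> X \<and> B \<subseteq> X} \<subseteq> local_events"
    by (intro Un_least subsetI; elim CollectE exE conjE; simp)
  then have "sigma_sets (Perms X) ({{\<sigma> \<in> Perms X. \<sigma> x \<in> B} | x B. x \<in> X \<and> B \<subseteq> X} \<union> {{\<sigma> \<in> Perms X. inv \<sigma> x \<in> B} | x B. x \<in> X \<and> B \<subseteq> X}) \<subseteq> sigma_sets (Perms X) local_events"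
    by (rule sigma_sets_mono')
  then show "sets (perm_space X) \<subseteq> sigma_sets (Perms X) local_events"
    unfolding sets_perm_space_generators .
qed

text \<open>The event that some jump over \<open>a\<close>, or from or to \<open>a\<close>, is not contained in the box \<open>T\<close>.\<close>

definition escape :: "real \<Rightarrow> real set \<Rightarrow> (real \<Rightarrow> real) set" where
  "escape a T = {\<sigma> \<in> Perms X. \<exists>p\<in>X. (p, \<sigma> p) \<notin> T \<times> T \<and> min p (\<sigma> p) \<le> a \<and> a \<le> max p (\<sigma> p)}"

definition jumps :: "real \<Rightarrow> real set \<Rightarrow> (real \<times> real) set" where
  "jumps a T = {(p, q) \<in> X \<times> X. (p, q) \<notin> T \<times> T \<and> min p q \<le> a \<and> a \<le> max p q}"

lemma countable_jumps: "countable (jumps a T)"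
  by (rule countable_subset[of _ "X \<times> X"]) (auto simp: jumps_def countable_X)

lemma escape_eq_UN: "escape a T = (\<Union>i\<in>jumps a T. {\<sigma> \<in> Perms X. \<sigma> (fst i) = snd i})"
proof (intro set_eqI iffI)
  fix \<sigma> assume "\<sigma> \<in> escape a T"
  then obtain p where "\<sigma> \<in> Perms X" "p \<in> X" "(p, \<sigma> p) \<notin> T \<times> T" "min p (\<sigma> p) \<le> a" "a \<le> max p (\<sigma> p)"
    by (auto simp only: escape_def)
  then show "\<sigma> \<in> (\<Union>i\<in>jumps a T. {\<sigma> \<in> Perms X. \<sigma> (fst i) = snd i})"
    by (intro UN_I[of "(p, \<sigma> p)"]) (simp_all add: jumps_def PermsD(4))
next
  fix \<sigma> assume "\<sigma> \<in> (\<Union>i\<in>jumps a T. {\<sigma> \<in> Perms X. \<sigma> (fst i) = snd i})"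
  then obtain p where "\<sigma> \<in> Perms X" "(p, \<sigma> p) \<in> jumps a T" by auto
  then show "\<sigma> \<in> escape a T" unfolding escape_def jumps_def by (intro CollectI conjI bexI[of _ p]) simp_all
qed

lemma escape_measurable: "escape a T \<in> sets (perm_space X)"
  unfolding escape_eq_UN
  by (intro sets.countable_UN' countable_jumps) (auto simp: jumps_def intro: coordinate_sets(1))

text \<open>The union bound over all jumps leaving the box. The box depends only on the constants of the jump
  bound, which gives uniformity in the measure \<open>M\<close>.\<close>

lemma escape_small:
  assumes "X2 X" and C: "0 \<le> C" and T0: "finite T0" "T0 \<subseteq> X" and e: "0 < e"
  obtains T where "finite T" "T0 \<subseteq> T" "T \<subseteq> X" 
    "\<And>M. prob_space M \<Longrightarrow> sets (perm_space X) \<subseteq> sets M \<Longrightarrow> jump_bound M a C T0 \<Longrightarrow> measure M (escape a T) \<le> e"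
proof -
  have e': "0 < e / (C + 1)" using C e by simp
  obtain T where T: "finite T" "T0 \<subseteq> T" "T \<subseteq> X"
    "\<And>F. finite F \<Longrightarrow> F \<subseteq> X \<times> X \<Longrightarrow> F \<inter> T \<times> T = {} \<Longrightarrow> (\<Sum>(p,q)\<in>F. decay p * decay q) \<le> e / (C + 1)"
    by (rule decay_pairs_tail[OF assms(1) e' T0]) (rule that)
  let ?I = "jumps a T"
  show ?thesis
  proof (rule that[OF T(1-3)])
    fix M assume M: "prob_space M" "sets (perm_space X) \<subseteq> sets M" "jump_bound M a C T0"
    interpret prob_space M by fact
    have m: "{\<sigma> \<in> Perms X. \<sigma> (fst i) = snd i} \<in> sets M" if "i \<in> ?I" for i
      using coordinate_sets(1)[of "fst i" "snd i"] that M(2) by (auto simp: jumps_def)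
    have "measure M (\<Union>i\<in>?I. {\<sigma> \<in> Perms X. \<sigma> (fst i) = snd i}) \<le> e"
    proof (rule measure_countable_UN_le[OF countable_jumps m])
      fix F assume F: "finite F" "F \<subseteq> ?I"
      have "(\<Sum>i\<in>F. measure M {\<sigma> \<in> Perms X. \<sigma> (fst i) = snd i}) \<le> (\<Sum>i\<in>F. C * (decay (fst i) * decay (snd i)))"
      proof (rule sum_mono)
        fix i assume "i \<in> F"
        then have "fst i \<in> X" "snd i \<in> X" "(fst i, snd i) \<notin> T0 \<times> T0" "min (fst i) (snd i) \<le> a" "a \<le> max (fst i) (snd i)"
          using F T(2) by (auto simp: jumps_def)
        then show "measure M {\<sigma> \<in> Perms X. \<sigma> (fst i) = snd i} \<le> C * (decay (fst i) * decay (snd i))"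
          using M(3) unfolding jump_bound_def by blast
      qed
      also have "\<dots> = C * (\<Sum>(p,q)\<in>F. decay p * decay q)" by (simp add: sum_distrib_left case_prod_unfold)
      also have "\<dots> \<le> C * (e / (C + 1))"
        using F C by (intro mult_left_mono T(4)) (auto simp: jumps_def)
      also have "\<dots> \<le> e" using C e by (simp add: field_simps)
      finally show "(\<Sum>i\<in>F. measure M {\<sigma> \<in> Perms X. \<sigma> (fst i) = snd i}) \<le> e" .
    qed
    then show "measure M (escape a T) \<le> e" by (simp only: escape_eq_UN)
  qed
qed

end

section \<open>Compactness\<close>

context point_set begin

text \<open>A pointwise limit of permutations need not be surjective. Since images and preimages both stay in
  finite sets, the permutations and their inverses converge together, and the limits are inverse to
  each other.\<close>

lemma cluster_permutation:
  fixes s :: "nat \<Rightarrow> real \<Rightarrow> real"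
  assumes s: "\<And>k. s k \<in> Perms X" and fin: "\<And>x. x \<in> X \<Longrightarrow> \<exists>T. finite T \<and> (\<forall>k. s k x \<in> T \<and> inv (s k) x \<in> T)"
  obtains G \<tau> where "G \<noteq> bot" "G \<le> sequentially" "\<tau> \<in> Perms X" 
    "\<And>x. eventually (\<lambda>k. s k x = \<tau> x \<and> inv (s k) x = inv \<tau> x) G"
proof -
  define f where "f k i = (if fst i then s k (snd i) else inv (s k) (snd i))" for k and i :: "bool \<times> real"
  have T: "\<exists>T. finite T \<and> (\<forall>k. f k i \<in> T)" for i
  proof (cases "snd i \<in> X")
    case True
    then show ?thesis using fin[of "snd i"] unfolding f_def by (auto split: if_splits)
  next
    case False
    then have "s k (snd i) = snd i" "inv (s k) (snd i) = snd i" for k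
      using permutes_not_in[OF PermsD(1)[OF s[of k]] False] PermsD(10)[OF s[of k]] by auto
    then show ?thesis by (intro exI[of _ "{snd i}"]) (simp add: f_def)
  qed
  have "\<exists>B. \<forall>k. \<bar>f k i\<bar> \<le> B" for i
  proof -
    obtain T where "finite T" "\<forall>k. f k i \<in> T" using T by blast
    then have "\<bar>f k i\<bar> \<le> Max (abs ` T)" for k by (intro Max_ge) auto
    then show ?thesis by blast
  qed
  then obtain B where B: "\<And>k i. \<bar>f k i\<bar> \<le> B i" by metis
  obtain G g where G: "G \<noteq> bot" "G \<le> sequentially" "\<And>i. ((\<lambda>k. f k i) \<longlongrightarrow> g i) G"
    by (rule bounded_family_cluster[of sequentially f B, OF sequentially_bot B]) (rule that)
  have ev: "eventually (\<lambda>k. f k i = g i) G" for i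
  proof -
    obtain T where T: "finite T" "\<forall>k. f k i \<in> T" using T by blast
    show ?thesis by (rule tendsto_finite_range[OF G(3) _ T(1)]) (use T in simp)
  qed
  define \<tau> where "\<tau> x = g (True, x)" for x
  define \<tau>' where "\<tau>' x = g (False, x)" for x
  have ev1: "eventually (\<lambda>k. s k x = \<tau> x) G" for x using ev[of "(True, x)"] by (simp add: f_def \<tau>_def)
  have ev2: "eventually (\<lambda>k. inv (s k) x = \<tau>' x) G" for x using ev[of "(False, x)"] by (simp add: f_def \<tau>'_def)
  have r: "\<tau> (\<tau>' x) = x" for x
  proof -
    have "eventually (\<lambda>k. \<tau> (\<tau>' x) = x) G"
      using ev1[of "\<tau>' x"] ev2[of x] 
    proof eventually_elim
      case (elim k)
      then show ?case using PermsD(5)[OF s[of k], of x] by simp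
    qed
    then show ?thesis using G(1) by simp
  qed
  have l: "\<tau>' (\<tau> x) = x" for x
  proof -
    have "eventually (\<lambda>k. \<tau>' (\<tau> x) = x) G"
      using ev2[of "\<tau> x"] ev1[of x] 
    proof eventually_elim
      case (elim k)
      then show ?case using PermsD(6)[OF s[of k], of x] by simp
    qed
    then show ?thesis using G(1) by simp
  qed
  have inv: "inv \<tau> = \<tau>'" by (rule inv_equality) (simp_all add: l r)
  have "\<tau> x = x" if "x \<notin> X" for x
  proof -
    have "eventually (\<lambda>k. \<tau> x = x) G"
      using ev1[of x] 
    proof eventually_elim
      case (elim k)
      then show ?case using permutes_not_in[OF PermsD(1)[OF s[of k]] that] by simp
    qed
    then show ?thesis using G(1) by simp
  qed
  moreover have "\<exists>!x. \<tau> x = y" for y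
    by (rule ex1I[of _ "\<tau>' y"]) (auto simp: l r)
  ultimately have "\<tau> \<in> Perms X" by (simp add: Perms_def permutes_def)
  moreover have "eventually (\<lambda>k. s k x = \<tau> x \<and> inv (s k) x = inv \<tau> x) G" for x
    using ev1[of x] ev2[of x] unfolding inv by eventually_elim simp
  ultimately show ?thesis using that[OF G(1,2)] by blast
qed

text \<open>A compactness criterion in the spirit of Prokhorov. Additivity of the limit on local events is
  immediate. Continuity at the empty set is where tightness is needed: a decreasing sequence of local
  events of mass at least \<open>e\<close> still has positive mass after the events of large jumps at the
  successive points of \<open>X\<close> are removed, with mass at most \<open>e / 4\<close>, \<open>e / 8\<close>, and so on. A cluster point of
  permutations chosen from the remaining sets lies in all the events.\<close>

lemma tight_family_has_local_limit:
  fixes M :: "'k \<Rightarrow> (real \<Rightarrow> real) measure"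
  assumes F: "F \<noteq> bot"
    and M: "eventually (\<lambda>k. prob_space (M k) \<and> space (M k) = Perms X \<and> local_events \<subseteq> sets (M k)) F"
    and tight: "\<And>x e. x \<in> X \<Longrightarrow> 0 < e \<Longrightarrow> \<exists>T. finite T \<and> 
      eventually (\<lambda>k. measure (M k) {\<sigma> \<in> Perms X. \<sigma> x \<notin> T \<or> inv \<sigma> x \<notin> T} \<le> e) F"
  obtains \<mu> G where "prob_space \<mu>" "sets \<mu> = sets (perm_space X)" "G \<noteq> bot" "G \<le> F"
    "\<And>A. A \<in> local_events \<Longrightarrow> ((\<lambda>k. measure (M k) A) \<longlongrightarrow> measure \<mu> A) G"
proof -
  define f where "f k A = (if prob_space (M k) then measure (M k) A else 0)" for k A
  have "\<bar>f k A\<bar> \<le> 1" for k A by (simp add: f_def prob_space.prob_le_1)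
  then obtain G m where G: "G \<noteq> bot" "G \<le> F" and lim0: "\<And>A. ((\<lambda>k. f k A) \<longlongrightarrow> m A) G"
    by (rule bounded_family_cluster[OF F, of f "\<lambda>_. 1"]) blast
  have MG: "eventually (\<lambda>k. prob_space (M k) \<and> space (M k) = Perms X \<and> local_events \<subseteq> sets (M k)) G"
    using M G(2) by (rule filter_leD[rotated])
  have lim: "((\<lambda>k. measure (M k) A) \<longlongrightarrow> m A) G" for A
    by (rule Lim_transform_eventually[OF lim0]) (use MG in eventually_elim, simp add: f_def)
  have m0: "0 \<le> m A" for A by (rule tendsto_lowerbound[OF lim _ G(1)]) simp
  have msub: "m A \<le> (\<Sum>i\<in>I. m (B i))" if I: "finite I" and A: "A \<in> local_events" and B: "\<And>i. i \<in> I \<Longrightarrow> B i \<in> local_events" and AB: "A \<subseteq> (\<Union>i\<in>I. B i)" 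
    for I :: "nat set" and A B
  proof (rule tendsto_le[OF G(1) _ lim])
    show "((\<lambda>k. \<Sum>i\<in>I. measure (M k) (B i)) \<longlongrightarrow> (\<Sum>i\<in>I. m (B i))) G" by (intro tendsto_sum lim)
    show "eventually (\<lambda>k. measure (M k) A \<le> (\<Sum>i\<in>I. measure (M k) (B i))) G" using MG
    proof eventually_elim
      case (elim k)
      then interpret prob_space "M k" by simp
      have Bm: "B ` I \<subseteq> sets (M k)" using B elim by auto
      have "measure (M k) A \<le> measure (M k) (\<Union>i\<in>I. B i)" using AB Bm I by (intro finite_measure_mono) auto
      also have "\<dots> \<le> (\<Sum>i\<in>I. measure (M k) (B i))" by (rule finite_measure_subadditive_finite[OF I Bm])
      finally show ?case .
    qed
  qed
  have mmono: "m A \<le> m B" if "A \<in> local_events" "B \<in> local_events" "A \<subseteq> B" for A B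
    using msub[of "{0}" A "\<lambda>_. B"] that by simp
  have m1: "m (Perms X) = 1"
  proof (rule tendsto_unique[OF G(1) lim])
    show "((\<lambda>k. measure (M k) (Perms X)) \<longlongrightarrow> 1) G"
    proof (rule tendsto_eventually)
      show "eventually (\<lambda>k. measure (M k) (Perms X) = 1) G" using MG
        by eventually_elim (metis prob_space.prob_space)
    qed
  qed
  have m_empty: "m {} = 0" by (rule tendsto_unique[OF G(1) lim]) simp
  have madd: "m (A \<union> B) = m A + m B" if AB: "A \<in> local_events" "B \<in> local_events" "A \<inter> B = {}" for A B
  proof (rule tendsto_unique[OF G(1) lim])
    have "eventually (\<lambda>k. measure (M k) A + measure (M k) B = measure (M k) (A \<union> B)) G" using MG
    proof eventually_elim
      case (elim k)
      then interpret prob_space "M k" by simp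
      show ?case using AB elim by (intro finite_measure_Union[symmetric]) auto
    qed
    then show "((\<lambda>k. measure (M k) (A \<union> B)) \<longlongrightarrow> m A + m B) G"
      by (rule Lim_transform_eventually[OF tendsto_add[OF lim lim]])
  qed
  have tight': "\<exists>T. finite T \<and> m {\<sigma> \<in> Perms X. \<sigma> x \<notin> T \<or> inv \<sigma> x \<notin> T} \<le> e" if x: "x \<in> X" "0 < e" for x e
  proof -
    obtain T where T: "finite T" "eventually (\<lambda>k. measure (M k) {\<sigma> \<in> Perms X. \<sigma> x \<notin> T \<or> inv \<sigma> x \<notin> T} \<le> e) F"
      using tight[OF x] by blast
    have "eventually (\<lambda>k. measure (M k) {\<sigma> \<in> Perms X. \<sigma> x \<notin> T \<or> inv \<sigma> x \<notin> T} \<le> e) G"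
      using T(2) G(2) by (rule filter_leD[rotated])
    then have "m {\<sigma> \<in> Perms X. \<sigma> x \<notin> T \<or> inv \<sigma> x \<notin> T} \<le> e"
      by (rule tendsto_upperbound[OF lim _ G(1)])
    then show ?thesis using T(1) by blast
  qed
  have cont: "(\<lambda>i. ennreal (m (A i))) \<longlonglongrightarrow> 0"
    if A: "range A \<subseteq> local_events" and dec: "decseq A" and empty: "(\<Inter>i. A i) = {}" for A :: "nat \<Rightarrow> (real \<Rightarrow> real) set"
  proof -
    have Ai: "A i \<in> local_events" for i using A by auto
    have "\<exists>i. m (A i) < e" if e: "0 < e" for e
    proof (rule ccontr)
      assume "\<not> (\<exists>i. m (A i) < e)"
      then have ge: "e \<le> m (A i)" for i by (simp add: not_less)
      define p where "p = from_nat_into X"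
      have pX: "p j \<in> X" for j unfolding p_def using origin by (intro from_nat_into) auto
      have p_surj: "\<exists>j. p j = x" if "x \<in> X" for x
        by (rule exI[of _ "to_nat_on X x"]) (simp add: p_def that countable_X)
      have "\<forall>j. \<exists>T. finite T \<and> m {\<sigma> \<in> Perms X. \<sigma> (p j) \<notin> T \<or> inv \<sigma> (p j) \<notin> T} \<le> e * (1/2) ^ (j + 2)"
        by (intro allI tight'[OF pX]) (use e in simp)
      from choice[OF this] obtain T where T: "finite (T j)" 
        "m {\<sigma> \<in> Perms X. \<sigma> (p j) \<notin> T j \<or> inv \<sigma> (p j) \<notin> T j} \<le> e * (1/2) ^ (j + 2)" for j by auto
      let ?bad = "\<lambda>j. {\<sigma> \<in> Perms X. \<sigma> (p j) \<notin> T j \<or> inv \<sigma> (p j) \<notin> T j}"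
      have bad: "?bad j \<in> local_events" for j by (rule local_eventI[of "{p j}"]) (use pX in auto)
      have geo: "(\<Sum>j<k. (1/2::real) ^ (j + 2)) = 1/2 - (1/2) ^ (k + 1)" for k by (induction k) auto
      have "\<forall>k. \<exists>\<sigma>. \<sigma> \<in> A k \<and> (\<forall>j<k. \<sigma> (p j) \<in> T j \<and> inv \<sigma> (p j) \<in> T j)"
      proof (rule allI, rule ccontr)
        fix k
        assume no: "\<not> (\<exists>\<sigma>. \<sigma> \<in> A k \<and> (\<forall>j<k. \<sigma> (p j) \<in> T j \<and> inv \<sigma> (p j) \<in> T j))"
        have "A k \<subseteq> (\<Union>j\<in>{..<k}. ?bad j)"
        proof
          fix \<sigma> assume s: "\<sigma> \<in> A k"
          then obtain j where "j < k" "\<not> (\<sigma> (p j) \<in> T j \<and> inv \<sigma> (p j) \<in> T j)" using no by blast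
          then show "\<sigma> \<in> (\<Union>j\<in>{..<k}. ?bad j)"
            using s local_events_sub[OF Ai[of k]] by (intro UN_I[of j]) auto
        qed
        then have "m (A k) \<le> (\<Sum>j<k. m (?bad j))" by (intro msub Ai bad) auto
        also have "\<dots> \<le> (\<Sum>j<k. e * (1/2) ^ (j + 2))" by (intro sum_mono T(2))
        also have "\<dots> = e * (1/2 - (1/2) ^ (k + 1))" by (simp only: geo sum_distrib_left[symmetric])
        also have "\<dots> < e * 1"
        proof (rule mult_strict_left_mono[OF _ e])
          have "0 < (1/2::real) ^ (k + 1)" by simp
          then show "1/2 - (1/2) ^ (k + 1) < (1::real)" by linarith
        qed
        finally show False using ge[of k] by simp
      qed
      from choice[OF this] obtain s where s: "s k \<in> A k" "j < k \<Longrightarrow> s k (p j) \<in> T j \<and> inv (s k) (p j) \<in> T j" for k j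
        by auto
      have sP: "s k \<in> Perms X" for k using s(1)[of k] local_events_sub[OF Ai[of k]] by auto
      have "\<exists>U. finite U \<and> (\<forall>k. s k x \<in> U \<and> inv (s k) x \<in> U)" if x: "x \<in> X" for x
      proof -
        obtain j where j: "x = p j" using p_surj[OF x] by blast
        have "s k x \<in> T j \<union> (\<lambda>k. s k x) ` {..j} \<union> (\<lambda>k. inv (s k) x) ` {..j} \<and> inv (s k) x \<in> T j \<union> (\<lambda>k. s k x) ` {..j} \<union> (\<lambda>k. inv (s k) x) ` {..j}" for k
          using s(2)[of j k] by (cases "j < k") (auto simp: j)
        then show ?thesis using T(1) by (intro exI[of _ "T j \<union> (\<lambda>k. s k x) ` {..j} \<union> (\<lambda>k. inv (s k) x) ` {..j}"]) auto
      qed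
      then obtain H \<tau> where H: "H \<noteq> bot" "H \<le> sequentially" and tau: "\<tau> \<in> Perms X" 
        and ev: "\<And>x. eventually (\<lambda>k. s k x = \<tau> x \<and> inv (s k) x = inv \<tau> x) H"
        by (rule cluster_permutation[of s, OF sP]) (assumption, rule that)
      have "\<tau> \<in> A i" for i
      proof -
        obtain J where J: "finite J" "J \<subseteq> X" 
          "\<And>\<sigma> \<tau>. \<sigma> \<in> A i \<Longrightarrow> \<tau> \<in> Perms X \<Longrightarrow> (\<And>x. x \<in> J \<Longrightarrow> \<sigma> x = \<tau> x \<and> inv \<sigma> x = inv \<tau> x) \<Longrightarrow> \<tau> \<in> A i"
          by (rule local_eventE[OF Ai]) blast
        have "eventually (\<lambda>k. \<forall>x\<in>J. s k x = \<tau> x \<and> inv (s k) x = inv \<tau> x) H"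
          using ev J(1) by (intro eventually_ball_finite) auto
        moreover have "eventually (\<lambda>k. i \<le> k) H" using eventually_ge_at_top H(2) by (rule filter_leD[rotated])
        ultimately have "eventually (\<lambda>k. \<tau> \<in> A i) H"
        proof eventually_elim
          case (elim k)
          have "s k \<in> A i" using s(1)[of k] decseqD[OF dec elim(2)] by auto
          then show ?case using J(3)[of "s k" \<tau>] tau elim(1) by auto
        qed
        then show ?thesis using H(1) by simp
      qed
      then show False using empty by auto
    qed
    note small = this
    have "(\<lambda>i. m (A i)) \<longlonglongrightarrow> 0"
    proof (rule LIMSEQ_I)
      fix e :: real assume "0 < e"
      then obtain i where i: "m (A i) < e" using small by blast
      have "norm (m (A j) - 0) < e" if "i \<le> j" for j
        using mmono[OF Ai Ai decseqD[OF dec that]] i m0[of "A j"] by simp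
      then show "\<exists>i. \<forall>j\<ge>i. norm (m (A j) - 0) < e" by blast
    qed
    then show ?thesis using tendsto_ennrealI[of "\<lambda>i. m (A i)" 0] by simp
  qed
  have "\<exists>\<nu> :: (real \<Rightarrow> real) set \<Rightarrow> ennreal. (\<forall>A\<in>local_events. \<nu> A = ennreal (m A)) \<and> measure_space (Perms X) (sigma_sets (Perms X) local_events) \<nu>"
  proof (rule L.caratheodory_empty_continuous)
    show "positive local_events (\<lambda>A. ennreal (m A))" by (simp add: positive_def m_empty)
    show "additive local_events (\<lambda>A. ennreal (m A))" by (auto simp: additive_def madd m0 ennreal_plus)
  qed (use cont in auto)
  then obtain \<nu> where nu: "\<And>A. A \<in> local_events \<Longrightarrow> \<nu> A = ennreal (m A)" 
    "measure_space (Perms X) (sigma_sets (Perms X) local_events) \<nu>" by blast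
  define \<mu> where "\<mu> = measure_of (Perms X) local_events \<nu>"
  have sets: "sets \<mu> = sets (perm_space X)"
    unfolding \<mu>_def sets_perm_space by (rule sets_measure_of) (rule L.space_closed)
  have em: "emeasure \<mu> A = ennreal (m A)" if "A \<in> local_events" for A
  proof -
    have "emeasure \<mu> A = \<nu> A"
      using nu(2) that L.space_closed unfolding measure_space_def
      by (intro emeasure_measure_of[OF \<mu>_def]) (auto simp: sets_perm_space sets)
    then show ?thesis using nu(1)[OF that] by simp
  qed
  have "space \<mu> = Perms X" using sets_eq_imp_space_eq[OF sets] by simp
  then have "prob_space \<mu>" using em[OF L.top] by (intro prob_spaceI) (simp add: m1)
  moreover have "((\<lambda>k. measure (M k) A) \<longlongrightarrow> measure \<mu> A) G" if "A \<in> local_events" for A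
    using lim[of A] em[OF that] m0[of A] by (simp add: measure_def)
  ultimately show ?thesis using that sets G by blast
qed

end

section \<open>Gibbs property and flow of the limit\<close>

lemma weight_cong:
  assumes "\<And>x. x \<in> \<Lambda> \<Longrightarrow> \<sigma> x = \<tau> x" shows "weight V \<Lambda> \<sigma> = weight V \<Lambda> \<tau>"
proof -
  have "\<Lambda> \<inter> \<sigma> -` \<Lambda> = \<Lambda> \<inter> \<tau> -` \<Lambda>" using assms by auto
  then show ?thesis using assms by (simp add: weight_def Hamiltonian_def)
qed

text \<open>Two boundary conditions that agree on \<open>K\<close> have corresponding classes: apply the change inside \<open>\<Lambda>\<close> that
  turns \<open>\<sigma>\<close> into \<open>\<rho>\<close> to \<open>\<tau>\<close> instead. The correspondence does not affect what is seen in \<open>K\<close>.\<close>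

lemma boundary_class_transfer:
  assumes s: "\<sigma> \<in> Perms X" and t: "\<tau> \<in> Perms X" and K: "\<Lambda> \<subseteq> K" "K \<subseteq> X"
    and agree: "\<And>x. x \<in> K \<Longrightarrow> \<sigma> x = \<tau> x" "\<And>x. x \<in> K \<Longrightarrow> inv \<sigma> x = inv \<tau> x"
    and r: "\<rho> \<in> boundary_class X \<Lambda> \<sigma>"
  defines "\<rho>' \<equiv> \<tau> \<circ> inv \<sigma> \<circ> \<rho>"
  shows "\<rho>' \<in> boundary_class X \<Lambda> \<tau>" "\<And>x. x \<in> K \<Longrightarrow> \<rho> x = \<rho>' x \<and> inv \<rho> x = inv \<rho>' x"
proof -
  note S = PermsD[OF s] and T = PermsD[OF t]
  have rP: "\<rho> \<in> Perms X" and ra: "agree_off X \<Lambda> \<rho> \<sigma>" using r by (auto simp: boundary_class_def)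
  note R = PermsD[OF rP]
  have r'P: "\<rho>' \<in> Perms X" unfolding \<rho>'_def Perms_def mem_Collect_eq
    by (intro permutes_compose PermsD(1)[OF t] PermsD(1)[OF S(8)] PermsD(1)[OF rP])
  note R' = PermsD[OF r'P]
  have eq: "\<rho> x = \<sigma> x" if "x \<in> X" "x \<notin> \<Lambda> \<or> \<rho> x \<notin> \<Lambda> \<or> \<sigma> x \<notin> \<Lambda>" for x
    by (rule agree_off_eq[OF rP s ra that])
  have off: "\<rho>' x = \<tau> x" if "x \<in> X" "x \<notin> \<Lambda>" for x
  proof -
    have "\<rho> x = \<sigma> x" by (rule eq) (use that in auto)
    then show ?thesis by (simp add: \<rho>'_def S(6))
  qed
  have off_inv: "inv \<rho>' z = inv \<tau> z" if z: "z \<in> X" "z \<notin> \<Lambda>" for z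
  proof -
    define w where "w = inv \<tau> z"
    have w: "w \<in> X" "\<tau> w = z" using z by (auto simp: w_def T)
    have "\<rho> w = \<sigma> w"
    proof (cases "w \<in> \<Lambda>")
      case True
      then have "\<sigma> w = z" using agree(1)[of w] w K by auto
      then show ?thesis using z w by (intro eq) auto
    next
      case False
      then show ?thesis using w by (intro eq) auto
    qed
    then have "\<rho>' w = z" using w by (simp add: \<rho>'_def S(6))
    then show ?thesis using R'(10) by (simp add: w_def)
  qed
  have on: "\<rho>' x = \<rho> x" if "x \<in> \<Lambda>" for x
  proof (cases "\<rho> x \<in> \<Lambda>")
    case True
    then have "inv \<sigma> (\<rho> x) = inv \<tau> (\<rho> x)" using agree(2) K by auto
    then show ?thesis by (simp add: \<rho>'_def T(5))
  next
    case False
    then have e: "\<rho> x = \<sigma> x" using that K by (intro eq) auto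
    then have "\<rho>' x = \<tau> x" by (simp add: \<rho>'_def S(6))
    also have "\<tau> x = \<rho> x" using that K agree(1)[of x] e by auto
    finally show ?thesis .
  qed
  have on_inv: "inv \<rho>' y = inv \<rho> y" if "y \<in> \<Lambda>" for y
  proof -
    have "inv \<sigma> y = inv \<tau> y" using agree(2) K that by auto
    then have "\<rho>' (inv \<rho> y) = y" by (simp add: \<rho>'_def R(5) T(5))
    then show ?thesis using R'(10) by simp
  qed
  show "\<rho>' \<in> boundary_class X \<Lambda> \<tau>" using r'P off off_inv by (auto simp: boundary_class_def agree_off_def)
  fix x assume x: "x \<in> K"
  show "\<rho> x = \<rho>' x \<and> inv \<rho> x = inv \<rho>' x"
  proof (cases "x \<in> \<Lambda>")
    case False
    then have "x \<in> X" "x \<in> X - \<Lambda>" using x K by auto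
    then have "\<rho> x = \<sigma> x" "inv \<rho> x = inv \<sigma> x" "\<rho>' x = \<tau> x" "inv \<rho>' x = inv \<tau> x"
      using ra off[of x] off_inv[of x] by (auto simp: agree_off_def)
    then show ?thesis using agree[OF x] by simp
  qed (use on on_inv in simp)
qed

context point_set begin

text \<open>It suffices to know the boundary condition on \<open>\<Lambda>\<close> and on the points that decide \<open>A\<close>.\<close>

lemma kernel_local:
  assumes L: "finite \<Lambda>" "\<Lambda> \<subseteq> X" and A: "A \<in> local_events"
  obtains K where "finite K" "K \<subseteq> X" "\<And>\<sigma> \<tau>. \<sigma> \<in> Perms X \<Longrightarrow> \<tau> \<in> Perms X \<Longrightarrow> 
    (\<And>x. x \<in> K \<Longrightarrow> \<sigma> x = \<tau> x) \<Longrightarrow> (\<And>x. x \<in> K \<Longrightarrow> inv \<sigma> x = inv \<tau> x) \<Longrightarrow>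
    measure (gibbs_kernel X V \<Lambda> \<sigma>) A = measure (gibbs_kernel X V \<Lambda> \<tau>) A"
proof -
  obtain J where J: "finite J" "J \<subseteq> X" 
    "\<And>\<sigma> \<tau>. \<sigma> \<in> A \<Longrightarrow> \<tau> \<in> Perms X \<Longrightarrow> (\<And>x. x \<in> J \<Longrightarrow> \<sigma> x = \<tau> x \<and> inv \<sigma> x = inv \<tau> x) \<Longrightarrow> \<tau> \<in> A"
    by (rule local_eventE[OF A]) blast
  define K where "K = J \<union> \<Lambda>"
  have K: "finite K" "\<Lambda> \<subseteq> K" "K \<subseteq> X" "J \<subseteq> K" using J L by (auto simp: K_def)
  show ?thesis
  proof (rule that[OF K(1,3)])
    fix \<sigma> \<tau> assume s: "\<sigma> \<in> Perms X" and t: "\<tau> \<in> Perms X"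
      and ag: "\<And>x. x \<in> K \<Longrightarrow> \<sigma> x = \<tau> x" "\<And>x. x \<in> K \<Longrightarrow> inv \<sigma> x = inv \<tau> x"
    have sum: "(\<Sum>\<rho>\<in>boundary_class X \<Lambda> \<sigma> \<inter> B. weight V \<Lambda> \<rho>) = (\<Sum>\<rho>\<in>boundary_class X \<Lambda> \<tau> \<inter> B. weight V \<Lambda> \<rho>)"
      if B: "\<And>\<sigma> \<tau>. \<sigma> \<in> B \<Longrightarrow> \<tau> \<in> Perms X \<Longrightarrow> (\<And>x. x \<in> K \<Longrightarrow> \<sigma> x = \<tau> x \<and> inv \<sigma> x = inv \<tau> x) \<Longrightarrow> \<tau> \<in> B" for B
    proof (rule sum.reindex_bij_witness[where i = "\<lambda>\<rho>. \<sigma> \<circ> inv \<tau> \<circ> \<rho>" and j = "\<lambda>\<rho>. \<tau> \<circ> inv \<sigma> \<circ> \<rho>"])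
      note tr = boundary_class_transfer[OF s t K(2,3) ag]
      fix \<rho> assume r: "\<rho> \<in> boundary_class X \<Lambda> \<sigma> \<inter> B"
      show "\<sigma> \<circ> inv \<tau> \<circ> (\<tau> \<circ> inv \<sigma> \<circ> \<rho>) = \<rho>"
        by (simp add: fun_eq_iff PermsD(5,6)[OF s] PermsD(5,6)[OF t])
      have "\<tau> \<circ> inv \<sigma> \<circ> \<rho> \<in> B"
        by (rule B[of \<rho>]) (use r tr(1)[of \<rho>] tr(2)[of \<rho>] in \<open>auto simp: boundary_class_def simp del: o_apply\<close>)
      then show "\<tau> \<circ> inv \<sigma> \<circ> \<rho> \<in> boundary_class X \<Lambda> \<tau> \<inter> B" using tr(1)[of \<rho>] r by simp
      show "weight V \<Lambda> (\<tau> \<circ> inv \<sigma> \<circ> \<rho>) = weight V \<Lambda> \<rho>"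
        by (rule weight_cong) (use tr(2)[of \<rho>] r K(2) in \<open>auto simp del: o_apply\<close>)
    next
      note tr' = boundary_class_transfer[OF t s K(2,3) ag[symmetric]]
      fix \<rho> assume r: "\<rho> \<in> boundary_class X \<Lambda> \<tau> \<inter> B"
      show "\<tau> \<circ> inv \<sigma> \<circ> (\<sigma> \<circ> inv \<tau> \<circ> \<rho>) = \<rho>"
        by (simp add: fun_eq_iff PermsD(5,6)[OF s] PermsD(5,6)[OF t])
      have "\<sigma> \<circ> inv \<tau> \<circ> \<rho> \<in> B"
        by (rule B[of \<rho>]) (use r tr'(1)[of \<rho>] tr'(2)[of \<rho>] in \<open>auto simp: boundary_class_def simp del: o_apply\<close>)
      then show "\<sigma> \<circ> inv \<tau> \<circ> \<rho> \<in> boundary_class X \<Lambda> \<sigma> \<inter> B" using tr'(1)[of \<rho>] r by simp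
    qed
    have "(\<Sum>\<rho>\<in>boundary_class X \<Lambda> \<sigma> \<inter> A. weight V \<Lambda> \<rho>) = (\<Sum>\<rho>\<in>boundary_class X \<Lambda> \<tau> \<inter> A. weight V \<Lambda> \<rho>)"
      by (rule sum) (use J(3) K(4) in blast)
    moreover have "partition_fun X V \<Lambda> \<sigma> = partition_fun X V \<Lambda> \<tau>"
      using sum[of UNIV] by (simp add: partition_fun_eq)
    ultimately show "measure (gibbs_kernel X V \<Lambda> \<sigma>) A = measure (gibbs_kernel X V \<Lambda> \<tau>) A"
      using measure_gibbs_kernel[OF s L(1) local_events_sub[OF A]] measure_gibbs_kernel[OF t L(1) local_events_sub[OF A]] by simp
  qed
qed

lemma kernel_level_sets_local:
  assumes "finite \<Lambda>" "\<Lambda> \<subseteq> X" "A \<in> local_events"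
  shows "{\<eta> \<in> Perms X. c \<le> measure (gibbs_kernel X V \<Lambda> \<eta>) A} \<in> local_events"
proof -
  obtain K where K: "finite K" "K \<subseteq> X" "\<And>\<sigma> \<tau>. \<sigma> \<in> Perms X \<Longrightarrow> \<tau> \<in> Perms X \<Longrightarrow> 
    (\<And>x. x \<in> K \<Longrightarrow> \<sigma> x = \<tau> x) \<Longrightarrow> (\<And>x. x \<in> K \<Longrightarrow> inv \<sigma> x = inv \<tau> x) \<Longrightarrow>
    measure (gibbs_kernel X V \<Lambda> \<sigma>) A = measure (gibbs_kernel X V \<Lambda> \<tau>) A"
    by (rule kernel_local[OF assms, of V]) blast
  show ?thesis
  proof (rule local_eventI[OF K(1,2)])
    fix \<sigma> \<tau> assume "\<sigma> \<in> Perms X" "\<tau> \<in> Perms X" "\<And>x. x \<in> K \<Longrightarrow> \<sigma> x = \<tau> x" "\<And>x. x \<in> K \<Longrightarrow> inv \<sigma> x = inv \<tau> x"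
    then have "measure (gibbs_kernel X V \<Lambda> \<sigma>) A = measure (gibbs_kernel X V \<Lambda> \<tau>) A" by (rule K(3))
    moreover assume "c \<le> measure (gibbs_kernel X V \<Lambda> \<sigma>) A"
    ultimately show "c \<le> measure (gibbs_kernel X V \<Lambda> \<tau>) A" by (simp only:)
  qed
qed

end

text \<open>The sum is the integral of \<open>h\<close> rounded down to a multiple of \<open>1 / n\<close>.\<close>

lemma (in prob_space) integral_layers:
  assumes meas: "\<And>c. {x \<in> space M. c \<le> h x} \<in> sets M" and h: "\<And>x. x \<in> space M \<Longrightarrow> 0 \<le> h x \<and> h x \<le> 1" and n: "0 < n"
  shows "\<bar>(LINT x|M. h x) - (\<Sum>j=1..n. measure M {x \<in> space M. real j / real n \<le> h x} / real n)\<bar> \<le> 1 / real n"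
proof -
  define l where "l x = (\<Sum>j=1..n. indicator {x \<in> space M. real j / real n \<le> h x} x / real n)" for x
  have hm: "h \<in> borel_measurable M" using meas by (simp add: borel_measurable_iff_ge)
  have hi: "integrable M h"
    by (rule integrable_const_bound[of _ 1]) (use h hm in auto)
  have li: "integrable M l" unfolding l_def using meas by (intro Bochner_Integration.integrable_sum integrable_divide) (auto simp: less_top[symmetric])
  have "(LINT x|M. l x) = (\<Sum>j=1..n. measure M {x \<in> space M. real j / real n \<le> h x} / real n)"
    unfolding l_def using meas 
    by (subst Bochner_Integration.integral_sum) (auto simp: less_top[symmetric] Int_def intro!: sum.cong arg_cong[where f = "measure M"])
  moreover have l: "l x \<le> h x \<and> h x \<le> l x + 1 / real n" if x: "x \<in> space M" for x
  proof -
    define k where "k = nat \<lfloor>real n * h x\<rfloor>"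
    have kn: "real k \<le> real n * h x" "real n * h x < real k + 1" 
      using h[OF x] by (auto simp: k_def)
    have "real k \<le> real n" using kn(1) h[OF x] by (smt (verit) mult_left_le of_nat_0_le_iff)
    then have "k \<le> n" by simp
    have "real j / real n \<le> h x \<longleftrightarrow> j \<le> k" for j
    proof -
      have "real j / real n \<le> h x \<longleftrightarrow> real j \<le> real n * h x" using n by (simp add: field_simps)
      also have "\<dots> \<longleftrightarrow> j \<le> k" using kn by linarith
      finally show ?thesis .
    qed
    then have "l x = (\<Sum>j=1..n. if j \<le> k then 1 / real n else 0)"
      using x unfolding l_def by (intro sum.cong) auto
    also have "\<dots> = (\<Sum>j=1..k. 1 / real n)"
      by (rule sum.mono_neutral_cong_right) (use \<open>k \<le> n\<close> in auto)
    finally have lx: "l x = real k / real n" by simp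
    have "real k / real n \<le> h x" using kn(1) n by (simp add: pos_divide_le_eq mult.commute)
    moreover have "h x \<le> (real k + 1) / real n" using kn(2) n by (simp add: pos_le_divide_eq mult.commute)
    ultimately show ?thesis by (simp add: lx add_divide_distrib)
  qed
  moreover have "(LINT x|M. l x) \<le> (LINT x|M. h x)" using l by (intro integral_mono li hi) auto
  moreover have "(LINT x|M. h x) \<le> (LINT x|M. l x + 1 / real n)"
    using l by (intro integral_mono hi Bochner_Integration.integrable_add li) auto
  moreover have "(LINT x|M. l x + 1 / real n) = (LINT x|M. l x) + 1 / real n"
    using li by (simp add: prob_space)
  ultimately show ?thesis by simp
qed

context point_set begin

text \<open>A local function may take infinitely many values, so its integral is approximated by finitely many
  local level events, uniformly in the measure.\<close>

lemma local_integral_tendsto: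
  fixes M :: "'k \<Rightarrow> (real \<Rightarrow> real) measure" and h :: "(real \<Rightarrow> real) \<Rightarrow> real"
  assumes mu: "prob_space \<mu>" "sets \<mu> = sets (perm_space X)"
    and M: "eventually (\<lambda>k. prob_space (M k) \<and> space (M k) = Perms X \<and> local_events \<subseteq> sets (M k)) G"
    and lim: "\<And>A. A \<in> local_events \<Longrightarrow> ((\<lambda>k. measure (M k) A) \<longlongrightarrow> measure \<mu> A) G"
    and level: "\<And>c. {x \<in> Perms X. c \<le> h x} \<in> local_events" and h: "\<And>x. x \<in> Perms X \<Longrightarrow> 0 \<le> h x \<and> h x \<le> 1"
  shows "((\<lambda>k. LINT x|M k. h x) \<longlongrightarrow> (LINT x|\<mu>. h x)) G"
proof (rule tendstoI)
  fix e :: real assume e: "0 < e"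
  obtain n :: nat where n: "0 < n" "1 / real n < e / 4" 
    using e reals_Archimedean[of "e / 4"] by (metis divide_pos_pos inverse_eq_divide zero_less_Suc zero_less_numeral)
  define S where "S P = (\<Sum>j=1..n. measure P {x \<in> Perms X. real j / real n \<le> h x} / real n)" for P
  have sp: "space \<mu> = Perms X" using sets_eq_imp_space_eq[OF mu(2)] by simp
  have mu_close: "\<bar>(LINT x|\<mu>. h x) - S \<mu>\<bar> \<le> 1 / real n"
    using prob_space.integral_layers[OF mu(1), of h n] level h local_events_measurable n by (simp add: sp mu(2) S_def)
  have "((\<lambda>k. S (M k)) \<longlongrightarrow> S \<mu>) G" unfolding S_def by (intro tendsto_sum tendsto_divide lim level tendsto_const) (use n in simp)
  then have "eventually (\<lambda>k. dist (S (M k)) (S \<mu>) < e / 4) G" by (rule tendstoD) (use e in simp)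
  then show "eventually (\<lambda>k. dist (LINT x|M k. h x) (LINT x|\<mu>. h x) < e) G" using M
  proof eventually_elim
    case (elim k)
    then have "\<bar>(LINT x|M k. h x) - S (M k)\<bar> \<le> 1 / real n"
      using prob_space.integral_layers[of "M k" h n] level h n by (auto simp: S_def)
    then show ?case using elim(1) mu_close n(2) unfolding dist_real_def by linarith
  qed
qed

text \<open>The events with measurable kernel that satisfy the Gibbs equation form a Dynkin system.\<close>

lemma gibbs_of_local_gibbs:
  assumes mu: "prob_space \<mu>" "sets \<mu> = sets (perm_space X)" and L: "finite \<Lambda>" "\<Lambda> \<subseteq> X"
    and loc: "\<And>A. A \<in> local_events \<Longrightarrow> (LINT \<eta>|\<mu>. measure (gibbs_kernel X V \<Lambda> \<eta>) A) = measure \<mu> A"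
    and A: "A \<in> sets (perm_space X)"
  shows "(\<integral>\<^sup>+ \<eta>. emeasure (gibbs_kernel X V \<Lambda> \<eta>) A \<partial>\<mu>) = emeasure \<mu> A"
proof -
  interpret prob_space \<mu> by fact
  let ?K = "gibbs_kernel X V \<Lambda>"
  have sp: "space \<mu> = Perms X" using sets_eq_imp_space_eq[OF mu(2)] by simp
  have pk: "prob_space (?K \<eta>)" if "\<eta> \<in> space \<mu>" for \<eta> using prob_space_gibbs_kernel[OF _ L(1)] that by (simp add: sp)
  have stable: "Int_stable local_events" by (auto simp: Int_stable_def)
  have "(\<lambda>\<eta>. emeasure (?K \<eta>) A) \<in> borel_measurable \<mu> \<and> (\<integral>\<^sup>+ \<eta>. emeasure (?K \<eta>) A \<partial>\<mu>) = emeasure \<mu> A"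
    using stable L.space_closed A[unfolded sets_perm_space]
  proof (induction rule: sigma_sets_induct_disjoint)
    case (basic A)
    have "{\<eta> \<in> space \<mu>. c \<le> measure (?K \<eta>) A} \<in> sets \<mu>" for c
      using kernel_level_sets_local[OF L basic] local_events_measurable by (simp add: sp mu(2))
    then have m: "(\<lambda>\<eta>. measure (?K \<eta>) A) \<in> borel_measurable \<mu>" by (simp add: borel_measurable_iff_ge)
    have e: "emeasure (?K \<eta>) A = ennreal (measure (?K \<eta>) A)" if "\<eta> \<in> space \<mu>" for \<eta>
      using finite_measure.emeasure_eq_measure[OF prob_space.finite_measure[OF pk[OF that]]] .
    have "integrable \<mu> (\<lambda>\<eta>. measure (?K \<eta>) A)"
      using m pk by (intro integrable_const_bound[of _ 1]) (auto simp: prob_space.prob_le_1)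
    then have "(\<integral>\<^sup>+ \<eta>. ennreal (measure (?K \<eta>) A) \<partial>\<mu>) = ennreal (measure \<mu> A)"
      by (subst nn_integral_eq_integral) (simp_all add: loc[OF basic])
    then have "(\<integral>\<^sup>+ \<eta>. emeasure (?K \<eta>) A \<partial>\<mu>) = emeasure \<mu> A"
      by (simp add: e emeasure_eq_measure cong: nn_integral_cong)
    moreover have "(\<lambda>\<eta>. emeasure (?K \<eta>) A) \<in> borel_measurable \<mu>"
      using m by (simp add: e cong: measurable_cong)
    ultimately show ?case by simp
  next
    case empty
    show ?case by simp
  next
    case (compl A)
    have As: "A \<in> sets \<mu>" using compl(1) by (simp add: mu(2) sets_perm_space)
    then have sub: "A \<subseteq> Perms X" using sets.sets_into_space sp by auto
    have e: "emeasure (?K \<eta>) (Perms X - A) = 1 - emeasure (?K \<eta>) A" if "\<eta> \<in> space \<mu>" for \<eta>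
      using emeasure_compl[of A "?K \<eta>"] prob_space.emeasure_space_1[OF pk[OF that]] sub
        finite_measure.emeasure_finite[OF prob_space.finite_measure[OF pk[OF that]], of A] by simp
    have "(\<integral>\<^sup>+ \<eta>. emeasure (?K \<eta>) (Perms X - A) \<partial>\<mu>) = (\<integral>\<^sup>+ \<eta>. 1 - emeasure (?K \<eta>) A \<partial>\<mu>)"
      by (rule nn_integral_cong) (rule e)
    also have "\<dots> = (\<integral>\<^sup>+ \<eta>. 1 \<partial>\<mu>) - (\<integral>\<^sup>+ \<eta>. emeasure (?K \<eta>) A \<partial>\<mu>)"
      using compl.IH pk by (intro nn_integral_diff) (auto simp: prob_space.measure_le_1 intro!: AE_I2)
    also have "\<dots> = emeasure \<mu> (Perms X - A)"
      using emeasure_compl[OF As] compl.IH by (simp add: sp emeasure_space_1[unfolded sp])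
    finally have "(\<integral>\<^sup>+ \<eta>. emeasure (?K \<eta>) (Perms X - A) \<partial>\<mu>) = emeasure \<mu> (Perms X - A)" .
    moreover have "(\<lambda>\<eta>. emeasure (?K \<eta>) (Perms X - A)) \<in> borel_measurable \<mu>"
    proof -
      have "(\<lambda>\<eta>. emeasure (?K \<eta>) A) \<in> borel_measurable \<mu>" using compl.IH by simp
      then have "(\<lambda>\<eta>. 1 - emeasure (?K \<eta>) A) \<in> borel_measurable \<mu>" by measurable
      then show ?thesis by (simp add: e cong: measurable_cong)
    qed
    ultimately show ?case by simp
  next
    case (union A)
    have As: "range A \<subseteq> sets \<mu>" using union(2) by (auto simp: mu(2) sets_perm_space)
    then have sub: "range A \<subseteq> Pow (Perms X)" using sets.sets_into_space sp by blast
    have e: "emeasure (?K \<eta>) (\<Union>i. A i) = (\<Sum>i. emeasure (?K \<eta>) (A i))" for \<eta>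
      using sub union(1) by (intro suminf_emeasure[symmetric]) auto
    have m: "(\<lambda>\<eta>. emeasure (?K \<eta>) (A i)) \<in> borel_measurable \<mu>" for i using union.IH by simp
    then have "(\<lambda>\<eta>. \<Sum>i. emeasure (?K \<eta>) (A i)) \<in> borel_measurable \<mu>" by measurable
    moreover have "(\<integral>\<^sup>+ \<eta>. (\<Sum>i. emeasure (?K \<eta>) (A i)) \<partial>\<mu>) = emeasure \<mu> (\<Union>i. A i)"
      using m union.IH suminf_emeasure[OF As union(1)] by (subst nn_integral_suminf) auto
    ultimately show ?case by (simp only: e)
  qed
  then show ?thesis by simp
qed

lemma flow_at_outside_escape:
  assumes s: "\<sigma> \<in> Perms X" "\<sigma> \<notin> escape a T" and T: "finite T" "T \<subseteq> X"
  shows "flow_at X a \<sigma> = Some (int (card {x \<in> T. x < a \<and> a < \<sigma> x}) - int (card {x \<in> T. \<sigma> x < a \<and> a < x}))"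
proof -
  have "x \<in> T" if "x \<in> X" "x < a \<and> a < \<sigma> x \<or> \<sigma> x < a \<and> a < x" for x
    using s that by (auto simp: escape_def)
  then have "flow_right X a \<sigma> = {x \<in> T. x < a \<and> a < \<sigma> x}" "flow_left X a \<sigma> = {x \<in> T. \<sigma> x < a \<and> a < x}"
    using T by (auto simp: flow_right_def flow_left_def)
  then show ?thesis using T by (simp add: flow_at_def)
qed

text \<open>The event that the flow over \<open>a\<close> carried by the points of \<open>T\<close> differs from \<open>n\<close>. Unlike the flow itself it is
  local, and if no jump over \<open>a\<close> leaves \<open>T\<close>, it decides the flow.\<close>

definition miscount :: "real \<Rightarrow> int \<Rightarrow> real set \<Rightarrow> (real \<Rightarrow> real) set" where
  "miscount a n T = {\<sigma> \<in> Perms X. int (card {x \<in> T. x < a \<and> a < \<sigma> x}) - int (card {x \<in> T. \<sigma> x < a \<and> a < x}) \<noteq> n}"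

lemma miscount_local: assumes "finite T" "T \<subseteq> X" shows "miscount a n T \<in> local_events"
  unfolding miscount_def
proof (rule local_eventI[OF assms])
  fix \<sigma> \<tau> :: "real \<Rightarrow> real" assume "\<And>x. x \<in> T \<Longrightarrow> \<sigma> x = \<tau> x"
  then have "{x \<in> T. x < a \<and> a < \<tau> x} = {x \<in> T. x < a \<and> a < \<sigma> x}" "{x \<in> T. \<tau> x < a \<and> a < x} = {x \<in> T. \<sigma> x < a \<and> a < x}" by auto
  moreover assume "int (card {x \<in> T. x < a \<and> a < \<sigma> x}) - int (card {x \<in> T. \<sigma> x < a \<and> a < x}) \<noteq> n"
  ultimately show "int (card {x \<in> T. x < a \<and> a < \<tau> x}) - int (card {x \<in> T. \<tau> x < a \<and> a < x}) \<noteq> n" by simp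
qed

text \<open>If the flow is finite, then the finitely many crossings are contained in a bounded box.\<close>

lemma flow_event_measurable:
  assumes a: "a \<notin> X"
  shows "{\<sigma> \<in> Perms X. flow_at X a \<sigma> = Some n} \<in> sets (perm_space X)"
proof -
  define T where "T k = {x \<in> X. - real k \<le> x \<and> x \<le> real k}" for k :: nat
  have T: "finite (T k)" "T k \<subseteq> X" for k using finite_bounded_part by (auto simp: T_def)
  have "{\<sigma> \<in> Perms X. flow_at X a \<sigma> = Some n} = (\<Union>k. Perms X - escape a (T k) - miscount a n (T k))"
  proof (intro set_eqI iffI)
    fix \<sigma> assume "\<sigma> \<in> {\<sigma> \<in> Perms X. flow_at X a \<sigma> = Some n}"
    then have s: "\<sigma> \<in> Perms X" and f: "flow_at X a \<sigma> = Some n" by auto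
    define W where "W = flow_right X a \<sigma> \<union> flow_left X a \<sigma>"
    have "finite W" using f by (auto simp: W_def flow_at_def split: if_splits)
    then have fin: "finite (W \<union> \<sigma> ` W)" by simp
    obtain k :: nat where k: "\<And>x. x \<in> W \<union> \<sigma> ` W \<Longrightarrow> \<bar>x\<bar> \<le> real k"
    proof -
      obtain B where B: "\<And>x. x \<in> W \<union> \<sigma> ` W \<Longrightarrow> norm x \<le> B" using finite_imp_bounded[OF fin] unfolding bounded_iff by blast
      obtain k :: nat where "B \<le> real k" using real_arch_simple by blast
      then have "\<bar>x\<bar> \<le> real k" if "x \<in> W \<union> \<sigma> ` W" for x using B[OF that] by simp
      then show ?thesis by (rule that)
    qed
    have "\<sigma> \<notin> escape a (T k)"
    proof
      assume "\<sigma> \<in> escape a (T k)"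
      then obtain p where p: "p \<in> X" "(p, \<sigma> p) \<notin> T k \<times> T k" "min p (\<sigma> p) \<le> a" "a \<le> max p (\<sigma> p)"
        by (auto simp only: escape_def)
      have "p \<noteq> a" "\<sigma> p \<noteq> a" using p(1) a PermsD(4)[OF s, of p] by auto
      then have "p \<in> W" using p by (auto simp: W_def flow_right_def flow_left_def min_def max_def split: if_splits)
      then have "\<bar>p\<bar> \<le> real k" "\<bar>\<sigma> p\<bar> \<le> real k" using k by auto
      then show False using p(1,2) PermsD(4)[OF s, of p] by (auto simp: T_def abs_le_iff)
    qed
    moreover from this have "\<sigma> \<notin> miscount a n (T k)"
      using flow_at_outside_escape[OF s _ T] f by (simp add: miscount_def)
    ultimately show "\<sigma> \<in> (\<Union>k. Perms X - escape a (T k) - miscount a n (T k))" using s by blast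
  next
    fix \<sigma> assume "\<sigma> \<in> (\<Union>k. Perms X - escape a (T k) - miscount a n (T k))"
    then obtain k where "\<sigma> \<in> Perms X" "\<sigma> \<notin> escape a (T k)" "\<sigma> \<notin> miscount a n (T k)" by blast
    then show "\<sigma> \<in> {\<sigma> \<in> Perms X. flow_at X a \<sigma> = Some n}"
      using flow_at_outside_escape[OF _ _ T, of \<sigma> a k] by (simp add: miscount_def)
  qed
  moreover have "(\<Union>k. Perms X - escape a (T k) - miscount a n (T k)) \<in> sets (perm_space X)"
    using escape_measurable local_events_measurable[OF miscount_local[OF T]] sets.top[of "perm_space X"]
    by (intro sets.countable_nat_UN) auto
  ultimately show ?thesis by simp
qed

text \<open>The limit is taken along all finite regions, ordered by inclusion.\<close>

lemma ex_gibbs_flow: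
  assumes X2: "X2 X" and V: "V1 V" "V2 V"
  shows "\<exists>\<mu>\<in>gibbs_measures X V. measure \<mu> {\<sigma> \<in> space \<mu>. flow X \<sigma> = Some n} = 1"
proof -
  define F where "F = finite_subsets_at_top X"
  define M where "M \<Lambda> = gibbs_kernel X V \<Lambda> (shift n)" for \<Lambda>
  have Fnb: "F \<noteq> bot" by (simp add: F_def)
  have evF: "eventually (\<lambda>\<Lambda>. finite \<Lambda> \<and> \<Lambda> \<subseteq> X \<and> U \<subseteq> \<Lambda>) F" if "finite U" "U \<subseteq> X" for U
    unfolding F_def using that by (rule eventually_superset)
  have Mk: "prob_space (M \<Lambda>)" "sets (perm_space X) \<subseteq> sets (M \<Lambda>)" if "finite \<Lambda>" for \<Lambda>
    using prob_space_gibbs_kernel[OF shift_Perms that] sets.sets_into_space[of _ "perm_space X"] by (auto simp: M_def)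
  have M: "eventually (\<lambda>\<Lambda>. prob_space (M \<Lambda>) \<and> space (M \<Lambda>) = Perms X \<and> local_events \<subseteq> sets (M \<Lambda>)) F"
    using evF[OF finite.emptyI empty_subsetI] 
  proof eventually_elim
    case (elim \<Lambda>)
    then show ?case using Mk(1)[of \<Lambda>] L.space_closed by (simp add: M_def)
  qed
  have esc: "\<exists>T C T0. finite T \<and> T \<subseteq> X \<and> eventually (\<lambda>\<Lambda>. measure (M \<Lambda>) (escape a T) \<le> e) F \<and>
      eventually (\<lambda>\<Lambda>. jump_bound (M \<Lambda>) a C T0) F \<and> 
      (\<forall>P. prob_space P \<longrightarrow> sets (perm_space X) \<subseteq> sets P \<longrightarrow> jump_bound P a C T0 \<longrightarrow> measure P (escape a T) \<le> e)"
    if e: "0 < e" for a e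
  proof -
    obtain C T0 where C: "0 \<le> C" "finite T0" "T0 \<subseteq> X" "eventually (\<lambda>\<Lambda>. jump_bound (M \<Lambda>) a C T0) F"
      by (rule eventually_kernel_jump_bound[OF V, of n a, folded F_def M_def]) (rule that)
    obtain T where T: "finite T" "T0 \<subseteq> T" "T \<subseteq> X" 
      "\<And>M. prob_space M \<Longrightarrow> sets (perm_space X) \<subseteq> sets M \<Longrightarrow> jump_bound M a C T0 \<Longrightarrow> measure M (escape a T) \<le> e"
      by (rule escape_small[OF X2 C(1-3) e]) (rule that)
    have "eventually (\<lambda>\<Lambda>. measure (M \<Lambda>) (escape a T) \<le> e) F"
      using C(4) evF[OF finite.emptyI empty_subsetI] by eventually_elim (use T(4) Mk in auto)
    then show ?thesis using T C(4) by blast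
  qed
  have tight: "\<exists>T. finite T \<and> eventually (\<lambda>\<Lambda>. measure (M \<Lambda>) {\<sigma> \<in> Perms X. \<sigma> x \<notin> T \<or> inv \<sigma> x \<notin> T} \<le> e) F"
    if x: "x \<in> X" and e: "0 < e" for x e
  proof -
    obtain T where T: "finite T" "eventually (\<lambda>\<Lambda>. measure (M \<Lambda>) (escape x T) \<le> e) F" using esc[OF e] by blast
    have sub: "{\<sigma> \<in> Perms X. \<sigma> x \<notin> T \<or> inv \<sigma> x \<notin> T} \<subseteq> escape x T"
    proof
      fix \<sigma> assume "\<sigma> \<in> {\<sigma> \<in> Perms X. \<sigma> x \<notin> T \<or> inv \<sigma> x \<notin> T}"
      then have s: "\<sigma> \<in> Perms X" and o: "\<sigma> x \<notin> T \<or> inv \<sigma> x \<notin> T" by auto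
      from o show "\<sigma> \<in> escape x T"
      proof
        assume "\<sigma> x \<notin> T"
        then show ?thesis unfolding escape_def using s x by (intro CollectI conjI bexI[of _ x]) auto
      next
        assume "inv \<sigma> x \<notin> T"
        then show ?thesis unfolding escape_def using s x by (intro CollectI conjI bexI[of _ "inv \<sigma> x"]) (auto simp: PermsD(5,7)[OF s])
      qed
    qed
    have "eventually (\<lambda>\<Lambda>. measure (M \<Lambda>) {\<sigma> \<in> Perms X. \<sigma> x \<notin> T \<or> inv \<sigma> x \<notin> T} \<le> e) F"
      using T(2) evF[OF finite.emptyI empty_subsetI]
    proof eventually_elim
      case (elim \<Lambda>)
      then interpret prob_space "M \<Lambda>" using Mk by auto
      have "escape x T \<in> sets (M \<Lambda>)" using Mk(2)[of \<Lambda>] escape_measurable elim by auto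
      then show ?case using finite_measure_mono[OF sub] elim(1) by linarith
    qed
    then show ?thesis using T(1) by blast
  qed
  obtain \<mu> G where mu: "prob_space \<mu>" "sets \<mu> = sets (perm_space X)" and G: "G \<noteq> bot" "G \<le> F"
    and lim: "\<And>A. A \<in> local_events \<Longrightarrow> ((\<lambda>\<Lambda>. measure (M \<Lambda>) A) \<longlongrightarrow> measure \<mu> A) G"
    by (rule tight_family_has_local_limit[OF Fnb M tight]) (assumption, assumption, rule that)
  interpret prob_space \<mu> by fact
  have sp: "space \<mu> = Perms X" using sets_eq_imp_space_eq[OF mu(2)] by simp
  note GF = filter_leD[OF G(2)]
  have gibbs: "(LINT \<eta>|\<mu>. measure (gibbs_kernel X V \<Lambda> \<eta>) A) = measure \<mu> A"
    if L: "finite \<Lambda>" "\<Lambda> \<subseteq> X" and A: "A \<in> local_events" for \<Lambda> A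
  proof (rule tendsto_unique[OF G(1)])
    let ?h = "\<lambda>\<eta>. measure (gibbs_kernel X V \<Lambda> \<eta>) A"
    have h: "0 \<le> ?h \<eta> \<and> ?h \<eta> \<le> 1" if "\<eta> \<in> Perms X" for \<eta>
      using prob_space.prob_le_1[OF prob_space_gibbs_kernel[OF that L(1)]] by simp
    show "((\<lambda>\<Lambda>'. LINT \<eta>|M \<Lambda>'. ?h \<eta>) \<longlongrightarrow> (LINT \<eta>|\<mu>. ?h \<eta>)) G"
      by (rule local_integral_tendsto[OF mu GF[OF M] lim kernel_level_sets_local[OF L A] h])
    have "eventually (\<lambda>\<Lambda>'. measure (M \<Lambda>') A = (LINT \<eta>|M \<Lambda>'. ?h \<eta>)) G"
      using GF[OF evF[OF L]]
    proof eventually_elim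
      case (elim \<Lambda>')
      interpret Q: prob_space "M \<Lambda>'" using Mk elim by auto
      have spM: "space (M \<Lambda>') = Perms X" by (simp add: M_def)
      have "integrable (M \<Lambda>') ?h"
        by (rule Q.integrable_const_bound[of _ 1]) (use h in \<open>auto simp: spM M_def measurable_def\<close>)
      then have "ennreal (LINT \<eta>|M \<Lambda>'. ?h \<eta>) = emeasure (M \<Lambda>') A"
        using gibbs_kernel_consistent[OF shift_Perms[of n], of \<Lambda>' \<Lambda> A V] elim local_events_sub[OF A]
        by (subst nn_integral_eq_integral[symmetric]) (auto simp: M_def)
      then show ?case by (simp add: Q.emeasure_eq_measure)
    qed
    then show "((\<lambda>\<Lambda>'. LINT \<eta>|M \<Lambda>'. ?h \<eta>) \<longlongrightarrow> measure \<mu> A) G"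
      by (rule Lim_transform_eventually[OF lim[OF A]])
  qed
  have "\<mu> \<in> gibbs_measures X V" unfolding gibbs_measures_def
    using mu gibbs_of_local_gibbs[OF mu _ _ gibbs] by blast
  moreover have "measure \<mu> {\<sigma> \<in> space \<mu>. flow X \<sigma> = Some n} = 1"
  proof -
    obtain a where a: "a \<notin> X" using many_points_above[of 0] by blast
    define D where "D = {\<sigma> \<in> Perms X. flow_at X a \<sigma> = Some n}"
    have D: "D \<in> sets \<mu>" unfolding D_def mu(2) by (rule flow_event_measurable[OF a])
    have eq: "{\<sigma> \<in> space \<mu>. flow X \<sigma> = Some n} = D" using flow_eq_flow_at[OF _ a] by (auto simp: D_def sp)
    \<comment> \<open>Under every finite-volume measure a wrong count in \<open>T\<close> forces a crossing that leaves \<open>T\<close>, since the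
      flow is \<open>n\<close>. So a wrong count is unlikely uniformly, and this is inherited by the limit.\<close>
    have small: "measure \<mu> (Perms X - D) \<le> e" if "0 < e" for e
    proof -
      from that have "0 < e / 2" by simp
      from esc[OF this, of a] obtain T C T0 where T: "finite T" "T \<subseteq> X" "eventually (\<lambda>\<Lambda>. measure (M \<Lambda>) (escape a T) \<le> e / 2) F"
        and J: "eventually (\<lambda>\<Lambda>. jump_bound (M \<Lambda>) a C T0) F"
        and P: "\<And>P. prob_space P \<Longrightarrow> sets (perm_space X) \<subseteq> sets P \<Longrightarrow> jump_bound P a C T0 \<Longrightarrow> measure P (escape a T) \<le> e / 2" by blast
      have "jump_bound \<mu> a C T0" unfolding jump_bound_def
      proof (intro ballI impI)
        fix p q assume pq: "p \<in> X" "q \<in> X" "(p, q) \<notin> T0 \<times> T0" "min p q \<le> a" "a \<le> max p q"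
        have "{\<sigma> \<in> Perms X. \<sigma> p = q} \<in> local_events" by (rule local_eventI[of "{p}"]) (use pq in auto)
        moreover have "eventually (\<lambda>\<Lambda>. measure (M \<Lambda>) {\<sigma> \<in> Perms X. \<sigma> p = q} \<le> C * (decay p * decay q)) G"
          using GF[OF J] by eventually_elim (use pq in \<open>simp add: jump_bound_def\<close>)
        ultimately show "measure \<mu> {\<sigma> \<in> Perms X. \<sigma> p = q} \<le> C * (decay p * decay q)"
          using tendsto_upperbound[OF lim _ G(1)] by blast
      qed
      then have 1: "measure \<mu> (escape a T) \<le> e / 2" using P[OF mu(1)] mu(2) by simp
      have "eventually (\<lambda>\<Lambda>. measure (M \<Lambda>) (miscount a n T) \<le> e / 2) G"
        using GF[OF T(3)] GF[OF evF[OF finite.emptyI empty_subsetI]]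
      proof eventually_elim
        case (elim \<Lambda>)
        then have L: "finite \<Lambda>" by simp
        have "boundary_class X \<Lambda> (shift n) \<inter> miscount a n T \<subseteq> boundary_class X \<Lambda> (shift n) \<inter> escape a T"
        proof (intro subsetI IntI)
          fix \<sigma> assume s: "\<sigma> \<in> boundary_class X \<Lambda> (shift n) \<inter> miscount a n T"
          then show "\<sigma> \<in> boundary_class X \<Lambda> (shift n)" by simp
          have "\<sigma> \<in> Perms X" "agree_off X \<Lambda> \<sigma> (shift n)" using s by (auto simp: boundary_class_def)
          then have "flow_at X a \<sigma> = Some n" using agree_off_flow[OF _ shift_Perms L _ a] shift_flow[OF a] by simp
          then show "\<sigma> \<in> escape a T" using flow_at_outside_escape[OF \<open>\<sigma> \<in> Perms X\<close> _ T(1,2), of a] s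
            by (auto simp: miscount_def)
        qed
        moreover have "miscount a n T \<subseteq> Perms X" "escape a T \<subseteq> Perms X" by (auto simp: miscount_def escape_def)
        ultimately have "measure (M \<Lambda>) (miscount a n T) \<le> measure (M \<Lambda>) (escape a T)"
          using finite_boundary_class[OF shift_Perms L] partition_fun_pos[OF shift_Perms[of n] L, of V] less_imp_le[OF weight_pos]
          by (simp add: M_def measure_gibbs_kernel[OF shift_Perms L] divide_right_mono sum_mono2)
        then show ?case using elim(1) by linarith
      qed
      then have 2: "measure \<mu> (miscount a n T) \<le> e / 2"
        by (rule tendsto_upperbound[OF lim[OF miscount_local[OF T(1,2)]] _ G(1)])
      have m: "escape a T \<in> sets \<mu>" "miscount a n T \<in> sets \<mu>"
        using escape_measurable local_events_measurable[OF miscount_local[OF T(1,2)]] by (auto simp: mu(2))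
      have "Perms X - D \<subseteq> escape a T \<union> miscount a n T"
        using flow_at_outside_escape[OF _ _ T(1,2), of _ a] by (auto simp: D_def miscount_def)
      then have "measure \<mu> (Perms X - D) \<le> measure \<mu> (escape a T \<union> miscount a n T)"
        using m by (intro finite_measure_mono) auto
      also have "\<dots> \<le> measure \<mu> (escape a T) + measure \<mu> (miscount a n T)"
        by (rule measure_Un_le[OF m])
      finally show ?thesis using 1 2 by simp
    qed
    have "measure \<mu> (Perms X - D) \<le> 0" by (rule field_le_epsilon) (use small in simp)
    then have "measure \<mu> D = 1" using prob_compl[OF D] measure_nonneg[of \<mu> "Perms X - D"] by (simp add: sp)
    then show ?thesis by (simp add: eq)
  qed
  ultimately show ?thesis by blast
qed

end

theorem lemma2p10:
  fixes X :: "real set" and V :: "real \<Rightarrow> real"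
  assumes "X1 X" and "X2 X" and "V1 V" and "V2 V"
  shows "\<forall>n::int. \<exists>\<mu> \<in> gibbs_measures X V. measure \<mu> {\<sigma> \<in> space \<mu>. flow X \<sigma> = Some n} = 1"
proof
  fix n :: int
  interpret point_set X by unfold_locales (rule assms(1))
  show "\<exists>\<mu> \<in> gibbs_measures X V. measure \<mu> {\<sigma> \<in> space \<mu>. flow X \<sigma> = Some n} = 1"
    using assms(2-4) by (rule ex_gibbs_flow)
qed

end
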